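(* For $\varepsilon>0$ let $N_\varepsilon=\sup N_\varepsilon(x,y)$, where $N_\varepsilon(x,y)$ is the number of zeroes of the adjoint variable $\psi$ along an optimal (minimum-time) trajectory of the controlled pendulum $\dot x=y,\ \dot y=-\sin x+\varepsilon u,\ |u|\le1$, connecting $(x,y)$ with $(0,0)$, and the supremum is taken over the entire phase space. There exist positive constants $c_1,c_2$ such that $$\frac{c_1}{\varepsilon}\leq N_\varepsilon\leq\frac{c_2}{\varepsilon}$$ for all sufficiently small $\varepsilon>0$.
   Context: Setting. The phase space is the cylinder $S^1\times\mathbb{R}$ with coordinates $(x,y)$, $x\in S^1=\mathbb{R}/2\pi\mathbb{Z}$, $y=\dot x\in\mathbb{R}$. For $\varepsilon>0$ the control system is $\dot x=y,\ \dot y=-\sin x+\varepsilon u$, with measurable controls $u=u(t)$, $|u|\le1$. An optimal trajectory is a trajectory $(x(t),y(t))$, $t\in[0,T]$, that goes from its initial point to the lower equilibrium $(0,0)$ in the minimal possible time (an optimal control exists for every initial point). Adjoint variables. By the Pontryagin maximum principle an optimal trajectory is accompanied by adjoint variables $(\phi,\psi)$ on $[0,T]$ satisfying $\dot\phi=(\cos x)\psi$, $\dot\psi=-\phi$, $u=\operatorname{sign}\psi$ (wherever $\psi\neq0$), and $y\phi+(-\sin x+\varepsilon u)\psi-1\equiv0$. In particular $\ddot\psi+(\cos x)\psi=0$, and the zeroes of $\psi$ are the possible switching instants of the control. Convention. $N_\varepsilon(x,y)$ is the number of zeroes of $\psi$ on $[0,T]$; $N_\varepsilon$ is the supremum of this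 number over all initial points $(x,y)$, all optimal trajectories from $(x,y)$ to $(0,0)$, and all adjoint variables $(\phi,\psi)$ on $[0,T]$ satisfying $\dot\phi=(\cos x)\psi$, $\dot\psi=-\phi$, $u=\operatorname{sign}\psi$ (wherever $\psi\neq0$) and $y\phi+(-\sin x+\varepsilon u)\psi-1\equiv0$ along the trajectory. *)

theory Defs
  imports "HOL-Analysis.Analysis" "HOL-Library.Real_Mod" "HOL-Library.Extended_Nat"
begin

text \<open>
  Points of the cylinder and curves on it are given by real angle coordinates. A curve on the
  cylinder is represented by a continuous lift, and two angles denote the same point of the circle
  iff they are congruent modulo \<open>2 * pi\<close>; this congruence is used wherever a
  trajectory is required to start or end at a given point.

  A trajectory for a measurable control is a Caratheodory solution. The equation for \<open>x\<close>
  has a continuous right-hand side and holds at every time (one-sidedly at the end points); the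
  equation for \<open>y\<close> is required in integrated form, that is, \<open>y\<close> is absolutely
  continuous and satisfies the differential equation almost everywhere. The functions are
  unconstrained outside \<open>{0..T}\<close>.
\<close>

definition admissible_control :: "real \<Rightarrow> (real \<Rightarrow> real) \<Rightarrow> bool" where
  "admissible_control T u \<longleftrightarrow>
     u \<in> borel_measurable (lebesgue_on {0..T}) \<and> (\<forall>t\<in>{0..T}. \<bar>u t\<bar> \<le> 1)"

definition pendulum_trajectory ::
  "real \<Rightarrow> real \<Rightarrow> (real \<Rightarrow> real) \<Rightarrow> (real \<Rightarrow> real) \<Rightarrow> (real \<Rightarrow> real) \<Rightarrow> bool" where
  "pendulum_trajectory \<epsilon> T x y u \<longleftrightarrow>
     0 \<le> T \<and> admissible_control T u \<and>
     (\<forall>t\<in>{0..T}. (x has_real_derivative y t) (at t within {0..T})) \<and>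
     (\<forall>t\<in>{0..T}. ((\<lambda>s. - sin (x s) + \<epsilon> * u s) has_integral (y t - y 0)) {0..t})"

definition steers_to_equilibrium ::
  "real \<Rightarrow> real \<Rightarrow> real \<Rightarrow> real \<Rightarrow> (real \<Rightarrow> real) \<Rightarrow> (real \<Rightarrow> real) \<Rightarrow> (real \<Rightarrow> real) \<Rightarrow> bool" where
  "steers_to_equilibrium \<epsilon> x0 y0 T x y u \<longleftrightarrow>
     pendulum_trajectory \<epsilon> T x y u \<and>
     [x 0 = x0] (rmod 2 * pi) \<and> y 0 = y0 \<and>
     [x T = 0] (rmod 2 * pi) \<and> y T = 0"

definition optimal_trajectory ::
  "real \<Rightarrow> real \<Rightarrow> real \<Rightarrow> real \<Rightarrow> (real \<Rightarrow> real) \<Rightarrow> (real \<Rightarrow> real) \<Rightarrow> (real \<Rightarrow> real) \<Rightarrow> bool" where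
  "optimal_trajectory \<epsilon> x0 y0 T x y u \<longleftrightarrow>
     steers_to_equilibrium \<epsilon> x0 y0 T x y u \<and>
     (\<forall>T' x' y' u'. steers_to_equilibrium \<epsilon> x0 y0 T' x' y' u' \<longrightarrow> T \<le> T')"

text \<open>
  The control of a trajectory only matters up to null sets. The sign condition and the
  Hamiltonian identity are imposed at every time, i.e. for the representative of the control that
  equals \<open>sgn (\<psi> t)\<close> wherever \<open>\<psi> t \<noteq> 0\<close>; as the
  supremum below ranges over all representatives, this loses nothing.
\<close>

definition adjoint_variables ::
  "real \<Rightarrow> real \<Rightarrow> (real \<Rightarrow> real) \<Rightarrow> (real \<Rightarrow> real) \<Rightarrow> (real \<Rightarrow> real) \<Rightarrow>
    (real \<Rightarrow> real) \<Rightarrow> (real \<Rightarrow> real) \<Rightarrow> bool" where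
  "adjoint_variables \<epsilon> T x y u \<phi> \<psi> \<longleftrightarrow>
     (\<forall>t\<in>{0..T}. (\<phi> has_real_derivative cos (x t) * \<psi> t) (at t within {0..T})) \<and>
     (\<forall>t\<in>{0..T}. (\<psi> has_real_derivative - \<phi> t) (at t within {0..T})) \<and>
     (\<forall>t\<in>{0..T}. \<psi> t \<noteq> 0 \<longrightarrow> u t = sgn (\<psi> t)) \<and>
     (\<forall>t\<in>{0..T}. y t * \<phi> t + (- sin (x t) + \<epsilon> * u t) * \<psi> t - 1 = 0)"

definition num_zeroes :: "real \<Rightarrow> (real \<Rightarrow> real) \<Rightarrow> enat" where
  "num_zeroes T \<psi> =
     (let Z = {t \<in> {0..T}. \<psi> t = 0} in if finite Z then enat (card Z) else \<infinity>)"

text \<open>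
  An optimal trajectory and its adjoint variables need not be unique, so the number attached to an
  initial point is a supremum as well.
\<close>

definition N_point :: "real \<Rightarrow> real \<Rightarrow> real \<Rightarrow> enat" where
  "N_point \<epsilon> x0 y0 =
     Sup {num_zeroes T \<psi> | T x y u \<phi> \<psi>.
       optimal_trajectory \<epsilon> x0 y0 T x y u \<and> adjoint_variables \<epsilon> T x y u \<phi> \<psi>}"

definition N_sup :: "real \<Rightarrow> enat" where
  "N_sup \<epsilon> = (SUP (x0, y0) \<in> UNIV. N_point \<epsilon> x0 y0)"

end

theory Submission
  imports Defs "HOL-Complex_Analysis.Great_Picard"
begin

text \<open>
  Upper bound: at a zero of \<open>\<psi>\<close> the Hamiltonian identity reads \<open>y \<phi> = 1\<close>, so between two consecutive
  zeroes the pendulum comes to rest. From a state of rest the origin can be reached in time \<open>O(1 / \<epsilon>)\<close>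
  by braking and a final manoeuvre near the equilibrium, so an optimal trajectory lasts at most that long after its
  first rest; and zeroes of a solution of \<open>\<psi>'' = - cos x \<psi>\<close> are at least one time unit apart.

  Lower bound: reverse time and minimise \<open>T + K (1 + cos (x T))\<close> over all trajectories issuing from the
  equilibrium. A minimiser is time-optimal for its end point. As the end point is free, the
  first-order conditions need no separation argument and produce adjoint variables that are automatically
  normal, with \<open>\<psi> T = 0\<close>. For \<open>K\<close> of order \<open>1 / \<epsilon>\<close> the end point satisfies \<open>cos (x T) \<le> 0\<close>, so the
  energy rises by a fixed amount; this takes time of order \<open>1 / \<epsilon>\<close>, during which \<open>cos x \<ge> 1 / 2\<close>, and
  Sturm comparison gives a zero of \<open>\<psi>\<close> in every time interval of length \<open>5\<close>.
\<close>

text \<open>Initial speeds are arbitrary, so the time up to the first rest has no uniform bound;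
  this forces the upper bound to count zeroes from a rest on. Two obstacles shape the way from rest
  to the origin. Oscillation periods blow up logarithmically at the separatrix, so energy loss is
  controlled by pointwise Lyapunov functions and not averaged over periods. And braking does not
  move a pendulum that rests at an equilibrium, so such a pendulum is first kicked away. For the
  lower bound, \<open>K\<close> is also the bound on the time from the upper equilibrium at rest to
  the origin. The reversed swing therefore costs at most \<open>K\<close> without penalty, and no
  minimiser can end with \<open>cos (x T) > 0\<close>. Stationarity in the end time supplies the
  constant 1 of the Hamiltonian identity. Minimising sequences of controls converge only weakly; in
  terms of primitives this is uniform convergence, but the first-order condition then comes in
  integrated form and the bang-bang law has to be recovered from it. The numerical constants are
  convenient, not optimised.\<close>

section \<open>Planar Lipschitz differential equations\<close>

text \<open>Picard iteration in an exponentially weighted sup norm: with the weight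
  \<open>exp (- 2 * L * t)\<close> the integral operator halves distances on the whole interval,
  however long, so no short-time solutions need to be glued.\<close>

lemma lipschitz_ode_exists:
  fixes F :: "real \<Rightarrow> 'a::euclidean_space \<Rightarrow> 'a"
  assumes T: "0 \<le> T" and L: "0 < L"
    and cont: "\<And>z. continuous_on {0..T} z \<Longrightarrow> continuous_on {0..T} (\<lambda>t. F t (z t))"
    and lip: "\<And>t v w. t \<in> {0..T} \<Longrightarrow> norm (F t v - F t w) \<le> L * norm (v - w)"
  obtains z where "z 0 = z0"
    "\<And>t. t \<in> {0..T} \<Longrightarrow> (z has_vector_derivative F t (z t)) (at t within {0..T})"
proof -
  \<comment> \<open>Bounded continuous functions live on the whole line, so curves on
    \<open>{0..T}\<close> are extended by clamping time.\<close>
  define c where "c t = max 0 (min T t)" for t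
  have c_in: "c t \<in> {0..T}" and c_id: "t \<in> {0..T} \<Longrightarrow> c t = t" for t
    using T by (auto simp: c_def)
  have c_cont: "continuous_on UNIV c" unfolding c_def by (intro continuous_intros)
  define G where "G z s = F s (exp (2 * L * s) *\<^sub>R z s)" for z :: "real \<Rightarrow> 'a" and s
  have G_cont: "continuous_on {0..T} (G z)" if "continuous_on {0..T} z" for z
    unfolding G_def using that by (intro cont continuous_intros)
  \<comment> \<open>The Picard operator conjugated with the weight: the unknown is
    \<open>exp (- 2 * L * t)\<close> times the solution.\<close>
  define h where "h z t = exp (- (2 * L * t)) *\<^sub>R (z0 + integral {0..t} (G z))" for z :: "real \<Rightarrow> 'a" and t
  have h_cont: "continuous_on {0..T} (h z)" if "continuous_on {0..T} z" for z
    unfolding h_def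
    by (intro continuous_intros indefinite_integral_continuous_1 integrable_continuous_real G_cont that)
  have h_bc: "(\<lambda>t. h z (c t)) \<in> bcontfun" if "continuous_on {0..T} z" for z
  proof -
    have "continuous_on UNIV (\<lambda>t. h z (c t))"
      by (rule continuous_on_compose2[OF h_cont[OF that] c_cont]) (use c_in in auto)
    moreover have "bounded (h z ` {0..T})"
      by (intro compact_imp_bounded compact_continuous_image h_cont that) auto
    then have "bounded (range (\<lambda>t. h z (c t)))"
      by (rule bounded_subset) (use c_in in blast)
    ultimately show ?thesis by (simp add: bcontfun_def)
  qed
  define \<Phi> where "\<Phi> z = Bcontfun (\<lambda>t. h (apply_bcontfun z) (c t))" for z :: "real \<Rightarrow>\<^sub>C 'a"
  have \<Phi>: "apply_bcontfun (\<Phi> z) t = h (apply_bcontfun z) (c t)" for z t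
    unfolding \<Phi>_def by (subst Bcontfun_inverse) (auto intro!: h_bc)
  have "dist (\<Phi> v) (\<Phi> w) \<le> (1/2) * dist v w" for v w
  proof (rule dist_bound)
    fix t0
    define t where "t = c t0"
    have t: "t \<in> {0..T}" using c_in t_def by auto
    have iv: "G v integrable_on {0..t}" and iw: "G w integrable_on {0..t}"
      using t by (auto intro!: integrable_continuous_real continuous_on_subset[OF G_cont])
    have ie: "((\<lambda>s. L * (exp (2 * L * s) * dist v w)) has_integral
        (exp (2 * L * t) * dist v w / 2 - exp (2 * L * 0) * dist v w / 2)) {0..t}"
      using t L by (intro fundamental_theorem_of_calculus)
        (auto intro!: derivative_eq_intros simp: has_real_derivative_iff_has_vector_derivative[symmetric])
    have "norm (integral {0..t} (G v) - integral {0..t} (G w)) = norm (integral {0..t} (\<lambda>s. G v s - G w s))"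
      using iv iw by (simp add: integral_diff)
    also have "\<dots> \<le> integral {0..t} (\<lambda>s. L * (exp (2 * L * s) * dist v w))"
    proof (rule integral_norm_bound_integral)
      fix s assume s: "s \<in> {0..t}"
      have "norm (G v s - G w s) \<le> L * norm (exp (2 * L * s) *\<^sub>R v s - exp (2 * L * s) *\<^sub>R w s)"
        unfolding G_def using s t by (intro lip) auto
      also have "\<dots> = L * (exp (2 * L * s) * dist (v s) (w s))"
        by (simp add: dist_norm flip: scaleR_diff_right)
      also have "\<dots> \<le> L * (exp (2 * L * s) * dist v w)"
        using L by (intro mult_left_mono dist_bounded) auto
      finally show "norm (G v s - G w s) \<le> \<dots>" .
    qed (use iv iw ie in \<open>auto intro!: integrable_diff\<close>)
    also have "\<dots> = exp (2 * L * t) * dist v w / 2 - dist v w / 2"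
      using integral_unique[OF ie] by simp
    finally have *: "norm (integral {0..t} (G v) - integral {0..t} (G w)) \<le> exp (2 * L * t) * (dist v w / 2)"
      using zero_le_dist[of v w] by argo
    have "dist (\<Phi> v t0) (\<Phi> w t0) = exp (- (2 * L * t)) * norm (integral {0..t} (G v) - integral {0..t} (G w))"
      by (simp add: \<Phi> h_def dist_norm t_def flip: scaleR_diff_right)
    also have "\<dots> \<le> exp (- (2 * L * t)) * (exp (2 * L * t) * (dist v w / 2))"
      by (intro mult_left_mono *) auto
    also have "\<dots> = 1/2 * dist v w" by (simp flip: mult.assoc exp_add)
    finally show "dist (\<Phi> v t0) (\<Phi> w t0) \<le> 1/2 * dist v w" .
  qed
  then have "\<exists>!z. \<Phi> z = z" by (intro banach_fix_type[of "1/2"]) auto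
  then obtain f where f: "\<Phi> f = f" by blast
  define z where "z t = exp (2 * L * t) *\<^sub>R apply_bcontfun f t" for t
  have zG: "F s (z s) = G f s" for s by (simp add: z_def G_def)
  have z: "z t = z0 + integral {0..t} (\<lambda>s. F s (z s))" if "t \<in> {0..T}" for t
  proof -
    have "apply_bcontfun f t = h (apply_bcontfun f) t" using \<Phi>[of f t] f c_id[OF that] by simp
    then show ?thesis unfolding zG by (simp add: z_def h_def flip: exp_add)
  qed
  show thesis
  proof
    show "z 0 = z0" using z[of 0] T by simp
    fix t assume t: "t \<in> {0..T}"
    have "((\<lambda>t. z0 + integral {0..t} (\<lambda>s. F s (z s))) has_vector_derivative 0 + F t (z t)) (at t within {0..T})"
      by (intro has_vector_derivative_add has_vector_derivative_const integral_has_vector_derivative t)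
        (simp add: zG G_cont)
    then show "(z has_vector_derivative F t (z t)) (at t within {0..T})"
      using has_vector_derivative_transform[OF t z] by simp
  qed
qed

lemma lipschitz_ode_exists_planar:
  fixes f g :: "real \<Rightarrow> real \<Rightarrow> real \<Rightarrow> real"
  assumes T: "0 \<le> T" and L: "0 < L"
    and cf: "\<And>p q. continuous_on {0..T} p \<Longrightarrow> continuous_on {0..T} q \<Longrightarrow> continuous_on {0..T} (\<lambda>t. f t (p t) (q t))"
    and cg: "\<And>p q. continuous_on {0..T} p \<Longrightarrow> continuous_on {0..T} q \<Longrightarrow> continuous_on {0..T} (\<lambda>t. g t (p t) (q t))"
    and lf: "\<And>t p q p' q'. t \<in> {0..T} \<Longrightarrow> \<bar>f t p q - f t p' q'\<bar> \<le> L * (\<bar>p - p'\<bar> + \<bar>q - q'\<bar>)"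
    and lg: "\<And>t p q p' q'. t \<in> {0..T} \<Longrightarrow> \<bar>g t p q - g t p' q'\<bar> \<le> L * (\<bar>p - p'\<bar> + \<bar>q - q'\<bar>)"
  obtains x y where "x 0 = x0" "y 0 = y0"
    "\<And>t. t \<in> {0..T} \<Longrightarrow> (x has_real_derivative f t (x t) (y t)) (at t within {0..T})"
    "\<And>t. t \<in> {0..T} \<Longrightarrow> (y has_real_derivative g t (x t) (y t)) (at t within {0..T})"
proof -
  define F where "F t z = (f t (fst z) (snd z), g t (fst z) (snd z))" for t and z :: "real \<times> real"
  have cF: "continuous_on {0..T} (\<lambda>t. F t (z t))" if "continuous_on {0..T} z" for z
    unfolding F_def using that by (intro continuous_intros cf cg)
  have lF: "norm (F t v - F t w) \<le> (4 * L) * norm (v - w)" if "t \<in> {0..T}" for t v w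
  proof -
    have n: "\<bar>fst v - fst w\<bar> \<le> norm (v - w)" "\<bar>snd v - snd w\<bar> \<le> norm (v - w)"
      using norm_fst_le[of "fst (v - w)" "snd (v - w)"] norm_snd_le[of "snd (v - w)" "fst (v - w)"] by (auto simp: minus_prod_def)
    have "norm (F t v - F t w) \<le> \<bar>f t (fst v) (snd v) - f t (fst w) (snd w)\<bar> + \<bar>g t (fst v) (snd v) - g t (fst w) (snd w)\<bar>"
      unfolding F_def by (simp add: norm_Pair_le[THEN order_trans])
    also have "\<dots> \<le> 2 * (L * (\<bar>fst v - fst w\<bar> + \<bar>snd v - snd w\<bar>))"
      using lf[OF that, of "fst v" "snd v" "fst w" "snd w"] lg[OF that, of "fst v" "snd v" "fst w" "snd w"] by linarith
    also have "\<dots> \<le> 2 * (L * (norm (v - w) + norm (v - w)))"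
      using L n by (intro mult_left_mono add_mono) auto
    finally show ?thesis by simp
  qed
  have L4: "0 < 4 * L" using L by simp
  obtain z where z: "z 0 = (x0, y0)"
    "\<And>t. t \<in> {0..T} \<Longrightarrow> (z has_vector_derivative F t (z t)) (at t within {0..T})"
    using lipschitz_ode_exists[OF T L4 cF lF] by blast
  show thesis
  proof (rule that[of "\<lambda>t. fst (z t)" "\<lambda>t. snd (z t)"])
    fix t assume "t \<in> {0..T}"
    from z(2)[OF this] show "((\<lambda>t. fst (z t)) has_real_derivative f t (fst (z t)) (snd (z t))) (at t within {0..T})"
      "((\<lambda>t. snd (z t)) has_real_derivative g t (fst (z t)) (snd (z t))) (at t within {0..T})"
      unfolding has_real_derivative_iff_has_vector_derivative has_vector_derivative_def F_def
      by (auto dest: has_derivative_fst has_derivative_snd)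
  qed (use z in auto)
qed

section \<open>Concatenation of trajectories\<close>

text \<open>Measurability of the control comes for free: the right-hand side has an integral, and
  removing the continuous term \<open>sin (x t)\<close> and the factor \<open>\<epsilon>\<close>
  leaves \<open>u\<close> integrable.\<close>

lemma pendulum_trajectoryI:
  assumes "0 \<le> T" "0 < \<epsilon>" and u: "\<And>t. t \<in> {0..T} \<Longrightarrow> \<bar>u t\<bar> \<le> 1"
    and x: "\<And>t. t \<in> {0..T} \<Longrightarrow> (x has_real_derivative y t) (at t within {0..T})"
    and y: "\<And>t. t \<in> {0..T} \<Longrightarrow> ((\<lambda>s. - sin (x s) + \<epsilon> * u s) has_integral (y t - y 0)) {0..t}"
  shows "pendulum_trajectory \<epsilon> T x y u"
proof -
  have "continuous_on {0..T} x"
    using x by (intro DERIV_continuous_on) auto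
  then have s: "(\<lambda>t. sin (x t)) integrable_on {0..T}"
    by (intro integrable_continuous_real continuous_intros)
  have "(\<lambda>s. - sin (x s) + \<epsilon> * u s) integrable_on {0..T}"
    using y[of T] \<open>0 \<le> T\<close> by (auto simp: integrable_on_def)
  from integrable_add[OF this s] have "(\<lambda>s. \<epsilon> * u s) integrable_on {0..T}" by simp
  from integrable_on_cmult_left[OF this, of "1 / \<epsilon>"] have "u integrable_on {0..T}"
    using \<open>0 < \<epsilon>\<close> by simp
  then have "u \<in> borel_measurable (lebesgue_on {0..T})" by (rule integrable_imp_measurable)
  with assms show ?thesis unfolding pendulum_trajectory_def admissible_control_def by auto
qed

text \<open>Inverse dynamics: a path may be designed first and its control read off, as long as the
  required force stays within \<open>\<epsilon>\<close>. All steering manoeuvres below are built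
  this way.\<close>

lemma pendulum_trajectory_smoothI:
  assumes "0 \<le> T" "0 < \<epsilon>"
    and x: "\<And>t. t \<in> {0..T} \<Longrightarrow> (x has_real_derivative y t) (at t within {0..T})"
    and y: "\<And>t. t \<in> {0..T} \<Longrightarrow> (y has_real_derivative a t) (at t within {0..T})"
    and a: "\<And>t. t \<in> {0..T} \<Longrightarrow> \<bar>a t + sin (x t)\<bar> \<le> \<epsilon>"
  shows "pendulum_trajectory \<epsilon> T x y (\<lambda>t. (a t + sin (x t)) / \<epsilon>)"
proof (rule pendulum_trajectoryI[OF assms(1,2)])
  fix t assume t: "t \<in> {0..T}"
  show "\<bar>(a t + sin (x t)) / \<epsilon>\<bar> \<le> 1" using a[OF t] \<open>0 < \<epsilon>\<close> by (simp add: field_simps)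
  have "(a has_integral (y t - y 0)) {0..t}"
    using t by (intro fundamental_theorem_of_calculus)
      (auto simp flip: has_real_derivative_iff_has_vector_derivative intro!: has_field_derivative_subset[OF y])
  then show "((\<lambda>s. - sin (x s) + \<epsilon> * ((a s + sin (x s)) / \<epsilon>)) has_integral (y t - y 0)) {0..t}"
    using \<open>0 < \<epsilon>\<close> by simp
qed (use x in auto)

lemma pendulum_trajectory_continuous:
  assumes "pendulum_trajectory \<epsilon> T x y u"
  shows "continuous_on {0..T} x" "continuous_on {0..T} y"
proof -
  show "continuous_on {0..T} x"
    using assms by (intro DERIV_continuous_on) (auto simp: pendulum_trajectory_def)
  have T: "0 \<le> T" and y: "\<And>t. t \<in> {0..T} \<Longrightarrow> ((\<lambda>s. - sin (x s) + \<epsilon> * u s) has_integral (y t - y 0)) {0..t}"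
    using assms by (auto simp: pendulum_trajectory_def)
  have "continuous_on {0..T} (\<lambda>t. y 0 + integral {0..t} (\<lambda>s. - sin (x s) + \<epsilon> * u s))"
    using y[of T] T by (intro continuous_intros indefinite_integral_continuous_1) (auto simp: integrable_on_def)
  then show "continuous_on {0..T} y"
    by (rule continuous_on_eq) (metis integral_unique[OF y] add.commute diff_add_cancel)
qed

lemma pendulum_trajectory_integral:
  assumes "pendulum_trajectory \<epsilon> T x y u" "0 \<le> s" "s \<le> t" "t \<le> T"
  shows "((\<lambda>s. - sin (x s) + \<epsilon> * u s) has_integral (y t - y s)) {s..t}"
proof -
  have y: "\<And>t. t \<in> {0..T} \<Longrightarrow> ((\<lambda>s. - sin (x s) + \<epsilon> * u s) has_integral (y t - y 0)) {0..t}"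
    using assms by (auto simp: pendulum_trajectory_def)
  have "(\<lambda>s. - sin (x s) + \<epsilon> * u s) integrable_on {s..t}"
    by (rule integrable_on_subinterval[of _ "{0..t}"]) (use y[of t] assms in \<open>auto simp: integrable_on_def\<close>)
  then obtain I where I: "((\<lambda>s. - sin (x s) + \<epsilon> * u s) has_integral I) {s..t}" by blast
  have "((\<lambda>s. - sin (x s) + \<epsilon> * u s) has_integral ((y s - y 0) + I)) {0..t}"
    using assms y[of s] I by (intro has_integral_combine[of 0 s t]) auto
  with y[of t] assms have "y t - y 0 = (y s - y 0) + I"
    by (intro has_integral_unique) auto
  with I show ?thesis by simp
qed

lemma pendulum_trajectory_restrict:
  assumes "pendulum_trajectory \<epsilon> T x y u" "0 \<le> T'" "T' \<le> T"
  shows "pendulum_trajectory \<epsilon> T' x y u"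
proof -
  have "u \<in> borel_measurable (lebesgue_on {0..T'})"
    by (rule measurable_restrict_mono[where A = "{0..T}"])
      (use assms in \<open>auto simp: pendulum_trajectory_def admissible_control_def\<close>)
  moreover have "(x has_real_derivative y t) (at t within {0..T'})" if "t \<in> {0..T'}" for t
    by (rule has_field_derivative_subset[of _ _ _ "{0..T}"])
      (use assms that in \<open>auto simp: pendulum_trajectory_def\<close>)
  ultimately show ?thesis using assms by (auto simp: pendulum_trajectory_def admissible_control_def)
qed

text \<open>Two lifts whose end points agree only modulo the period must be aligned before they can
  be concatenated.\<close>

lemma pendulum_trajectory_add_period:
  assumes "pendulum_trajectory \<epsilon> T x y u" "[c = 0] (rmod 2 * pi)"
  shows "pendulum_trajectory \<epsilon> T (\<lambda>t. x t + c) y u"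
proof -
  obtain n where "0 = c + of_int n * (2 * pi)" using assms(2) unfolding rcong_altdef by blast
  then have c: "c = 2 * pi * of_int (- n)" by (simp add: algebra_simps)
  have "sin (x t + c) = sin (x t)" for t
    unfolding c sin_add using sin_int_2pin[of "- n"] cos_int_2pin[of "- n"] by simp
  then show ?thesis using assms(1)
    by (auto simp: pendulum_trajectory_def intro!: derivative_eq_intros)
qed

lemma pendulum_trajectory_append:
  assumes "0 < \<epsilon>" and 1: "pendulum_trajectory \<epsilon> T1 x1 y1 u1" and 2: "pendulum_trajectory \<epsilon> T2 x2 y2 u2"
    and eq: "x2 0 = x1 T1" "y2 0 = y1 T1"
  shows "pendulum_trajectory \<epsilon> (T1 + T2) (\<lambda>t. if t \<in> {0..T1} then x1 t else x2 (t - T1))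
     (\<lambda>t. if t \<in> {0..T1} then y1 t else y2 (t - T1)) (\<lambda>t. if t \<in> {0..T1} then u1 t else u2 (t - T1))"
    (is "pendulum_trajectory _ _ ?x ?y ?u")
proof (rule pendulum_trajectoryI)
  have T: "0 \<le> T1" "0 \<le> T2" using 1 2 by (auto simp: pendulum_trajectory_def)
  then show "0 \<le> T1 + T2" by simp
  fix t assume t: "t \<in> {0..T1 + T2}"
  show "\<bar>?u t\<bar> \<le> 1" using t 1 2 by (auto simp: pendulum_trajectory_def admissible_control_def)
  have d2: "((\<lambda>t. x2 (t - T1)) has_real_derivative y2 (t - T1)) (at t within {T1..T1 + T2})"
    if "t \<in> {T1..T1 + T2}" for t
  proof -
    have h1: "(x2 has_real_derivative y2 (t - T1)) (at (t - T1) within (\<lambda>t. t - T1) ` {T1..T1 + T2})"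
      using 2 that by (auto simp: pendulum_trajectory_def)
    have h2: "((\<lambda>t. t - T1) has_real_derivative 1) (at t within {T1..T1 + T2})"
      by (auto intro!: derivative_eq_intros)
    show ?thesis using DERIV_image_chain[OF h1 h2] by (simp add: o_def)
  qed
  show "(?x has_real_derivative ?y t) (at t within {0..T1 + T2})"
    unfolding has_real_derivative_iff_has_vector_derivative
    by (rule has_vector_derivative_If_within_closures[where T = "{T1..T1 + T2}"])
      (use t T eq d2 1 in \<open>auto simp: pendulum_trajectory_def Un_absorb2 Un_absorb1 insert_absorb
        Int_atLeastAtMost simp flip: has_real_derivative_iff_has_vector_derivative\<close>)
  let ?f = "\<lambda>s. - sin (?x s) + \<epsilon> * ?u s"
  have *: "(?f has_integral (y1 s - y1 0)) {0..s}" if "s \<in> {0..T1}" for s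
  proof -
    have "((\<lambda>s. - sin (x1 s) + \<epsilon> * u1 s) has_integral (y1 s - y1 0)) {0..s}"
      using 1 that by (auto simp: pendulum_trajectory_def)
    then show ?thesis by (rule has_integral_eq[rotated]) (use that in auto)
  qed
  show "(?f has_integral (?y t - ?y 0)) {0..t}"
  proof (cases "t \<le> T1")
    case True
    then show ?thesis using * t T by auto
  next
    case False
    have "((\<lambda>s. - sin (x2 s) + \<epsilon> * u2 s) has_integral (y2 (t - T1) - y2 0)) {0..t - T1}"
      using 2 t False by (auto simp: pendulum_trajectory_def)
    from has_integral_shift_real_ivl[OF this, of "- T1"]
    have "((\<lambda>s. - sin (x2 (s - T1)) + \<epsilon> * u2 (s - T1)) has_integral (y2 (t - T1) - y2 0)) {T1..t}"
      by simp
    \<comment> \<open>At \<open>T1\<close> the glued control takes the value of the first piece; a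
      single point does not affect the integral.\<close>
    then have "(?f has_integral (y2 (t - T1) - y2 0)) {T1..t}"
      by (rule has_integral_spike_finite[of "{T1}", rotated 2]) auto
    from has_integral_combine[OF _ _ *[of T1] this] have
      "(?f has_integral ((y1 T1 - y1 0) + (y2 (t - T1) - y2 0))) {0..t}" using T False by auto
    then show ?thesis using False T eq by (simp add: algebra_simps)
  qed
qed fact

definition steerable :: "real \<Rightarrow> real \<Rightarrow> real \<times> real \<Rightarrow> real \<times> real \<Rightarrow> bool" where
  "steerable \<epsilon> T p q \<longleftrightarrow> (\<exists>x y u. pendulum_trajectory \<epsilon> T x y u \<and>
     [x 0 = fst p] (rmod 2 * pi) \<and> y 0 = snd p \<and> [x T = fst q] (rmod 2 * pi) \<and> y T = snd q)"

lemma steerableI: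
  "pendulum_trajectory \<epsilon> T x y u \<Longrightarrow> [x 0 = x0] (rmod 2 * pi) \<Longrightarrow> y 0 = y0 \<Longrightarrow>
    [x T = x1] (rmod 2 * pi) \<Longrightarrow> y T = y1 \<Longrightarrow> steerable \<epsilon> T (x0, y0) (x1, y1)"
  unfolding steerable_def by auto

lemma steerable_trans:
  assumes "0 < \<epsilon>" "steerable \<epsilon> T1 p q" "steerable \<epsilon> T2 q r"
  shows "steerable \<epsilon> (T1 + T2) p r"
proof -
  obtain x1 y1 u1 where 1: "pendulum_trajectory \<epsilon> T1 x1 y1 u1"
    "[x1 0 = fst p] (rmod 2 * pi)" "y1 0 = snd p" "[x1 T1 = fst q] (rmod 2 * pi)" "y1 T1 = snd q"
    using assms(2) by (auto simp: steerable_def)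
  obtain x2 y2 u2 where 2: "pendulum_trajectory \<epsilon> T2 x2 y2 u2"
    "[x2 0 = fst q] (rmod 2 * pi)" "y2 0 = snd q" "[x2 T2 = fst r] (rmod 2 * pi)" "y2 T2 = snd r"
    using assms(3) by (auto simp: steerable_def)
  define c where "c = x1 T1 - x2 0"
  have "[x1 T1 = x2 0] (rmod 2 * pi)"
    using 1(4) 2(2) rcong_sym rcong_trans by blast
  then have c0: "[c = 0] (rmod 2 * pi)" using rcong_diff_right_cancel[of "x1 T1" "x2 0" "x2 0" "2 * pi"] by (simp add: c_def)
  from pendulum_trajectory_add_period[OF 2(1) c0]
  have 3: "pendulum_trajectory \<epsilon> T2 (\<lambda>t. x2 t + c) y2 u2" .
  have 4: "[x2 T2 + c = fst r] (rmod 2 * pi)" using rcong_add[OF 2(4) c0] by simp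
  have T: "0 \<le> T1" "0 \<le> T2" using 1 2 by (auto simp: pendulum_trajectory_def)
  have 5: "x2 0 + c = x1 T1" "y2 0 = y1 T1" using 1 2 by (auto simp: c_def)
  show ?thesis
    unfolding steerable_def
    by (intro exI conjI, rule pendulum_trajectory_append[OF \<open>0 < \<epsilon>\<close> 1(1) 3 5])
      (use T 1 2 4 5 c_def in \<open>auto split: if_splits\<close>)
qed

section \<open>Steering a resting pendulum to the origin\<close>

lemma diff_le_of_deriv_le:
  fixes f :: "real \<Rightarrow> real"
  assumes d: "\<And>t. t \<in> {a..b} \<Longrightarrow> (f has_real_derivative f' t) (at t within {a..b})"
    and le: "\<And>t. a < t \<Longrightarrow> t < b \<Longrightarrow> f' t \<le> k" and ab: "a \<le> b"
  shows "f b - f a \<le> k * (b - a)"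
proof -
  have "f b - k * b \<le> f a - k * a"
  proof (rule DERIV_nonpos_imp_decreasing_open[OF ab])
    fix t assume t: "a < t" "t < b"
    have "(f has_real_derivative f' t) (at t)"
      using d[of t] t at_within_Icc_at[of a t b] by simp
    then have "((\<lambda>t. f t - k * t) has_real_derivative f' t - k) (at t)"
      by (auto intro!: derivative_eq_intros)
    then show "\<exists>y. ((\<lambda>t. f t - k * t) has_real_derivative y) (at t) \<and> y \<le> 0"
      using le t by fastforce
  next
    have "continuous_on {a..b} f" using d by (rule DERIV_continuous_on)
    then show "continuous_on {a..b} (\<lambda>t. f t - k * t)" by (intro continuous_intros)
  qed
  then show ?thesis by (simp add: algebra_simps)
qed

lemma abs_diff_le_of_deriv_le:
  fixes f :: "real \<Rightarrow> real"
  assumes d: "\<And>t. t \<in> {a..b} \<Longrightarrow> (f has_real_derivative f' t) (at t within {a..b})"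
    and le: "\<And>t. a < t \<Longrightarrow> t < b \<Longrightarrow> \<bar>f' t\<bar> \<le> k" and ab: "a \<le> b"
  shows "\<bar>f b - f a\<bar> \<le> k * (b - a)"
proof -
  have "f b - f a \<le> k * (b - a)"
    by (rule diff_le_of_deriv_le[OF d _ ab]) (use le in \<open>auto simp: abs_le_iff\<close>)
  moreover have "- f b - - f a \<le> k * (b - a)"
    by (rule diff_le_of_deriv_le[where f' = "\<lambda>t. - f' t", OF _ _ ab])
      (use le d in \<open>force intro!: derivative_eq_intros simp: abs_le_iff\<close>)+
  ultimately show ?thesis by (simp add: abs_le_iff)
qed

section \<open>Elementary bounds for sine and cosine\<close>

text \<open>Up to \<open>pi / 3\<close> the bound \<open>cos t \<ge> 1 / 2\<close> makes
  \<open>sin u - u / 2\<close> increasing; beyond, the sine is at least \<open>sqrt 3 / 2\<close>,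
  which exceeds \<open>pi / 4\<close>.\<close>

lemma abs_sin_ge_half:
  fixes u :: real
  assumes "\<bar>u\<bar> \<le> pi / 2"
  shows "\<bar>u\<bar> / 2 \<le> \<bar>sin u\<bar>"
proof -
  have *: "u / 2 \<le> sin u" if u: "0 \<le> u" "u \<le> pi / 2" for u :: real
  proof (cases "u \<le> pi / 3")
    case True
    have "(u / 2 - sin u) - (0 / 2 - sin 0) \<le> 0 * (u - 0)"
    proof (rule diff_le_of_deriv_le[where f' = "\<lambda>t. 1 / 2 - cos t"])
      fix t assume "0 < t" "t < u"
      then have "cos (pi / 3) \<le> cos t" using True pi_gt_zero by (intro cos_monotone_0_pi_le) auto
      then show "1 / 2 - cos t \<le> 0" by (simp add: cos_60)
    qed (use u in \<open>auto intro!: derivative_eq_intros\<close>)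
    then show ?thesis by simp
  next
    case False
    then have "sin (pi / 3) \<le> sin u" using u by (intro sin_monotone_2pi_le) auto
    moreover have "(8 / 10) \<le> sqrt 3 / (2::real)"
      using real_le_rsqrt[of "16 / 10" 3] by (simp add: power2_eq_square)
    ultimately show ?thesis using u pi_less_4 pi_approx by (simp add: sin_60)
  qed
  show ?thesis
    using *[of u] *[of "- u"] assms by (cases "u \<ge> 0") auto
qed

text \<open>Half-angle formula: \<open>1 - cos x\<close> is twice the square of
  \<open>sin (x / 2)\<close>. It converts small energy into a small angle.\<close>

lemma square_le_cos:
  fixes x :: real
  assumes "\<bar>x\<bar> \<le> pi"
  shows "x\<^sup>2 \<le> 8 * (1 - cos x)"
proof -
  have "\<bar>x / 2\<bar> / 2 \<le> \<bar>sin (x / 2)\<bar>" using assms by (intro abs_sin_ge_half) auto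
  then have "(\<bar>x / 2\<bar> / 2)\<^sup>2 \<le> \<bar>sin (x / 2)\<bar>\<^sup>2" by (intro power_mono) auto
  then show ?thesis using cos_double_sin[of "x / 2"] by (simp add: power2_eq_square)
qed

lemma sin_minus_self_le:
  fixes x :: real
  shows "\<bar>sin x - x\<bar> \<le> \<bar>x\<bar> ^ 3"
proof -
  have "\<bar>sin x - (\<Sum>m<3. sin_coeff m * x ^ m)\<bar> \<le> inverse (fact 3) * \<bar>x\<bar> ^ 3" by (rule Maclaurin_sin_bound)
  also have "(\<Sum>m<3. sin_coeff m * x ^ m) = x"
    by (simp add: eval_nat_numeral sin_coeff_def)
  also have "inverse (fact 3) * \<bar>x\<bar> ^ 3 \<le> \<bar>x\<bar> ^ 3" by (simp add: fact_numeral)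
  finally show ?thesis .
qed

lemma abs_sin_diff_le:
  fixes x y :: real
  shows "\<bar>sin x - sin y\<bar> \<le> \<bar>x - y\<bar>"
proof -
  have *: "\<bar>sin x - sin y\<bar> \<le> 1 * (x - y)" if "y \<le> x" for x y :: real
    by (rule abs_diff_le_of_deriv_le[where f' = cos]) (use that in \<open>auto intro!: derivative_eq_intros\<close>)
  show ?thesis using *[of y x] *[of x y] by (cases "y \<le> x") (auto simp: abs_minus_commute)
qed

lemma reduce_angle:
  obtains z where "[x = z] (rmod 2 * pi)" "\<bar>z\<bar> \<le> pi"
proof
  let ?z = "x - 2 * pi * of_int (round (x / (2 * pi)))"
  show "[x = ?z] (rmod 2 * pi)"
    unfolding rcong_altdef by (intro exI[of _ "- round (x / (2 * pi))"]) simp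
  have "\<bar>of_int (round (x / (2 * pi))) - x / (2 * pi)\<bar> \<le> 1 / 2" by (rule of_int_round_abs_le)
  then have "2 * pi * \<bar>of_int (round (x / (2 * pi))) - x / (2 * pi)\<bar> \<le> 2 * pi * (1 / 2)"
    by (intro mult_left_mono) auto
  also have "2 * pi * \<bar>of_int (round (x / (2 * pi))) - x / (2 * pi)\<bar> = \<bar>2 * pi * (of_int (round (x / (2 * pi))) - x / (2 * pi))\<bar>"
    by (simp add: abs_mult)
  also have "\<dots> = \<bar>?z\<bar>" by (simp add: right_diff_distrib abs_minus_commute)
  finally show "\<bar>?z\<bar> \<le> pi" by simp
qed

section \<open>Manoeuvres near the equilibria\<close>

text \<open>The path is the linearised oscillation \<open>z\<close> with the given initial data,
  faded out by the cubic cutoff \<open>\<sigma>\<close>, which falls from 1 to 0 with vanishing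
  slope at both ends. The force needed is \<open>\<sigma>2 t * z t + 2 * \<sigma>1 t * z' t\<close>
  plus the nonlinearity \<open>sin (X t) - X t\<close>. With amplitude \<open>A\<close> of order
  \<open>sqrt \<epsilon>\<close>, the cutoff terms are \<open>O(\<epsilon> * A)\<close> and the
  nonlinearity is at most \<open>A ^ 3 = 10 * \<epsilon> * A\<close>, so a small \<open>A\<close>
  leaves room.\<close>

lemma steerable_capture:
  assumes e: "0 < \<epsilon>" "\<epsilon> \<le> 1 / 2000" and E: "y0\<^sup>2 / 2 + (1 - cos x0) \<le> \<epsilon>"
  shows "steerable \<epsilon> (1 / \<epsilon>) (x0, y0) (0, 0)"
proof -
  obtain q where q: "[x0 = q] (rmod 2 * pi)" "\<bar>q\<bar> \<le> pi" by (rule reduce_angle)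
  have "cos x0 = cos q" using q(1) by (rule cos_rcong)
  with E have "1 - cos q \<le> \<epsilon> - y0\<^sup>2 / 2" by simp
  from mult_left_mono[OF this, of 8] square_le_cos[OF q(2)]
  have "q\<^sup>2 \<le> 8 * \<epsilon> - 4 * y0\<^sup>2" by (simp add: algebra_simps)
  moreover have "0 \<le> y0\<^sup>2" by simp
  ultimately have q2: "q\<^sup>2 + y0\<^sup>2 \<le> 10 * \<epsilon>" using e by argo
  define A where "A = sqrt (10 * \<epsilon>)"
  have A: "0 < A" "A\<^sup>2 = 10 * \<epsilon>" using e by (auto simp: A_def)
  \<comment> \<open>The threshold \<open>1 / 2000\<close> originates here: it gives
    \<open>A \<le> 1 / 14\<close>, and the total force
    \<open>\<epsilon> * (A * (6 * \<epsilon> + 13))\<close> then stays below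
    \<open>\<epsilon>\<close>.\<close>
  have "A\<^sup>2 \<le> (1 / 14)\<^sup>2" using A e by (simp add: power2_eq_square)
  then have A14: "A \<le> 1 / 14" by (rule power2_le_imp_le) auto
  define z z' where "z t = q * cos t + y0 * sin t" and "z' t = - q * sin t + y0 * cos t" for t
  define \<sigma> \<sigma>1 \<sigma>2 where "\<sigma> t = 1 - 3 * (\<epsilon> * t)\<^sup>2 + 2 * (\<epsilon> * t) ^ 3"
    and "\<sigma>1 t = \<epsilon> * (- 6 * (\<epsilon> * t) + 6 * (\<epsilon> * t)\<^sup>2)"
    and "\<sigma>2 t = \<epsilon>\<^sup>2 * (- 6 + 12 * (\<epsilon> * t))" for t
  define X Y a where "X t = \<sigma> t * z t" and "Y t = \<sigma>1 t * z t + \<sigma> t * z' t"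
    and "a t = \<sigma>2 t * z t + 2 * \<sigma>1 t * z' t - \<sigma> t * z t" for t
  have zz: "\<bar>z t\<bar> \<le> A" "\<bar>z' t\<bar> \<le> A" for t
  proof -
    have "(z t)\<^sup>2 + (z' t)\<^sup>2 = (q\<^sup>2 + y0\<^sup>2) * ((sin t)\<^sup>2 + (cos t)\<^sup>2)"
      unfolding z_def z'_def by algebra
    then have "(z t)\<^sup>2 + (z' t)\<^sup>2 \<le> A\<^sup>2" using q2 A by simp
    then have "(z t)\<^sup>2 \<le> A\<^sup>2" "(z' t)\<^sup>2 \<le> A\<^sup>2"
      using zero_le_power2[of "z t"] zero_le_power2[of "z' t"] by linarith+
    then show "\<bar>z t\<bar> \<le> A" "\<bar>z' t\<bar> \<le> A"
      using A(1) abs_le_square_iff[of _ A] by auto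
  qed
  have bd: "\<bar>\<sigma> t\<bar> \<le> 1" "\<bar>\<sigma>1 t\<bar> \<le> \<epsilon> * (3 / 2)" "\<bar>\<sigma>2 t\<bar> \<le> \<epsilon>\<^sup>2 * 6" if "t \<in> {0..1 / \<epsilon>}" for t
  proof -
    define s where "s = \<epsilon> * t"
    have s: "0 \<le> s" "s \<le> 1" using that e by (auto simp: s_def field_simps)
    have "0 \<le> (1 - s)\<^sup>2 * (1 + 2 * s)" using s by simp
    moreover have "(1 - s)\<^sup>2 * (1 + 2 * s) = 1 - 3 * s\<^sup>2 + 2 * s ^ 3" by algebra
    moreover have "0 \<le> s\<^sup>2 * (3 - 2 * s)" using s by simp
    moreover have "s\<^sup>2 * (3 - 2 * s) = 3 * s\<^sup>2 - 2 * s ^ 3" by algebra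
    ultimately show "\<bar>\<sigma> t\<bar> \<le> 1" by (simp add: \<sigma>_def s_def)
    have "0 \<le> s * (1 - s)" using s by simp
    moreover have "s * (1 - s) \<le> 1 / 4"
      using zero_le_power2[of "s - 1 / 2"] by (simp add: power2_eq_square algebra_simps)
    ultimately have "\<bar>- 6 * s + 6 * s\<^sup>2\<bar> \<le> 3 / 2" by (simp add: power2_eq_square algebra_simps)
    then show "\<bar>\<sigma>1 t\<bar> \<le> \<epsilon> * (3 / 2)" using e by (simp add: \<sigma>1_def s_def abs_mult)
    have "\<bar>- 6 + 12 * s\<bar> \<le> 6" using s by (simp add: abs_le_iff)
    then show "\<bar>\<sigma>2 t\<bar> \<le> \<epsilon>\<^sup>2 * 6" using e by (simp add: \<sigma>2_def s_def abs_mult)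
  qed
  have "pendulum_trajectory \<epsilon> (1 / \<epsilon>) X Y (\<lambda>t. (a t + sin (X t)) / \<epsilon>)"
  proof (rule pendulum_trajectory_smoothI)
    fix t assume t: "t \<in> {0..1 / \<epsilon>}"
    have d: "(z has_real_derivative z' t) (at t within {0..1 / \<epsilon>})"
      "(z' has_real_derivative - z t) (at t within {0..1 / \<epsilon>})"
      "(\<sigma> has_real_derivative \<sigma>1 t) (at t within {0..1 / \<epsilon>})"
      "(\<sigma>1 has_real_derivative \<sigma>2 t) (at t within {0..1 / \<epsilon>})"
      unfolding z_def[abs_def] z'_def[abs_def] \<sigma>_def[abs_def] \<sigma>1_def[abs_def] \<sigma>2_def
      by (auto intro!: derivative_eq_intros simp: power2_eq_square power3_eq_cube algebra_simps)
    show "(X has_real_derivative Y t) (at t within {0..1 / \<epsilon>})"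
      unfolding X_def[abs_def] Y_def by (auto intro!: derivative_eq_intros d)
    show "(Y has_real_derivative a t) (at t within {0..1 / \<epsilon>})"
      unfolding Y_def[abs_def] a_def by (auto intro!: derivative_eq_intros d)
    have XA: "\<bar>X t\<bar> \<le> A"
      using mult_mono[OF bd(1)[OF t] zz(1)] by (simp add: X_def abs_mult)
    have "\<bar>a t + sin (X t)\<bar> = \<bar>\<sigma>2 t * z t + 2 * (\<sigma>1 t * z' t) + (sin (X t) - X t)\<bar>"
      by (simp add: a_def X_def)
    also have "\<dots> \<le> \<bar>\<sigma>2 t * z t\<bar> + 2 * \<bar>\<sigma>1 t * z' t\<bar> + \<bar>sin (X t) - X t\<bar>"
      by linarith
    also have "\<bar>\<sigma>2 t * z t\<bar> \<le> (\<epsilon>\<^sup>2 * 6) * A"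
      unfolding abs_mult using e by (intro mult_mono bd t zz) auto
    also have "\<bar>\<sigma>1 t * z' t\<bar> \<le> (\<epsilon> * (3 / 2)) * A"
      unfolding abs_mult using e by (intro mult_mono bd t zz) auto
    also have "\<bar>sin (X t) - X t\<bar> \<le> A ^ 3"
      using sin_minus_self_le[of "X t"] power_mono[OF XA, of 3] by simp
    also have "A ^ 3 = \<epsilon> * (10 * A)" using A by (simp add: power3_eq_cube power2_eq_square)
    finally have "\<bar>a t + sin (X t)\<bar> \<le> \<epsilon> * (A * (\<epsilon> * 6 + 13))"
      by (simp add: power2_eq_square algebra_simps)
    also have "\<dots> \<le> \<epsilon> * ((1 / 14) * (6 / 2000 + 13))"
      using e A A14 by (intro mult_mono) auto
    also have "\<dots> \<le> \<epsilon>" using e by simp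
    finally show "\<bar>a t + sin (X t)\<bar> \<le> \<epsilon>" .
  qed (use e in auto)
  then show ?thesis
    by (rule steerableI) (use e q(1) in \<open>auto simp: X_def Y_def \<sigma>_def \<sigma>1_def z_def z'_def rcong_sym\<close>)
qed

text \<open>Braking needs a start with \<open>\<bar>sin x0\<bar> \<ge> \<epsilon> / 40\<close>. Near
  either equilibrium a short rest-to-rest displacement along a cubic provides it, because
  \<open>\<bar>cos x0\<bar> \<ge> 9 / 10\<close> there.\<close>

lemma steerable_kick:
  assumes e: "0 < \<epsilon>" "\<epsilon> \<le> 1 / 2000" and s: "\<bar>sin x0\<bar> < \<epsilon> / 40"
  shows "\<exists>x1. \<epsilon> / 40 \<le> \<bar>sin x1\<bar> \<and> steerable \<epsilon> 1 (x0, 0) (x1, 0)"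
proof (intro exI conjI)
  \<comment> \<open>Small enough for the control: the acceleration \<open>6 * d\<close>, the change
    of sine \<open>d\<close> and the initial sine \<open>\<epsilon> / 40\<close> add up to less than
    \<open>\<epsilon>\<close>. Large enough for the goal: \<open>0.81 * d - \<epsilon> / 40\<close>
    exceeds \<open>\<epsilon> / 40\<close>.\<close>
  define d where "d = \<epsilon> / 10"
  have d: "0 < d" "d \<le> 1 / 20000" using e by (auto simp: d_def)
  define X Y where "X t = x0 + d * (3 * t\<^sup>2 - 2 * t ^ 3)" and "Y t = d * (6 * t - 6 * t\<^sup>2)" for t
  have "pendulum_trajectory \<epsilon> 1 X Y (\<lambda>t. (d * (6 - 12 * t) + sin (X t)) / \<epsilon>)"
  proof (rule pendulum_trajectory_smoothI)
    fix t :: real assume t: "t \<in> {0..1}"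
    show "(X has_real_derivative Y t) (at t within {0..1})"
      "(Y has_real_derivative d * (6 - 12 * t)) (at t within {0..1})"
      unfolding X_def[abs_def] Y_def[abs_def]
      by (auto intro!: derivative_eq_intros simp: power2_eq_square algebra_simps)
    have "\<bar>X t - x0\<bar> \<le> d"
    proof -
      have "0 \<le> t\<^sup>2 * (3 - 2 * t)" "0 \<le> (1 - t)\<^sup>2 * (1 + 2 * t)" using t by auto
      then have "0 \<le> 3 * t\<^sup>2 - 2 * t ^ 3" "3 * t\<^sup>2 - 2 * t ^ 3 \<le> 1"
        by (auto simp: power2_eq_square power3_eq_cube algebra_simps)
      then show ?thesis using d by (simp add: X_def abs_mult)
    qed
    moreover have "\<bar>sin (X t) - sin x0\<bar> \<le> \<bar>X t - x0\<bar>"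
      using abs_sin_diff_le by blast
    moreover have "\<bar>d * (6 - 12 * t)\<bar> \<le> d * 6" using t d by (simp add: abs_mult abs_le_iff)
    moreover have "\<bar>d * (6 - 12 * t) + sin (X t)\<bar> \<le> \<bar>d * (6 - 12 * t)\<bar> + \<bar>sin (X t) - sin x0\<bar> + \<bar>sin x0\<bar>"
      by linarith
    ultimately show "\<bar>d * (6 - 12 * t) + sin (X t)\<bar> \<le> \<epsilon>" using s d by (simp add: d_def)
  qed (use e in auto)
  then show "steerable \<epsilon> 1 (x0, 0) (x0 + d, 0)"
    by (rule steerableI) (auto simp: X_def Y_def)
  have "9 / 10 \<le> \<bar>cos x0\<bar>"
  proof -
    have "\<bar>sin x0\<bar>\<^sup>2 \<le> (1 / 10)\<^sup>2" using s e by (intro power_mono) auto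
    then have "(9 / 10)\<^sup>2 \<le> \<bar>cos x0\<bar>\<^sup>2" using sin_cos_squared_add[of x0] by (simp add: power2_eq_square)
    then show ?thesis by (rule power2_le_imp_le) auto
  qed
  moreover have "9 / 10 * d \<le> sin d"
  proof -
    have "d ^ 3 \<le> (1 / 10) * d" using d mult_mono[of d "1/10" d 1]
      by (simp add: power3_eq_cube)
    then show ?thesis using sin_minus_self_le[of d] d by (simp add: abs_le_iff)
  qed
  ultimately have "(9 / 10) * (9 / 10 * d) \<le> \<bar>cos x0\<bar> * sin d"
    using d by (intro mult_mono) auto
  moreover have "\<bar>cos x0\<bar> * sin d \<le> \<bar>cos x0 * sin d\<bar>" by (simp add: abs_mult mult_left_mono)
  moreover have "\<bar>sin x0 * cos d\<bar> \<le> \<bar>sin x0\<bar>" by (simp add: abs_mult mult_left_le)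
  ultimately have "(9 / 10) * (9 / 10 * d) - \<bar>sin x0\<bar> \<le> \<bar>sin (x0 + d)\<bar>"
    unfolding sin_add by linarith
  then show "\<epsilon> / 40 \<le> \<bar>sin (x0 + d)\<bar>" using s by (simp add: d_def)
qed

section \<open>Braking by a saturated feedback\<close>

text \<open>The square root is the length of the gradient \<open>(sin x, y)\<close> of the energy.
  Dividing \<open>y\<close> by it gives friction of bounded strength that does not fade with the
  amplitude; the floor \<open>m\<close> keeps the field Lipschitz at the equilibria, where the
  gradient vanishes.\<close>

definition sat_feedback :: "real \<Rightarrow> real \<Rightarrow> real \<Rightarrow> real" where
  "sat_feedback m x y = y / max (sqrt (y\<^sup>2 + (sin x)\<^sup>2)) m"

lemma abs_sat_feedback_le:
  assumes "0 < m"
  shows "\<bar>sat_feedback m x y\<bar> \<le> 1"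
proof -
  have "\<bar>y\<bar> \<le> sqrt (y\<^sup>2 + (sin x)\<^sup>2)" by (rule real_le_rsqrt) simp
  then have "\<bar>y\<bar> \<le> max (sqrt (y\<^sup>2 + (sin x)\<^sup>2)) m" by (rule max.coboundedI1)
  then show ?thesis using assms by (simp add: sat_feedback_def abs_divide divide_le_eq_1 less_max_iff_disj)
qed

lemma sat_feedback_lipschitz:
  assumes m: "0 < m"
  shows "m * \<bar>sat_feedback m x y - sat_feedback m x' y'\<bar> \<le> 2 * \<bar>y - y'\<bar> + \<bar>x - x'\<bar>"
proof -
  define r N where "r x y = sqrt (y\<^sup>2 + (sin x)\<^sup>2)" and "N x y = max (r x y) m" for x y
  have r: "r x y = norm (y, sin x)" for x y by (simp add: r_def norm_Pair)
  have "\<bar>r x y - r x' y'\<bar> \<le> norm ((y, sin x) - (y', sin x'))"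
    unfolding r by (rule norm_triangle_ineq3)
  also have "\<dots> \<le> \<bar>y - y'\<bar> + \<bar>sin x - sin x'\<bar>"
    using norm_Pair_le[of "y - y'" "sin x - sin x'"] by simp
  also have "\<dots> \<le> \<bar>y - y'\<bar> + \<bar>x - x'\<bar>" using abs_sin_diff_le[of x x'] by simp
  finally have Nd: "\<bar>N x y - N x' y'\<bar> \<le> \<bar>y - y'\<bar> + \<bar>x - x'\<bar>" by (auto simp: N_def max_def)
  have N: "m \<le> N x y" "0 < N x y" "\<bar>y\<bar> \<le> N x y" for x y
  proof -
    have "\<bar>y\<bar> \<le> r x y" unfolding r_def by (rule real_le_rsqrt) simp
    then show "m \<le> N x y" "0 < N x y" "\<bar>y\<bar> \<le> N x y" using m by (auto simp: N_def)
  qed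
  \<comment> \<open>The term \<open>y' / N x y\<close> is subtracted and added; the second factor is
    controlled by the reverse triangle inequality for \<open>N\<close>.\<close>
  have "sat_feedback m x y - sat_feedback m x' y' = (y - y') / N x y + (y' / N x' y') * ((N x' y' - N x y) / N x y)"
    using N(2)[of x y] N(2)[of x' y'] by (simp add: sat_feedback_def N_def[symmetric] r_def[symmetric] field_simps)
  then have step: "\<bar>sat_feedback m x y - sat_feedback m x' y'\<bar> \<le> \<bar>(y - y') / N x y\<bar> + \<bar>(y' / N x' y') * ((N x' y' - N x y) / N x y)\<bar>"
    by (simp only: abs_triangle_ineq)
  have "\<bar>(y - y') / N x y\<bar> + \<bar>(y' / N x' y') * ((N x' y' - N x y) / N x y)\<bar> = \<bar>y - y'\<bar> / N x y + \<bar>y' / N x' y'\<bar> * (\<bar>N x' y' - N x y\<bar> / N x y)"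
    using N(2)[of x y] by (simp only: abs_mult abs_divide abs_of_pos)
  with step have "m * \<bar>sat_feedback m x y - sat_feedback m x' y'\<bar>
      \<le> m * (\<bar>y - y'\<bar> / N x y + \<bar>y' / N x' y'\<bar> * (\<bar>N x' y' - N x y\<bar> / N x y))"
    using m by (intro mult_left_mono) auto
  also have "\<dots> = (m / N x y) * \<bar>y - y'\<bar> + (m / N x y) * (\<bar>y' / N x' y'\<bar> * \<bar>N x' y' - N x y\<bar>)"
    by (simp add: distrib_left)
  also have "\<dots> \<le> 1 * \<bar>y - y'\<bar> + 1 * (1 * \<bar>N x' y' - N x y\<bar>)"
    using m N(1,2)[of x y] N(2)[of x' y'] N(3)[of y' x'] by (intro add_mono mult_mono) (auto simp: abs_divide)
  finally show ?thesis using Nd abs_minus_commute[of "N x y" "N x' y'"] by simp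
qed

text \<open>With \<open>k = y * s / \<rho>\<close> and \<open>s = sin x\<close>, the corrected energy \<open>E + b / 2 * \<epsilon> * k\<close> decreases at a rate
  proportional to \<open>\<epsilon> * \<rho>\<close> along the braked flow. The energy alone does not: its rate \<open>- b * \<epsilon> * y\<^sup>2 / \<rho>\<close>
  vanishes at the turning points.\<close>

lemma braking_lyapunov_bound:
  fixes \<epsilon> b \<rho> y s c :: real
  assumes \<rho>: "0 < \<rho>" "\<rho>\<^sup>2 = y\<^sup>2 + s\<^sup>2" and c: "c \<le> 1" and b: "0 < b" "0 < \<epsilon>" "4 * (b * \<epsilon>) \<le> \<rho>"
    and y1: "y1 = - s - b * \<epsilon> * y / \<rho>" and s1: "s1 = y * c"
  shows "- b * \<epsilon> * y\<^sup>2 / \<rho> + b / 2 * \<epsilon> * ((y1 * s + y * s1) / \<rho> - y * s * (y * y1 + s * s1) / \<rho> ^ 3)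
    \<le> - (3 / 8) * b * \<epsilon> * \<rho>"
proof -
  have y2: "y\<^sup>2 = \<rho>\<^sup>2 - s\<^sup>2" using \<rho> by simp
  \<comment> \<open>Over the common denominator \<open>\<rho> ^ 3\<close>, substituting
    \<open>\<rho>\<^sup>2 = y\<^sup>2 + s\<^sup>2\<close> cancels the mixed terms of the derivative
    of \<open>k\<close>.\<close>
  have k: "(y1 * s + y * s1) / \<rho> - y * s * (y * y1 + s * s1) / \<rho> ^ 3 = (s ^ 3 * y1 + y ^ 3 * s1) / \<rho> ^ 3"
  proof -
    have "(y1 * s + y * s1) / \<rho> = ((y1 * s + y * s1) * \<rho>\<^sup>2) / \<rho> ^ 3"
      using \<rho>(1) by (simp add: power2_eq_square power3_eq_cube)
    moreover have "(y1 * s + y * s1) * \<rho>\<^sup>2 - y * s * (y * y1 + s * s1) = s ^ 3 * y1 + y ^ 3 * s1"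
      unfolding \<rho>(2) by algebra
    ultimately show ?thesis by (simp flip: diff_divide_distrib)
  qed
  have \<rho>4: "\<rho> ^ 4 = (y\<^sup>2 + s\<^sup>2)\<^sup>2" unfolding \<rho>(2)[symmetric] by simp
  have "s ^ 3 * y1 = - (s ^ 4) - b * \<epsilon> * (s ^ 3 * y / \<rho>)" unfolding y1 by (simp add: algebra_simps power3_eq_cube power4_eq_xxxx)
  moreover have "- (s ^ 3 * y / \<rho>) \<le> \<rho> ^ 3"
  proof -
    have a: "\<bar>s\<bar> \<le> \<rho>" "\<bar>y\<bar> \<le> \<rho>" using \<rho> by (auto intro!: power2_le_imp_le[of "\<bar>_\<bar>"])
    have "\<bar>s ^ 3 * y\<bar> \<le> \<rho> ^ 3 * \<rho>" unfolding abs_mult power_abs using a \<rho>(1) by (intro mult_mono power_mono) auto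
    then have "- (s ^ 3 * y) \<le> \<rho> ^ 3 * \<rho>" by linarith
    then show ?thesis using \<rho>(1) by (simp add: field_simps)
  qed
  then have "- (b * \<epsilon> * (s ^ 3 * y / \<rho>)) \<le> b * \<epsilon> * \<rho> ^ 3"
    using mult_left_mono[of "- (s ^ 3 * y / \<rho>)" "\<rho> ^ 3" "b * \<epsilon>"] b by simp
  moreover have "y ^ 3 * s1 \<le> y ^ 4"
  proof -
    have "y ^ 4 * c \<le> y ^ 4 * 1" using c by (intro mult_left_mono) auto
    then show ?thesis unfolding s1 by (simp add: power3_eq_cube power4_eq_xxxx algebra_simps)
  qed
  ultimately have "s ^ 3 * y1 + y ^ 3 * s1 \<le> (y ^ 4 - s ^ 4) + (b * \<epsilon>) * \<rho> ^ 3" by linarith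
  then have "(s ^ 3 * y1 + y ^ 3 * s1) / \<rho> ^ 3 \<le> ((y ^ 4 - s ^ 4) + (b * \<epsilon>) * \<rho> ^ 3) / \<rho> ^ 3"
    using \<rho>(1) by (intro divide_right_mono) auto
  also have "\<dots> = (y ^ 4 - s ^ 4) / \<rho> ^ 3 + b * \<epsilon>" using \<rho>(1) by (simp add: add_divide_distrib)
  finally have A: "(b / 2 * \<epsilon>) * ((s ^ 3 * y1 + y ^ 3 * s1) / \<rho> ^ 3) \<le> (b / 2 * \<epsilon>) * ((y ^ 4 - s ^ 4) / \<rho> ^ 3 + b * \<epsilon>)"
    using b by (intro mult_left_mono) auto
  \<comment> \<open>The coefficient \<open>b / 2\<close> is chosen for this cancellation:
    \<open>2 * y\<^sup>2 * \<rho>\<^sup>2 - (y ^ 4 - s ^ 4)\<close> is the full square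
    \<open>\<rho> ^ 4\<close>, so dissipation and correction together no longer see the phase of the
    oscillation.\<close>
  have B: "- b * \<epsilon> * y\<^sup>2 / \<rho> + (b / 2 * \<epsilon>) * ((y ^ 4 - s ^ 4) / \<rho> ^ 3 + b * \<epsilon>)
      = - (b / 2 * \<epsilon>) * (\<rho> - b * \<epsilon>)"
  proof -
    have "2 * y\<^sup>2 / \<rho> = 2 * y\<^sup>2 * \<rho>\<^sup>2 / \<rho> ^ 3" using \<rho>(1) by (simp add: power2_eq_square power3_eq_cube)
    then have "2 * y\<^sup>2 / \<rho> - (y ^ 4 - s ^ 4) / \<rho> ^ 3 = (2 * y\<^sup>2 * \<rho>\<^sup>2 - (y ^ 4 - s ^ 4)) / \<rho> ^ 3"
      by (simp add: diff_divide_distrib)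
    also have "2 * y\<^sup>2 * \<rho>\<^sup>2 - (y ^ 4 - s ^ 4) = \<rho> ^ 4" unfolding \<rho>4 \<rho>(2) by algebra
    also have "\<rho> ^ 4 / \<rho> ^ 3 = \<rho>" using \<rho>(1) by (simp add: power3_eq_cube power4_eq_xxxx)
    finally have eq: "(y ^ 4 - s ^ 4) / \<rho> ^ 3 = 2 * y\<^sup>2 / \<rho> - \<rho>" by simp
    show ?thesis unfolding eq by (simp add: algebra_simps diff_divide_distrib)
  qed
  \<comment> \<open>\<open>4 * (b * \<epsilon>) \<le> \<rho>\<close> leaves three quarters of
    \<open>\<rho>\<close>, whence the constant \<open>3 / 8\<close>.\<close>
  have C: "- (b / 2 * \<epsilon>) * (\<rho> - b * \<epsilon>) \<le> - (b / 2 * \<epsilon>) * (3 / 4 * \<rho>)"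
    using b by (intro mult_left_mono_neg) auto
  have "- (b / 2 * \<epsilon>) * (3 / 4 * \<rho>) = - (3 / 8) * b * \<epsilon> * \<rho>" by simp
  with C have "- b * \<epsilon> * y\<^sup>2 / \<rho> + (b / 2 * \<epsilon>) * ((y ^ 4 - s ^ 4) / \<rho> ^ 3 + b * \<epsilon>) \<le> - (3 / 8) * b * \<epsilon> * \<rho>"
    unfolding B by simp
  with add_left_mono[OF A] show ?thesis unfolding k by (rule order_trans)
qed

lemma sat_feedback_flow_exists:
  assumes "0 < \<epsilon>" "0 \<le> T"
  obtains x y where "x 0 = x0" "y 0 = (0::real)"
    "\<And>t. t \<in> {0..T} \<Longrightarrow> (x has_real_derivative y t) (at t within {0..T})"
    "\<And>t. t \<in> {0..T} \<Longrightarrow> (y has_real_derivative - sin (x t) - 1 / 160 * \<epsilon> * sat_feedback (\<epsilon> / 40) (x t) (y t)) (at t within {0..T})"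
proof (rule lipschitz_ode_exists_planar[OF assms(2), where L = 2 and f = "\<lambda>t x y. y"
    and g = "\<lambda>t x y. - sin x - 1 / 160 * \<epsilon> * sat_feedback (\<epsilon> / 40) x y"])
  have nz: "max (sqrt a) (\<epsilon> / 40) \<noteq> 0" for a
    using assms by linarith
  show "continuous_on {0..T} (\<lambda>t. - sin (p t) - 1 / 160 * \<epsilon> * sat_feedback (\<epsilon> / 40) (p t) (q t))"
    if "continuous_on {0..T} p" "continuous_on {0..T} q" for p q
    unfolding sat_feedback_def using nz by (intro continuous_intros that) blast
  show "\<bar>(- sin p - 1 / 160 * \<epsilon> * sat_feedback (\<epsilon> / 40) p q) - (- sin p' - 1 / 160 * \<epsilon> * sat_feedback (\<epsilon> / 40) p' q')\<bar>
      \<le> 2 * (\<bar>p - p'\<bar> + \<bar>q - q'\<bar>)" for p p' q q'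
  proof -
    let ?d = "sat_feedback (\<epsilon> / 40) p q - sat_feedback (\<epsilon> / 40) p' q'"
    have "(- sin p - 1 / 160 * \<epsilon> * sat_feedback (\<epsilon> / 40) p q) - (- sin p' - 1 / 160 * \<epsilon> * sat_feedback (\<epsilon> / 40) p' q')
      = (sin p' - sin p) + - (1 / 160 * \<epsilon> * ?d)" by (simp add: algebra_simps)
    also have "\<bar>\<dots>\<bar> \<le> \<bar>sin p' - sin p\<bar> + \<bar>1 / 160 * \<epsilon> * ?d\<bar>"
      by (rule order_trans[OF abs_triangle_ineq]) (simp only: abs_minus_cancel order_refl)
    \<comment> \<open>The gain \<open>\<epsilon> / 160\<close> is a quarter of the floor
      \<open>\<epsilon> / 40\<close>, so the large Lipschitz constant of the feedback cancels and 2
      serves for every \<open>\<epsilon>\<close>.\<close>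
    also have "\<bar>1 / 160 * \<epsilon> * ?d\<bar> = 1 / 4 * (\<epsilon> / 40 * \<bar>?d\<bar>)" using assms by (simp add: abs_mult)
    finally show ?thesis
      using sat_feedback_lipschitz[of "\<epsilon> / 40" p q p' q'] abs_sin_diff_le[of p' p] assms
        abs_minus_commute[of p' p] abs_ge_zero[of "p - p'"] abs_ge_zero[of "q - q'"] by argo
  qed
qed auto

text \<open>For energies away from \<open>\<plusminus> 1\<close> the right Lyapunov function is \<open>- arccos E + b / 2 * \<epsilon> * k / sqrt (1 - E\<^sup>2)\<close>:
  since \<open>sqrt (1 - E\<^sup>2) \<le> \<rho>\<close>, it decreases at a rate of order \<open>\<epsilon>\<close> and its range is bounded, which avoids
  the logarithmic loss near the separatrix.\<close>

lemma normalized_lyapunov_bound: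
  fixes \<epsilon> b q \<rho> k k1 H H1 y :: real
  assumes pos: "0 < \<epsilon>" "0 < b" "b \<le> 1 / 4" "0 < q" and q: "\<epsilon> \<le> q\<^sup>2" "q \<le> \<rho>"
    and k: "\<bar>k\<bar> \<le> \<rho> / 2" and H: "\<bar>H\<bar> \<le> 1" and H1: "H1 = - b * \<epsilon> * y\<^sup>2 / \<rho>" and y: "y\<^sup>2 \<le> 2 * \<rho>"
    and le: "H1 + b / 2 * \<epsilon> * k1 \<le> - (3 / 8) * b * \<epsilon> * \<rho>"
  shows "H1 / q + b / 2 * \<epsilon> * (k1 / q + k * H * H1 / q ^ 3) \<le> - (b / 4 * \<epsilon>)"
proof -
  have \<rho>: "0 < \<rho>" using pos q by linarith
  have "(H1 + b / 2 * \<epsilon> * k1) / q \<le> - (3 / 8) * b * \<epsilon> * \<rho> / q"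
    using le pos by (intro divide_right_mono) auto
  \<comment> \<open>This term comes from differentiating \<open>1 / q\<close> and is the dangerous
    one near \<open>H = 1\<close> and \<open>H = - 1\<close>;
    \<open>\<epsilon> \<le> q\<^sup>2\<close> absorbs two of the three powers of \<open>q\<close>,
    and the term uses up only \<open>1 / 8\<close> of the available \<open>3 / 8\<close>.\<close>
  moreover have "b / 2 * \<epsilon> * (k * H * H1 / q ^ 3) \<le> (1 / 8) * b * \<epsilon> * \<rho> / q"
  proof -
    have "\<bar>k * H * H1\<bar> \<le> (\<rho> / 2) * 1 * (b * \<epsilon> * y\<^sup>2 / \<rho>)"
      unfolding abs_mult using k H pos \<rho> H1 by (intro mult_mono) auto
    also have "\<dots> = b / 2 * \<epsilon> * y\<^sup>2" using \<rho> by simp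
    also have "\<dots> \<le> b / 2 * \<epsilon> * (2 * \<rho>)" using y pos by (intro mult_left_mono) auto
    finally have "k * H * H1 \<le> b * \<epsilon> * \<rho>" by simp
    then have "b / 2 * \<epsilon> * (k * H * H1 / q ^ 3) \<le> b / 2 * \<epsilon> * (b * \<epsilon> * \<rho> / q ^ 3)"
      using pos by (intro mult_left_mono divide_right_mono) auto
    also have "\<dots> = b / 2 * \<epsilon> * (b * (\<epsilon> / q\<^sup>2) * (\<rho> / q))"
      by (simp add: power2_eq_square power3_eq_cube)
    also have "\<dots> \<le> b / 2 * \<epsilon> * ((1 / 4) * 1 * (\<rho> / q))"
      using pos q \<rho> by (intro mult_left_mono mult_mono) auto
    finally show ?thesis by simp
  qed
  ultimately have "H1 / q + b / 2 * \<epsilon> * (k1 / q + k * H * H1 / q ^ 3) \<le> - (b / 4 * \<epsilon>) * (\<rho> / q)"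
    by (simp add: add_divide_distrib distrib_left)
  also have "\<dots> \<le> - (b / 4 * \<epsilon>) * 1"
    using pos q by (intro mult_left_mono_neg) auto
  finally show ?thesis by simp
qed

text \<open>By contradiction, in two phases. If the energy stayed above
  \<open>- 1 + \<epsilon>\<close>, then during \<open>52000 / \<epsilon>\<close> time units it would
  leave the top level by more than \<open>\<epsilon>\<close>, and during the remaining
  \<open>8000 / \<epsilon>\<close> a function of bounded range would fall by more than that
  range.\<close>

lemma steerable_brake:
  assumes e: "0 < \<epsilon>" "\<epsilon> \<le> 1 / 2000" and s0: "\<epsilon> / 40 \<le> \<bar>sin x0\<bar>"
  shows "\<exists>T x1 y1. T \<le> 60000 / \<epsilon> \<and> steerable \<epsilon> T (x0, 0) (x1, y1) \<and> y1\<^sup>2 / 2 + (1 - cos x1) \<le> \<epsilon>"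
proof -
  \<comment> \<open>Matched so that \<open>4 * b * \<epsilon> = m\<close>, which is the margin that
    \<open>braking_lyapunov_bound\<close> requires once \<open>\<rho> t \<ge> m\<close>.\<close>
  define m b where "m = \<epsilon> / 40" and "b = (1 / 160 :: real)"
  define Tm where "Tm = 60000 / \<epsilon>"
  have m: "0 < m" and b: "0 < b" and Tm: "0 \<le> Tm" using e by (auto simp: m_def b_def Tm_def)
  obtain x y where x0: "x 0 = x0" and y0: "y 0 = (0::real)"
    and dx: "\<And>t. t \<in> {0..Tm} \<Longrightarrow> (x has_real_derivative y t) (at t within {0..Tm})"
    and dy: "\<And>t. t \<in> {0..Tm} \<Longrightarrow> (y has_real_derivative - sin (x t) - b * \<epsilon> * sat_feedback m (x t) (y t)) (at t within {0..Tm})"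
    using sat_feedback_flow_exists[OF e(1) Tm, of x0] unfolding m_def b_def by blast
  have traj: "pendulum_trajectory \<epsilon> Tm x y (\<lambda>t. (- sin (x t) - b * \<epsilon> * sat_feedback m (x t) (y t) + sin (x t)) / \<epsilon>)"
  proof (rule pendulum_trajectory_smoothI[OF Tm e(1) dx dy])
    fix t
    have "b * \<epsilon> * \<bar>sat_feedback m (x t) (y t)\<bar> \<le> 1 * \<epsilon> * 1"
      using e b abs_sat_feedback_le[OF m] by (intro mult_mono) (auto simp: b_def)
    then show "\<bar>- sin (x t) - b * \<epsilon> * sat_feedback m (x t) (y t) + sin (x t)\<bar> \<le> \<epsilon>"
      using e b by (simp add: abs_mult)
  qed
  define H where "H t = (y t)\<^sup>2 / 2 - cos (x t)" for t
  define H1 where "H1 t = - b * \<epsilon> * (y t * sat_feedback m (x t) (y t))" for t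
  have dH: "(H has_real_derivative H1 t) (at t within {0..Tm})" if "t \<in> {0..Tm}" for t
    unfolding H_def[abs_def] H1_def
    by (auto intro!: derivative_eq_intros dx dy that simp: field_simps)
  have H1_le: "H1 t \<le> 0" for t
    using e b m by (auto simp: H1_def sat_feedback_def less_max_iff_disj intro!: divide_nonneg_pos)
  have H_mono: "H t \<le> H s" if "0 \<le> s" "s \<le> t" "t \<le> Tm" for s t
  proof -
    have "H t - H s \<le> 0 * (t - s)"
      by (rule diff_le_of_deriv_le[where f' = H1])
        (use that H1_le in \<open>auto intro!: has_field_derivative_subset[OF dH]\<close>)
    then show ?thesis by simp
  qed
  have "\<exists>t\<in>{0..Tm}. H t \<le> - 1 + \<epsilon>"
  proof (rule ccontr)
    assume "\<not> ?thesis"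
    then have above: "- 1 + \<epsilon> < H t" if "t \<in> {0..Tm}" for t using that by force
    define \<rho> q k where "\<rho> t = sqrt ((y t)\<^sup>2 + (sin (x t))\<^sup>2)" and "q t = sqrt (1 - (H t)\<^sup>2)"
      and "k t = y t * sin (x t) / \<rho> t" for t
    have H0: "H 0 = - cos x0" by (simp add: H_def x0 y0)
    have H0_le: "H 0 \<le> 1" unfolding H0 using cos_ge_minus_one[of x0] by linarith
    have HM: "H t \<le> 1" if "t \<in> {0..Tm}" for t using H_mono[of 0 t] that H0_le by auto
    have Habs: "\<bar>H t\<bar> \<le> 1" if "t \<in> {0..Tm}" for t using HM[OF that] above[OF that] e by linarith
    \<comment> \<open>For nonnegative energy the decrease of \<open>H\<close> carries the initial
      bound on \<open>sin x0\<close> along; for negative energy the assumption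
      \<open>- 1 + \<epsilon> < H t\<close> suffices. As a result
      \<open>\<rho> t \<ge> q t \<ge> m\<close>, so the feedback never reaches its floor.\<close>
    have m2: "m\<^sup>2 \<le> 1 - (H t)\<^sup>2" if t: "t \<in> {0..Tm}" for t
    proof (cases "0 \<le> H t")
      case True
      then have "(H t)\<^sup>2 \<le> (H 0)\<^sup>2" using H_mono[of 0 t] t by (intro power_mono) auto
      moreover have "m\<^sup>2 \<le> \<bar>sin x0\<bar>\<^sup>2" using s0 m unfolding m_def by (intro power_mono) auto
      ultimately show ?thesis using sin_cos_squared_add[of x0] unfolding H0 power2_minus power2_abs by linarith
    next
      case False
      have "m\<^sup>2 \<le> 1 * \<epsilon>" using e unfolding m_def power2_eq_square by (simp add: field_simps)
      also have "\<dots> \<le> (1 - H t) * (1 + H t)" using False above[OF t] e by (intro mult_mono) auto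
      finally show ?thesis by (simp add: algebra_simps power2_eq_square)
    qed
    have q_pos: "0 < q t" "m \<le> q t" "(q t)\<^sup>2 = 1 - (H t)\<^sup>2" if "t \<in> {0..Tm}" for t
    proof -
      show "m \<le> q t" unfolding q_def using m2[OF that] by (rule real_le_rsqrt)
      with m show "0 < q t" by linarith
      show "(q t)\<^sup>2 = 1 - (H t)\<^sup>2"
        unfolding q_def using m2[OF that] zero_le_power2[of m] by (intro real_sqrt_pow2) linarith
    qed
    have q_le: "q t \<le> \<rho> t" for t
    proof -
      have "0 \<le> (y t)\<^sup>2 * (1 - cos (x t)) + (y t) ^ 4 / 4" by simp
      also have "\<dots> = (y t)\<^sup>2 + (sin (x t))\<^sup>2 - (1 - (H t)\<^sup>2)"
        unfolding H_def sin_squared_eq by (simp add: power2_eq_square power4_eq_xxxx field_simps)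
      finally show ?thesis unfolding q_def \<rho>_def by simp
    qed
    have \<rho>: "0 < \<rho> t" "m \<le> \<rho> t" "(\<rho> t)\<^sup>2 = (y t)\<^sup>2 + (sin (x t))\<^sup>2" if "t \<in> {0..Tm}" for t
    proof -
      show "0 < \<rho> t" "m \<le> \<rho> t" using q_pos[OF that] q_le[of t] by linarith+
      show "(\<rho> t)\<^sup>2 = (y t)\<^sup>2 + (sin (x t))\<^sup>2" by (simp add: \<rho>_def)
    qed
    have sat: "sat_feedback m (x t) (y t) = y t / \<rho> t" if "t \<in> {0..Tm}" for t
      using \<rho>(2)[OF that] by (simp add: sat_feedback_def \<rho>_def max_def)
    have H1: "H1 t = - b * \<epsilon> * (y t)\<^sup>2 / \<rho> t" if "t \<in> {0..Tm}" for t
      by (simp add: H1_def sat[OF that] power2_eq_square)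
    have y_le: "\<bar>y t\<bar> \<le> 2" "\<bar>y t\<bar> \<le> \<rho> t" if "t \<in> {0..Tm}" for t
    proof -
      have "(y t)\<^sup>2 \<le> 4" using HM[OF that] cos_le_one[of "x t"] unfolding H_def by linarith
      then have "\<bar>y t\<bar>\<^sup>2 \<le> 2\<^sup>2" by simp
      then show "\<bar>y t\<bar> \<le> 2" by (intro power2_le_imp_le[of "\<bar>y t\<bar>"]) auto
      show "\<bar>y t\<bar> \<le> \<rho> t" unfolding \<rho>_def by (rule real_le_rsqrt) simp
    qed
    have k_le: "\<bar>k t\<bar> \<le> 2" "\<bar>k t\<bar> \<le> \<rho> t / 2" if t: "t \<in> {0..Tm}" for t
    proof -
      have "\<bar>y t * sin (x t)\<bar> \<le> (\<rho> t)\<^sup>2 / 2"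
        unfolding \<rho>(3)[OF t] abs_mult using sum_squares_bound[of "\<bar>y t\<bar>" "\<bar>sin (x t)\<bar>"] by simp
      then show "\<bar>k t\<bar> \<le> \<rho> t / 2" using \<rho>(1)[OF t] by (simp add: k_def abs_divide field_simps power2_eq_square)
      have "\<bar>sin (x t)\<bar> \<le> \<rho> t" unfolding \<rho>_def by (rule real_le_rsqrt) simp
      then have "\<bar>y t * sin (x t)\<bar> \<le> 2 * \<rho> t" unfolding abs_mult using y_le(1)[OF t] by (intro mult_mono) auto
      then show "\<bar>k t\<bar> \<le> 2" using \<rho>(1)[OF t] by (simp add: k_def abs_divide field_simps)
    qed
    define y1 s1 k1 where "y1 t = - sin (x t) - b * \<epsilon> * y t / \<rho> t" and "s1 t = y t * cos (x t)"
      and "k1 t = (y1 t * sin (x t) + y t * s1 t) / \<rho> t - y t * sin (x t) * (y t * y1 t + sin (x t) * s1 t) / \<rho> t ^ 3" for t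
    have dy1: "(y has_real_derivative y1 t) (at t within {0..Tm})" if "t \<in> {0..Tm}" for t
      using dy[OF that] unfolding sat[OF that] y1_def by simp
    have ds: "((\<lambda>t. sin (x t)) has_real_derivative s1 t) (at t within {0..Tm})" if "t \<in> {0..Tm}" for t
      unfolding s1_def by (rule derivative_eq_intros dx that refl | simp)+
    have half_inverse: "inverse r / 2 * (2 * A) = A / r" for r A :: real by (cases "r = 0") (simp_all add: field_simps)
    have d\<rho>: "(\<rho> has_real_derivative (y t * y1 t + sin (x t) * s1 t) / \<rho> t) (at t within {0..Tm})" if "t \<in> {0..Tm}" for t
    proof -
      have "((\<lambda>t. (y t)\<^sup>2 + (sin (x t))\<^sup>2) has_real_derivative 2 * (y t * y1 t + sin (x t) * s1 t)) (at t within {0..Tm})"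
        by (rule derivative_eq_intros dy1 ds that refl | simp)+
      moreover have "0 < (y t)\<^sup>2 + (sin (x t))\<^sup>2" using \<rho>[OF that] zero_less_power[of "\<rho> t" 2] by simp
      ultimately have "((\<lambda>t. sqrt ((y t)\<^sup>2 + (sin (x t))\<^sup>2)) has_real_derivative
        inverse (sqrt ((y t)\<^sup>2 + (sin (x t))\<^sup>2)) / 2 * (2 * (y t * y1 t + sin (x t) * s1 t))) (at t within {0..Tm})"
        by (intro DERIV_chain'[OF _ DERIV_real_sqrt])
      then show ?thesis unfolding half_inverse by (simp add: \<rho>_def[abs_def])
    qed
    have dk: "(k has_real_derivative k1 t) (at t within {0..Tm})" if t: "t \<in> {0..Tm}" for t
    proof -
      have dn: "((\<lambda>t. y t * sin (x t)) has_real_derivative y1 t * sin (x t) + y t * s1 t) (at t within {0..Tm})"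
        using DERIV_mult[OF dy1[OF t] ds[OF t]] by (simp add: mult.commute)
      have "(k has_real_derivative ((y1 t * sin (x t) + y t * s1 t) * \<rho> t
          - y t * sin (x t) * ((y t * y1 t + sin (x t) * s1 t) / \<rho> t)) / (\<rho> t * \<rho> t)) (at t within {0..Tm})"
        unfolding k_def[abs_def] using \<rho>(1)[OF t]
        by (intro DERIV_divide dn d\<rho> t) auto
      then show ?thesis unfolding k1_def using \<rho>(1)[OF t]
        by (simp add: diff_divide_distrib power3_eq_cube mult.assoc)
    qed
    have lyap: "H1 t + b / 2 * \<epsilon> * k1 t \<le> - (3 / 8) * b * \<epsilon> * \<rho> t" if t: "t \<in> {0..Tm}" for t
      unfolding H1[OF t] k1_def
      by (rule braking_lyapunov_bound[OF \<rho>(1,3)[OF t] cos_le_one b e(1) _ y1_def s1_def])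
        (use \<rho>(2)[OF t] in \<open>simp add: m_def b_def\<close>)
    \<comment> \<open>With rate \<open>(3 / 8) * b * \<epsilon> * m\<close> this is long enough to
      lose \<open>3 * \<epsilon>\<close> of corrected energy; the correction itself varies by at
      most \<open>\<epsilon> / 80\<close>.\<close>
    define t1 where "t1 = 52000 / \<epsilon>"
    have t1: "0 \<le> t1" "t1 \<le> Tm" using e by (auto simp: t1_def Tm_def field_simps)
    \<comment> \<open>Near the upper equilibrium \<open>\<rho>\<close> is only bounded below by \<open>m\<close>, but there only energy of order \<open>\<epsilon>\<close> has to be lost.\<close>
    have "H t1 < 1 - \<epsilon>"
    proof (rule ccontr)
      assume H_t1: "\<not> ?thesis"
      have "(H t1 + b / 2 * \<epsilon> * k t1) - (H 0 + b / 2 * \<epsilon> * k 0) \<le> (- (3 / 8) * b * \<epsilon> * m) * (t1 - 0)"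
      proof (rule diff_le_of_deriv_le[where f' = "\<lambda>t. H1 t + b / 2 * \<epsilon> * k1 t"])
        fix t assume "t \<in> {0..t1}"
        then have t: "t \<in> {0..Tm}" using t1 by auto
        show "((\<lambda>t. H t + b / 2 * \<epsilon> * k t) has_real_derivative H1 t + b / 2 * \<epsilon> * k1 t) (at t within {0..t1})"
          by (rule has_field_derivative_subset[of _ _ _ "{0..Tm}"])
            (use t t1 in \<open>auto intro!: derivative_eq_intros dH dk\<close>)
      next
        fix t assume "0 < t" "t < t1"
        then have t: "t \<in> {0..Tm}" using t1 by auto
        have "b * \<epsilon> * m \<le> b * \<epsilon> * \<rho> t" using \<rho>(2)[OF t] b e by (intro mult_left_mono) auto
        then show "H1 t + b / 2 * \<epsilon> * k1 t \<le> - (3 / 8) * b * \<epsilon> * m" using lyap[OF t] by simp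
      qed fact
      also have "\<dots> = - (3 / 8) * (1 / 160) * (1 / 40) * 52000 * \<epsilon>"
        using e by (simp add: b_def m_def t1_def)
      finally have "H t1 - H 0 + (b / 2 * \<epsilon> * k t1 - b / 2 * \<epsilon> * k 0) \<le> - 3 * \<epsilon>" using e by linarith
      moreover have "b / 2 * \<epsilon> * (k 0 - k t1) \<le> b / 2 * \<epsilon> * 4"
        using k_le(1)[of 0] k_le(1)[of t1] t1 Tm b e by (intro mult_left_mono) auto
      moreover have "b / 2 * \<epsilon> * (k 0 - k t1) = b / 2 * \<epsilon> * k 0 - b / 2 * \<epsilon> * k t1"
        by (rule right_diff_distrib)
      moreover have "b / 2 * \<epsilon> * 4 = \<epsilon> / 80" by (simp add: b_def)
      ultimately show False using H_t1 H0_le e by linarith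
    qed
    then have H_le: "H t \<le> 1 - \<epsilon>" if "t \<in> {t1..Tm}" for t using H_mono[of t1 t] that t1 by auto
    have q_ge: "\<epsilon> \<le> (q t)\<^sup>2" if t: "t \<in> {t1..Tm}" for t
    proof -
      have "\<epsilon> \<le> (1 - H t) * (1 + H t)"
      proof (cases "0 \<le> H t")
        case True
        have "\<epsilon> * 1 \<le> (1 - H t) * (1 + H t)" using True H_le[OF t] e by (intro mult_mono) auto
        then show ?thesis by simp
      next
        case False
        have "1 * \<epsilon> \<le> (1 - H t) * (1 + H t)" using False above[of t] t t1 e by (intro mult_mono) auto
        then show ?thesis by simp
      qed
      moreover have "(q t)\<^sup>2 = 1 - (H t)\<^sup>2" using q_pos(3)[of t] t t1 by auto
      ultimately show ?thesis by (simp add: algebra_simps power2_eq_square)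
    qed
    have "(- arccos (H Tm) + b / 2 * \<epsilon> * (k Tm / q Tm)) - (- arccos (H t1) + b / 2 * \<epsilon> * (k t1 / q t1))
        \<le> - (b / 4 * \<epsilon>) * (Tm - t1)"
    proof (rule diff_le_of_deriv_le[where f = "\<lambda>t. - arccos (H t) + b / 2 * \<epsilon> * (k t / q t)"
          and f' = "\<lambda>t. H1 t / q t + b / 2 * \<epsilon> * (k1 t / q t + k t * H t * H1 t / q t ^ 3)"])
      fix t assume tt: "t \<in> {t1..Tm}"
      then have t: "t \<in> {0..Tm}" using t1 by auto
      have H: "- 1 < H t" "H t < 1" using above[OF t] H_le[OF tt] e by auto
      have da: "((\<lambda>t. arccos (H t)) has_real_derivative inverse (- sqrt (1 - (H t)\<^sup>2)) * H1 t) (at t within {0..Tm})"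
        by (rule DERIV_chain'[OF dH[OF t] DERIV_arccos[OF H]])
      have dq: "(q has_real_derivative - (H t * H1 t) / q t) (at t within {0..Tm})"
      proof -
        have "((\<lambda>t. 1 - (H t)\<^sup>2) has_real_derivative 2 * - (H t * H1 t)) (at t within {0..Tm})"
          using t by (auto intro!: derivative_eq_intros dH)
        moreover have "0 < 1 - (H t)\<^sup>2" using q_pos[OF t] zero_less_power[of "q t" 2] by simp
        ultimately have "((\<lambda>t. sqrt (1 - (H t)\<^sup>2)) has_real_derivative
          inverse (sqrt (1 - (H t)\<^sup>2)) / 2 * (2 * - (H t * H1 t))) (at t within {0..Tm})"
          by (intro DERIV_chain'[OF _ DERIV_real_sqrt])
        then show ?thesis unfolding half_inverse by (simp add: q_def[abs_def])
      qed
      have dkq: "((\<lambda>t. k t / q t) has_real_derivative k1 t / q t + k t * H t * H1 t / q t ^ 3) (at t within {0..Tm})"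
      proof -
        have "((\<lambda>t. k t / q t) has_real_derivative (k1 t * q t - k t * (- (H t * H1 t) / q t)) / (q t * q t)) (at t within {0..Tm})"
          using q_pos(1)[OF t] by (intro DERIV_divide dk dq t) auto
        then show ?thesis using q_pos(1)[OF t] by (simp add: add_divide_distrib power3_eq_cube mult.assoc)
      qed
      have "((\<lambda>t. - arccos (H t) + b / 2 * \<epsilon> * (k t / q t)) has_real_derivative
          H1 t / q t + b / 2 * \<epsilon> * (k1 t / q t + k t * H t * H1 t / q t ^ 3)) (at t within {0..Tm})"
        by (rule derivative_eq_intros da dkq refl)+ (simp add: q_def field_simps)
      then show "((\<lambda>t. - arccos (H t) + b / 2 * \<epsilon> * (k t / q t)) has_real_derivative
          H1 t / q t + b / 2 * \<epsilon> * (k1 t / q t + k t * H t * H1 t / q t ^ 3)) (at t within {t1..Tm})"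
        by (rule has_field_derivative_subset) (use t1 in auto)
    next
      fix t assume "t1 < t" "t < Tm"
      then have tt: "t \<in> {t1..Tm}" and t: "t \<in> {0..Tm}" using t1 by auto
      have "(y t)\<^sup>2 \<le> 2 * \<rho> t"
        using mult_mono[OF y_le(1,2)[OF t]] by (simp add: power2_eq_square)
      then show "H1 t / q t + b / 2 * \<epsilon> * (k1 t / q t + k t * H t * H1 t / q t ^ 3) \<le> - (b / 4 * \<epsilon>)"
        using q_pos[OF t] q_ge[OF tt] q_le k_le[OF t] Habs[OF t] H1[OF t] lyap[OF t] e b
        by (intro normalized_lyapunov_bound[where \<rho> = "\<rho> t" and y = "y t"]) (auto simp: b_def)
    qed fact
    note decrease = this
    \<comment> \<open>A drop by 12.5, whereas \<open>arccos\<close> varies by at most 4 and the two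
      corrections contribute at most 1 each.\<close>
    have rate: "- (b / 4 * \<epsilon>) * (Tm - t1) = - (25 / 2)"
      using e by (simp add: b_def Tm_def t1_def field_simps)
    have bd: "- 4 \<le> - arccos (H t)" "- arccos (H t) \<le> 0" "\<bar>b / 2 * \<epsilon> * (k t / q t)\<bar> \<le> 1" if tt: "t \<in> {t1..Tm}" for t
    proof -
      have t: "t \<in> {0..Tm}" using tt t1 by auto
      show "- 4 \<le> - arccos (H t)" "- arccos (H t) \<le> 0"
        using arccos_bounded[of "H t"] Habs[OF t] pi_less_4 by (auto simp: abs_le_iff)
      have "q t \<le> 1" unfolding q_def by simp
      then have "q t * q t \<le> q t" using q_pos(1)[OF t] by (intro mult_left_le) auto
      then have "\<epsilon> \<le> q t" using q_ge[OF tt] by (simp add: power2_eq_square)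
      then have "\<epsilon> / q t \<le> 1" using q_pos(1)[OF t] by simp
      then have "b / 2 * \<bar>k t\<bar> * (\<epsilon> / q t) \<le> 1 / 2 * 2 * 1"
        using k_le(1)[OF t] q_pos(1)[OF t] e by (intro mult_mono) (auto simp: b_def)
      moreover have "\<bar>b / 2 * \<epsilon> * (k t / q t)\<bar> = b / 2 * \<bar>k t\<bar> * (\<epsilon> / q t)"
        using e b q_pos(1)[OF t] by (simp add: abs_mult abs_divide)
      ultimately show "\<bar>b / 2 * \<epsilon> * (k t / q t)\<bar> \<le> 1" by simp
    qed
    have ends: "t1 \<in> {t1..Tm}" "Tm \<in> {t1..Tm}" using t1 by auto
    define P where "P t = b / 2 * \<epsilon> * (k t / q t)" for t
    show False using decrease bd[OF ends(1)] bd[OF ends(2)] unfolding rate P_def[symmetric] abs_le_iff by argo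
  qed
  then obtain t where t: "t \<in> {0..Tm}" "H t \<le> - 1 + \<epsilon>" by blast
  have "steerable \<epsilon> t (x0, 0) (x t, y t)"
    by (rule steerableI[OF pendulum_trajectory_restrict[OF traj]]) (use t x0 y0 in auto)
  moreover have "(y t)\<^sup>2 / 2 + (1 - cos (x t)) \<le> \<epsilon>" using t by (simp add: H_def)
  ultimately show ?thesis using t(1) unfolding Tm_def by auto
qed

lemma steerable_rest_to_origin:
  assumes e: "0 < \<epsilon>" "\<epsilon> \<le> 1 / 2000"
  shows "\<exists>T \<le> 60002 / \<epsilon>. steerable \<epsilon> T (x0, 0) (0, 0)"
proof -
  have kick: "\<exists>T x1. T \<le> 1 \<and> \<epsilon> / 40 \<le> \<bar>sin x1\<bar> \<and> steerable \<epsilon> T (x0, 0) (x1, 0)"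
  proof (cases "\<bar>sin x0\<bar> < \<epsilon> / 40")
    case True
    then show ?thesis using steerable_kick[OF e True] by blast
  next
    case False
    have "pendulum_trajectory \<epsilon> 0 (\<lambda>t. x0) (\<lambda>t. 0) (\<lambda>t. (- sin x0 + sin x0) / \<epsilon>)"
      using e by (intro pendulum_trajectory_smoothI) (auto simp: has_field_derivative_def has_derivative_within_singleton_iff bounded_linear_mult_right)
    then have "steerable \<epsilon> 0 (x0, 0) (x0, 0)" by (rule steerableI) auto
    then show ?thesis using False by (intro exI[of _ 0] exI[of _ x0]) auto
  qed
  then obtain T1 x1 where 1: "T1 \<le> 1" "\<epsilon> / 40 \<le> \<bar>sin x1\<bar>" "steerable \<epsilon> T1 (x0, 0) (x1, 0)" by blast
  obtain T2 x2 y2 where 2: "T2 \<le> 60000 / \<epsilon>" "steerable \<epsilon> T2 (x1, 0) (x2, y2)" "y2\<^sup>2 / 2 + (1 - cos x2) \<le> \<epsilon>"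
    using steerable_brake[OF e 1(2)] by blast
  have "steerable \<epsilon> (T1 + T2 + 1 / \<epsilon>) (x0, 0) (0, 0)"
    using steerable_trans[OF e(1) steerable_trans[OF e(1) 1(3) 2(2)] steerable_capture[OF e 2(3)]] .
  moreover have "1 \<le> 1 / \<epsilon>" using e by (simp add: field_simps)
  then have "T1 + T2 + 1 / \<epsilon> \<le> 60002 / \<epsilon>" using 1(1) 2(1) by (simp add: add_divide_distrib)
  ultimately show ?thesis by blast
qed

section \<open>The upper bound\<close>

text \<open>Rolle gives a zero of \<open>g\<close> between the zeroes, so
  \<open>\<bar>g\<bar>\<close> is at most \<open>b - a\<close> times the maximum of
  \<open>\<bar>f\<bar>\<close>. Integrating from \<open>a\<close>, where \<open>f\<close> vanishes,
  bounds that maximum by \<open>b - a\<close> times itself if \<open>b - a < 1\<close>; hence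
  \<open>f\<close> and \<open>g a\<close> would vanish.\<close>

lemma zeroes_separated:
  fixes f g c :: "real \<Rightarrow> real"
  assumes f: "\<And>t. t \<in> {a..b} \<Longrightarrow> (f has_real_derivative g t) (at t within {a..b})"
    and g: "\<And>t. t \<in> {a..b} \<Longrightarrow> (g has_real_derivative - c t * f t) (at t within {a..b})"
    and c: "\<And>t. t \<in> {a..b} \<Longrightarrow> \<bar>c t\<bar> \<le> 1"
    and nz: "f a \<noteq> 0 \<or> g a \<noteq> 0" and ab: "a < b" and z: "f a = 0" "f b = 0"
  shows "1 \<le> b - a"
proof (rule ccontr)
  assume "\<not> ?thesis"
  then have ba: "b - a < 1" by simp
  have cf: "continuous_on {a..b} f" using f by (rule DERIV_continuous_on)
  have "\<exists>\<xi>>a. \<xi> < b \<and> (f has_real_derivative 0) (at \<xi>)"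
  proof (rule Rolle[OF ab _ cf])
    fix t assume "a < t" "t < b"
    then show "f differentiable (at t)"
      using f[of t] at_within_Icc_at[of a t b] real_differentiable_def by auto
  qed (use z in simp)
  then obtain \<xi> where \<xi>: "a < \<xi>" "\<xi> < b" and "(f has_real_derivative 0) (at \<xi>)" by blast
  then have g\<xi>: "g \<xi> = 0"
    using f[of \<xi>] at_within_Icc_at[of a \<xi> b] DERIV_unique by fastforce
  obtain M where M: "M \<in> {a..b}" "\<And>t. t \<in> {a..b} \<Longrightarrow> \<bar>f t\<bar> \<le> \<bar>f M\<bar>"
    using continuous_attains_sup[of "{a..b}" "\<lambda>t. \<bar>f t\<bar>"] ab cf continuous_on_rabs[OF cf] by auto
  have gb: "\<bar>g t\<bar> \<le> \<bar>f M\<bar> * (b - a)" if t: "t \<in> {a..b}" for t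
  proof -
    have *: "\<bar>g v - g u\<bar> \<le> \<bar>f M\<bar> * (v - u)" if "a \<le> u" "u \<le> v" "v \<le> b" for u v
    proof (rule abs_diff_le_of_deriv_le[where f' = "\<lambda>t. - c t * f t"])
      show "(g has_real_derivative - c t * f t) (at t within {u..v})" if "t \<in> {u..v}" for t
        by (rule has_field_derivative_subset[OF g]) (use that \<open>a \<le> u\<close> \<open>v \<le> b\<close> in auto)
      show "\<bar>- c t * f t\<bar> \<le> \<bar>f M\<bar>" if "u < t" "t < v" for t
        using mult_mono[OF c[of t] M(2)[of t]] that \<open>a \<le> u\<close> \<open>v \<le> b\<close> by (simp add: abs_mult)
    qed fact
    have "\<bar>g t\<bar> \<le> \<bar>f M\<bar> * \<bar>t - \<xi>\<bar>"
      using *[of \<xi> t] *[of t \<xi>] g\<xi> \<xi> t by (cases "\<xi> \<le> t") auto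
    also have "\<dots> \<le> \<bar>f M\<bar> * (b - a)" using \<xi> t by (intro mult_left_mono) auto
    finally show ?thesis .
  qed
  have "\<bar>f M - f a\<bar> \<le> (\<bar>f M\<bar> * (b - a)) * (M - a)"
  proof (rule abs_diff_le_of_deriv_le[where f' = g])
    show "(f has_real_derivative g t) (at t within {a..M})" if "t \<in> {a..M}" for t
      by (rule has_field_derivative_subset[OF f]) (use that M in auto)
  qed (use gb M in auto)
  also have "\<dots> \<le> (\<bar>f M\<bar> * (b - a)) * 1" using M ba ab by (intro mult_left_mono) auto
  finally have "\<bar>f M\<bar> * (1 - (b - a)) \<le> 0" using z by (simp add: algebra_simps)
  then have "\<bar>f M\<bar> \<le> 0" using ba by (simp add: mult_le_0_iff)
  then have "f M = 0" by simp
  then have "\<bar>g a\<bar> \<le> 0" using gb[of a] ab by simp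
  then show False using nz z by simp
qed

text \<open>Points at least 1 apart have distinct integer parts of \<open>t - a\<close>.\<close>

lemma finite_card_of_separated:
  fixes Z :: "real set"
  assumes Z: "Z \<subseteq> {a..b}" and sep: "\<And>s t. s \<in> Z \<Longrightarrow> t \<in> Z \<Longrightarrow> s < t \<Longrightarrow> 1 \<le> t - s"
  shows "finite Z" "a \<le> b \<Longrightarrow> real (card Z) \<le> b - a + 1"
proof -
  define h where "h t = nat \<lfloor>t - a\<rfloor>" for t
  have inj: "inj_on h Z"
  proof (rule inj_onI)
    have *: "h s < h t" if "s \<in> Z" "t \<in> Z" "s < t" for s t
    proof -
      have "s - a + 1 \<le> t - a" "0 \<le> s - a" using sep[OF that] Z that by auto
      then have "\<lfloor>s - a\<rfloor> + 1 \<le> \<lfloor>t - a\<rfloor>" "0 \<le> \<lfloor>s - a\<rfloor>" by linarith+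
      then show ?thesis unfolding h_def by linarith
    qed
    fix s t assume "s \<in> Z" "t \<in> Z" "h s = h t"
    then show "s = t" using *[of s t] *[of t s] by fastforce
  qed
  have im: "h ` Z \<subseteq> {..nat \<lfloor>b - a\<rfloor>}"
    using Z unfolding h_def by (force intro!: nat_mono floor_mono)
  show "finite Z" using inj im by (rule inj_on_finite) simp
  assume "a \<le> b"
  have "card Z \<le> nat \<lfloor>b - a\<rfloor> + 1" using card_inj_on_le[OF inj im] by simp
  then show "real (card Z) \<le> b - a + 1" using \<open>a \<le> b\<close> by linarith
qed

lemma adjoint_nontrivial:
  assumes "adjoint_variables \<epsilon> T x y u \<phi> \<psi>" "t \<in> {0..T}" "\<psi> t = 0"
  shows "y t * \<phi> t = 1" "\<phi> t \<noteq> 0"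
proof -
  have "y t * \<phi> t + (- sin (x t) + \<epsilon> * u t) * \<psi> t - 1 = 0"
    using assms(1,2) unfolding adjoint_variables_def by blast
  then show "y t * \<phi> t = 1" using assms(3) by simp
  then show "\<phi> t \<noteq> 0" by auto
qed

lemma adjoint_zeroes_separated:
  assumes "adjoint_variables \<epsilon> T x y u \<phi> \<psi>" "s \<in> {0..T}" "t \<in> {0..T}" "\<psi> s = 0" "\<psi> t = 0" "s < t"
  shows "1 \<le> t - s"
proof (rule zeroes_separated[where f = \<psi> and g = "\<lambda>t. - \<phi> t" and c = "\<lambda>t. cos (x t)"])
  fix r assume r: "r \<in> {s..t}"
  then have r': "r \<in> {0..T}" using assms by auto
  show "(\<psi> has_real_derivative - \<phi> r) (at r within {s..t})"
    by (rule has_field_derivative_subset[of _ _ _ "{0..T}"])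
      (use assms r' in \<open>auto simp: adjoint_variables_def\<close>)
  have "(\<phi> has_real_derivative cos (x r) * \<psi> r) (at r within {s..t})"
    by (rule has_field_derivative_subset[of _ _ _ "{0..T}"])
      (use assms r' in \<open>auto simp: adjoint_variables_def\<close>)
  then show "((\<lambda>t. - \<phi> t) has_real_derivative - cos (x r) * \<psi> r) (at r within {s..t})"
    by (auto intro!: derivative_eq_intros)
qed (use assms adjoint_nontrivial(2)[OF assms(1,2)] in auto)

text \<open>At consecutive zeroes of \<open>\<psi>\<close> the slopes \<open>- \<phi> = - 1 / y\<close> have opposite signs, so the speed vanishes in between.\<close>

lemma rest_between_adjoint_zeroes:
  assumes adj: "adjoint_variables \<epsilon> T x y u \<phi> \<psi>" and y: "continuous_on {0..T} y"
    and ab: "0 \<le> a" "a < b" "b \<le> T" and z: "\<psi> a = 0" "\<psi> b = 0"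
    and nz: "\<And>t. a < t \<Longrightarrow> t < b \<Longrightarrow> \<psi> t \<noteq> 0"
  shows "\<exists>t\<in>{a..b}. y t = 0"
proof (rule ccontr)
  assume no: "\<not> ?thesis"
  have ds: "(\<psi> has_real_derivative - \<phi> t) (at t within {a..b})" if "t \<in> {a..b}" for t
    by (rule has_field_derivative_subset[of _ _ _ "{0..T}"])
      (use adj ab that in \<open>auto simp: adjoint_variables_def\<close>)
  have c: "continuous_on {a..b} \<psi>" using ds by (rule DERIV_continuous_on)
  have cy: "continuous_on {a..b} y" by (rule continuous_on_subset[OF y]) (use ab in auto)
  have ya: "y a * \<phi> a = 1" and yb: "y b * \<phi> b = 1"
    using adjoint_nontrivial(1)[OF adj] z ab by auto
  have "0 < y a * y b"
  proof (rule ccontr)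
    assume "\<not> ?thesis"
    then have "y a * y b \<le> 0" by simp
    then have "y a \<le> 0 \<and> 0 \<le> y b \<or> y b \<le> 0 \<and> 0 \<le> y a" by (auto simp: mult_le_0_iff)
    then show False
      using IVT'[of y a 0 b] IVT2'[of y b 0 a] cy ab no by fastforce
  qed
  \<comment> \<open>Since \<open>y a * \<phi> a = 1\<close> and \<open>y b * \<phi> b = 1\<close>,
    this product equals \<open>y a * y b\<close>.\<close>
  then have "0 < \<phi> a * \<phi> b * (y a * y b) * (y a * y b)" using ya yb
    by (simp add: algebra_simps)
  then have \<phi>: "0 < \<phi> a * \<phi> b" using \<open>0 < y a * y b\<close> by (simp add: zero_less_mult_iff)
  have at_a: "(\<psi> has_real_derivative - \<phi> a) (at a within {a..b})" and at_b: "(\<psi> has_real_derivative - \<phi> b) (at b within {a..b})"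
    using ds ab by auto
  define m where "m = (a + b) / 2"
  have sgn_const: "0 < \<psi> t * \<psi> m" if t: "a < t" "t < b" for t
  proof (rule ccontr)
    assume "\<not> ?thesis"
    then have "\<psi> t \<le> 0 \<and> 0 \<le> \<psi> m \<or> \<psi> m \<le> 0 \<and> 0 \<le> \<psi> t" by (auto simp: mult_le_0_iff not_less)
    moreover have "continuous_on {min t m..max t m} \<psi>"
      by (rule continuous_on_subset[OF c]) (use t ab in \<open>auto simp: m_def min_def max_def\<close>)
    ultimately have "\<exists>s\<in>{min t m..max t m}. \<psi> s = 0"
      using IVT'[of \<psi> "min t m" 0 "max t m"] IVT2'[of \<psi> "max t m" 0 "min t m"]
      by (cases "t \<le> m") (fastforce simp: min_def max_def)+
    then show False using nz t ab by (auto simp: m_def min_def max_def split: if_splits)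
  qed
  \<comment> \<open>\<open>\<psi>\<close> keeps the sign of its midpoint value on the open interval,
    so the difference quotients at the two ends, and with them the slopes, have opposite
    signs.\<close>
  have lim_a: "((\<lambda>t. (\<psi> t - \<psi> a) / (t - a)) \<longlongrightarrow> - \<phi> a) (at a within {a..b})"
    and lim_b: "((\<lambda>t. (\<psi> t - \<psi> b) / (t - b)) \<longlongrightarrow> - \<phi> b) (at b within {a..b})"
    using at_a at_b unfolding has_field_derivative_iff by auto
  have "0 \<le> - \<phi> a * \<psi> m"
  proof (rule tendsto_lowerbound[OF tendsto_mult_right[OF lim_a]])
    show "\<forall>\<^sub>F t in at a within {a..b}. 0 \<le> (\<psi> t - \<psi> a) / (t - a) * \<psi> m"
      unfolding eventually_at
    proof (intro exI[of _ "b - a"] conjI ballI impI)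
      fix t assume "t \<in> {a..b}" "t \<noteq> a \<and> dist t a < b - a"
      then have "0 < \<psi> t * \<psi> m" "a < t" using sgn_const by (auto simp: dist_real_def)
      then show "0 \<le> (\<psi> t - \<psi> a) / (t - a) * \<psi> m" using z by simp
    qed (use ab in auto)
  qed (use ab in \<open>simp add: at_within_Icc_at_right\<close>)
  moreover have "0 \<le> - (- \<phi> b) * \<psi> m"
  proof (rule tendsto_lowerbound[OF tendsto_mult_right[OF tendsto_minus[OF lim_b]]])
    show "\<forall>\<^sub>F t in at b within {a..b}. 0 \<le> - ((\<psi> t - \<psi> b) / (t - b)) * \<psi> m"
      unfolding eventually_at
    proof (intro exI[of _ "b - a"] conjI ballI impI)
      fix t assume "t \<in> {a..b}" "t \<noteq> b \<and> dist t b < b - a"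
      then have "0 < \<psi> t * \<psi> m" "t < b" using sgn_const by (auto simp: dist_real_def)
      then show "0 \<le> - ((\<psi> t - \<psi> b) / (t - b)) * \<psi> m" using z
        by (simp add: divide_le_0_iff mult_ac)
    qed (use ab in auto)
  qed (use ab in \<open>simp add: at_within_Icc_at_left\<close>)
  ultimately have "\<phi> a * \<psi> m \<le> 0" "0 \<le> \<phi> b * \<psi> m" by auto
  moreover have "\<psi> m \<noteq> 0" using nz[of m] ab by (auto simp: m_def)
  ultimately show False using \<phi>
    by (auto simp: zero_less_mult_iff mult_le_0_iff zero_le_mult_iff)
qed

text \<open>The instant of rest \<open>r\<close> lies between the first two zeroes, so only the
  first zero can precede it, however long that takes. After \<open>r\<close>, optimality limits the
  remaining time to that of the explicit steering, and separation turns time into a count.\<close>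

lemma num_zeroes_le:
  assumes e: "0 < \<epsilon>" "\<epsilon> \<le> 1 / 2000" and opt: "optimal_trajectory \<epsilon> x0 y0 T x y u"
    and adj: "adjoint_variables \<epsilon> T x y u \<phi> \<psi>"
  shows "ereal_of_enat (num_zeroes T \<psi>) \<le> ereal (60004 / \<epsilon>)"
proof -
  define Z where "Z = {t \<in> {0..T}. \<psi> t = 0}"
  have tr: "pendulum_trajectory \<epsilon> T x y u" and ends: "[x 0 = x0] (rmod 2 * pi)" "y 0 = y0"
    using opt by (auto simp: optimal_trajectory_def steers_to_equilibrium_def)
  have T: "0 \<le> T" using tr by (simp add: pendulum_trajectory_def)
  have sep: "1 \<le> t - s" if "s \<in> Z" "t \<in> Z" "s < t" for s t
    using that adjoint_zeroes_separated[OF adj] by (auto simp: Z_def)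
  have fin: "finite Z" by (rule finite_card_of_separated(1)[of Z 0 T]) (use sep in \<open>auto simp: Z_def\<close>)
  have "real (card Z) \<le> 60004 / \<epsilon>"
  proof (cases "card Z \<le> 1")
    case True
    then have "real (card Z) \<le> 1" by simp
    also have "1 \<le> 60004 / \<epsilon>" using e by (simp add: field_simps)
    finally show ?thesis .
  next
    case False
    define z1 where "z1 = Min Z"
    have ne: "Z \<noteq> {}" using False by auto
    have z1: "z1 \<in> Z" "\<And>t. t \<in> Z \<Longrightarrow> z1 \<le> t" unfolding z1_def using fin ne by auto
    define z2 where "z2 = Min (Z - {z1})"
    have ne2: "Z - {z1} \<noteq> {}" using False card_mono[of "{z1}" Z] by auto
    have "z2 \<in> Z - {z1}" and z2: "\<And>t. t \<in> Z - {z1} \<Longrightarrow> z2 \<le> t"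
      unfolding z2_def using fin ne2 by (auto simp del: Diff_iff intro: Min_in)
    then have z2Z: "z2 \<in> Z" "z1 < z2" using z1(2)[of z2] by auto
    have "\<exists>t\<in>{z1..z2}. y t = 0"
    proof (rule rest_between_adjoint_zeroes[OF adj pendulum_trajectory_continuous(2)[OF tr]])
      fix t assume "z1 < t" "t < z2"
      then show "\<psi> t \<noteq> 0" using z2[of t] z1(1) z2Z(1) by (auto simp: Z_def)
    qed (use z1(1) z2Z in \<open>auto simp: Z_def\<close>)
    then obtain r where r: "z1 \<le> r" "r \<le> z2" "y r = 0" by auto
    have rT: "0 \<le> r" "r \<le> T" using r z1(1) z2Z(1) by (auto simp: Z_def)
    obtain T' where T': "T' \<le> 60002 / \<epsilon>" "steerable \<epsilon> T' (x r, 0) (0, 0)"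
      using steerable_rest_to_origin[OF e] by blast
    have "steerable \<epsilon> r (x0, y0) (x r, 0)"
      by (rule steerableI[OF pendulum_trajectory_restrict[OF tr rT]]) (use ends r in auto)
    from steerable_trans[OF e(1) this T'(2)]
    obtain x' y' u' where "steers_to_equilibrium \<epsilon> x0 y0 (r + T') x' y' u'"
      by (auto simp: steerable_def steers_to_equilibrium_def)
    then have "T \<le> r + T'" using opt by (auto simp: optimal_trajectory_def)
    have "Z \<subseteq> insert z1 (Z \<inter> {r..T})" using z2 r by (force simp: Z_def)
    then have "card Z \<le> card (insert z1 (Z \<inter> {r..T}))" using fin by (intro card_mono) auto
    also have "\<dots> \<le> card (Z \<inter> {r..T}) + 1" using fin by (simp add: card_insert_if)
    finally have "real (card Z) \<le> real (card (Z \<inter> {r..T})) + 1" by simp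
    also have "real (card (Z \<inter> {r..T})) \<le> T - r + 1"
      by (rule finite_card_of_separated(2)) (use sep rT in auto)
    also have "T - r \<le> 60002 / \<epsilon>" using \<open>T \<le> r + T'\<close> T' by simp
    also have "60002 / \<epsilon> + 1 + 1 \<le> 60004 / \<epsilon>" using e by (simp add: field_simps)
    finally show ?thesis by simp
  qed
  then show ?thesis using fin unfolding num_zeroes_def Let_def Z_def[symmetric] by simp
qed

lemma N_sup_le:
  assumes e: "0 < \<epsilon>" "\<epsilon> \<le> 1 / 2000"
  shows "ereal_of_enat (N_sup \<epsilon>) \<le> ereal (60004 / \<epsilon>)"
proof -
  \<comment> \<open>The suprema are taken in \<open>enat\<close>, so the real bound is rounded down
    to an integer first.\<close>
  define n where "n = nat \<lfloor>60004 / \<epsilon>\<rfloor>"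
  have nn: "real n \<le> 60004 / \<epsilon>" using e by (simp add: n_def)
  have "num_zeroes T \<psi> \<le> enat n"
    if "optimal_trajectory \<epsilon> x0 y0 T x y u" "adjoint_variables \<epsilon> T x y u \<phi> \<psi>" for x0 y0 T x y u \<phi> \<psi>
  proof -
    have "ereal_of_enat (num_zeroes T \<psi>) \<le> ereal (60004 / \<epsilon>)" using num_zeroes_le[OF e that] .
    then show ?thesis
      by (cases "num_zeroes T \<psi>") (auto simp: n_def le_nat_floor)
  qed
  then have "N_sup \<epsilon> \<le> enat n" unfolding N_sup_def N_point_def by (auto intro!: SUP_least Sup_least)
  then have "ereal_of_enat (N_sup \<epsilon>) \<le> ereal_of_enat (enat n)" by (simp only: ereal_of_enat_le_iff)
  with nn show ?thesis by (metis ereal_less_eq(3) ereal_of_enat_simps(1) order_trans)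
qed

section \<open>A relaxed problem with free end point\<close>

text \<open>Time is reversed, so that trajectories start at the equilibrium. A control is represented by
  its primitive \<open>V\<close>, and \<open>y - \<epsilon> V\<close> is continuously differentiable for every Lipschitz \<open>V\<close>;
  the class of primitives is closed under uniform limits.\<close>

definition control_primitives :: "(real \<Rightarrow> real) set" where
  "control_primitives = {V. V 0 = 0 \<and> (\<forall>s t. \<bar>V s - V t\<bar> \<le> \<bar>s - t\<bar>)}"

definition relaxed_trajectory :: "real \<Rightarrow> real \<Rightarrow> (real \<Rightarrow> real) \<Rightarrow> (real \<Rightarrow> real) \<Rightarrow> (real \<Rightarrow> real) \<Rightarrow> bool" where
  "relaxed_trajectory \<epsilon> T V x y \<longleftrightarrow> x 0 = 0 \<and> y 0 = 0 \<and> V 0 = 0 \<and>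
    (\<forall>t\<in>{0..T}. (x has_real_derivative y t) (at t within {0..T})) \<and>
    (\<forall>t\<in>{0..T}. ((\<lambda>t. y t - \<epsilon> * V t) has_real_derivative - sin (x t)) (at t within {0..T}))"

lemma control_primitivesD:
  assumes "V \<in> control_primitives"
  shows "V 0 = 0" "\<bar>V s - V t\<bar> \<le> \<bar>s - t\<bar>" "\<bar>V t\<bar> \<le> \<bar>t\<bar>" "continuous_on A V"
proof -
  show *: "V 0 = 0" "\<bar>V s - V t\<bar> \<le> \<bar>s - t\<bar>" for s t using assms by (auto simp: control_primitives_def)
  show "\<bar>V t\<bar> \<le> \<bar>t\<bar>" using *(2)[of t 0] *(1) by simp
  have "1-lipschitz_on A V" by (rule lipschitz_onI) (use *(2) in \<open>auto simp: dist_real_def\<close>)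
  then show "continuous_on A V" by (rule lipschitz_on_continuous_on)
qed

lemma control_primitive_extend:
  assumes "V 0 = 0" "0 \<le> T" "\<And>s t. s \<in> {0..T} \<Longrightarrow> t \<in> {0..T} \<Longrightarrow> \<bar>V s - V t\<bar> \<le> \<bar>s - t\<bar>"
  shows "(\<lambda>t. V (max 0 (min T t))) \<in> control_primitives"
proof -
  have "\<bar>V (max 0 (min T s)) - V (max 0 (min T t))\<bar> \<le> \<bar>s - t\<bar>" for s t
  proof -
    have "\<bar>V (max 0 (min T s)) - V (max 0 (min T t))\<bar> \<le> \<bar>max 0 (min T s) - max 0 (min T t)\<bar>"
      using assms by (intro assms(3)) auto
    also have "\<dots> \<le> \<bar>s - t\<bar>" by (auto simp: max_def min_def)
    finally show ?thesis .
  qed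
  then show ?thesis using assms by (simp add: control_primitives_def)
qed

text \<open>In the unknowns \<open>x\<close> and \<open>p = y - \<epsilon> * V\<close> the system is
  an ordinary Lipschitz equation with continuous coefficients; the control enters through
  \<open>V\<close> only.\<close>

lemma relaxed_trajectory_exists:
  assumes "0 \<le> T" "V \<in> control_primitives"
  shows "\<exists>x y. relaxed_trajectory \<epsilon> T V x y"
proof -
  obtain x p where *: "x 0 = 0" "p 0 = 0"
    "\<And>t. t \<in> {0..T} \<Longrightarrow> (x has_real_derivative p t + \<epsilon> * V t) (at t within {0..T})"
    "\<And>t. t \<in> {0..T} \<Longrightarrow> (p has_real_derivative - sin (x t)) (at t within {0..T})"
  proof (rule lipschitz_ode_exists_planar[OF assms(1), where L = 1 and f = "\<lambda>t x p. p + \<epsilon> * V t" and g = "\<lambda>t x p. - sin x"])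
    show "continuous_on {0..T} (\<lambda>t. q t + \<epsilon> * V t)" if "continuous_on {0..T} q" for q
      by (intro continuous_intros that control_primitivesD(4) assms)
    show "\<bar>- sin p - - sin p'\<bar> \<le> 1 * (\<bar>p - p'\<bar> + \<bar>q - q'\<bar>)" for p q p' q' :: real
      using abs_sin_diff_le[of p' p] abs_minus_commute[of p p'] abs_ge_zero[of "q - q'"] by simp
  qed (auto intro!: continuous_intros)
  then have "relaxed_trajectory \<epsilon> T V x (\<lambda>t. p t + \<epsilon> * V t)"
    using control_primitivesD(1)[OF assms(2)] by (auto simp: relaxed_trajectory_def)
  then show ?thesis by blast
qed

lemma relaxed_trajectory_restrict:
  assumes "relaxed_trajectory \<epsilon> T V x y" "T' \<le> T"
  shows "relaxed_trajectory \<epsilon> T' V x y"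
proof -
  have s: "{0..T'} \<subseteq> {0..T}" using assms by auto
  have "(x has_real_derivative y t) (at t within {0..T'})"
    "((\<lambda>t. y t - \<epsilon> * V t) has_real_derivative - sin (x t)) (at t within {0..T'})" if "t \<in> {0..T'}" for t
    using assms(1) that s by (auto simp: relaxed_trajectory_def intro!: has_field_derivative_subset[OF _ s])
  then show ?thesis using assms by (auto simp: relaxed_trajectory_def)
qed

text \<open>Gronwall for the squared distance in the coordinates \<open>x\<close> and
  \<open>y - \<epsilon> * V\<close>. Closeness of the primitives is enough, the controls themselves
  may be far apart; this gives the compactness argument its continuity. With
  \<open>\<eta> = 0\<close> it is uniqueness, which is used repeatedly below.\<close>

lemma relaxed_trajectory_stable:
  assumes x: "relaxed_trajectory \<epsilon> T V x y" and x': "relaxed_trajectory \<epsilon> T V' x' y'"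
    and V: "\<And>t. t \<in> {0..T} \<Longrightarrow> \<bar>V t - V' t\<bar> \<le> \<eta>" and e: "0 < \<epsilon>" "\<epsilon> \<le> 1" and t: "t \<in> {0..T}"
  shows "\<bar>x t - x' t\<bar> \<le> \<eta> * exp (2 * t)"
proof -
  define \<delta> \<beta> where "\<delta> t = x t - x' t" and "\<beta> t = (y t - \<epsilon> * V t) - (y' t - \<epsilon> * V' t)" for t
  have d\<delta>: "(\<delta> has_real_derivative \<beta> s + \<epsilon> * (V s - V' s)) (at s within {0..T})" if "s \<in> {0..T}" for s
  proof -
    have "(\<delta> has_real_derivative y s - y' s) (at s within {0..T})"
      unfolding \<delta>_def[abs_def] using x x' that by (intro DERIV_diff) (auto simp: relaxed_trajectory_def)
    then show ?thesis by (simp add: \<beta>_def algebra_simps)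
  qed
  have d\<beta>: "(\<beta> has_real_derivative - sin (x s) - - sin (x' s)) (at s within {0..T})" if "s \<in> {0..T}" for s
    unfolding \<beta>_def[abs_def] using x x' that by (intro DERIV_diff) (auto simp: relaxed_trajectory_def)
  define n where "n s = (\<delta> s)\<^sup>2 + (\<beta> s)\<^sup>2" for s
  define n' where "n' s = 2 * \<delta> s * (\<beta> s + \<epsilon> * (V s - V' s)) + 2 * \<beta> s * (sin (x' s) - sin (x s))" for s
  have dn: "(n has_real_derivative n' s) (at s within {0..T})" if "s \<in> {0..T}" for s
    unfolding n_def[abs_def] n'_def using that by (auto intro!: derivative_eq_intros d\<delta> d\<beta> simp: algebra_simps)
  have n'_le: "n' s \<le> 3 * n s + \<eta>\<^sup>2" if s: "s \<in> {0..T}" for s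
  proof -
    note am = sum_squares_bound
    have "(\<epsilon> * (V s - V' s))\<^sup>2 \<le> \<eta>\<^sup>2"
    proof -
      have "\<bar>\<epsilon> * (V s - V' s)\<bar> \<le> 1 * \<eta>" unfolding abs_mult using e V[OF s] by (intro mult_mono) auto
      then show ?thesis by (metis abs_ge_zero mult_1 power2_abs power_mono)
    qed
    moreover have "(sin (x' s) - sin (x s))\<^sup>2 \<le> (\<delta> s)\<^sup>2"
      unfolding abs_le_square_iff[symmetric] \<delta>_def using abs_sin_diff_le[of "x' s" "x s"] by (simp add: abs_minus_commute)
    moreover have "n' s = 2 * \<delta> s * \<beta> s + 2 * \<delta> s * (\<epsilon> * (V s - V' s)) + 2 * \<beta> s * (sin (x' s) - sin (x s))"
      by (simp add: n'_def distrib_left)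
    ultimately show ?thesis
      using am[of "\<delta> s" "\<beta> s"] am[of "\<delta> s" "\<epsilon> * (V s - V' s)"] am[of "\<beta> s" "sin (x' s) - sin (x s)"]
        zero_le_power2[of "\<beta> s"]
      unfolding n_def by argo
  qed
  have "(n t + \<eta>\<^sup>2) * exp (- 3 * t) - (n 0 + \<eta>\<^sup>2) * exp (- 3 * 0) \<le> 0 * (t - 0)"
  proof (rule diff_le_of_deriv_le[where f' = "\<lambda>s. (n' s - 3 * (n s + \<eta>\<^sup>2)) * exp (- 3 * s)"])
    fix s assume "s \<in> {0..t}"
    then have "(n has_real_derivative n' s) (at s within {0..t})"
      by (intro has_field_derivative_subset[OF dn]) (use t in auto)
    then show "((\<lambda>s. (n s + \<eta>\<^sup>2) * exp (- 3 * s)) has_real_derivative (n' s - 3 * (n s + \<eta>\<^sup>2)) * exp (- 3 * s)) (at s within {0..t})"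
      by (auto intro!: derivative_eq_intros simp: algebra_simps)
  next
    fix s assume "0 < s" "s < t"
    then have "n' s \<le> 3 * n s + \<eta>\<^sup>2" using t by (intro n'_le) auto
    with zero_le_power2[of \<eta>] have "n' s - 3 * (n s + \<eta>\<^sup>2) \<le> 0" by argo
    then show "(n' s - 3 * (n s + \<eta>\<^sup>2)) * exp (- 3 * s) \<le> 0" by (simp add: mult_nonpos_nonneg)
  qed (use t in auto)
  moreover have "n 0 = 0"
    using x x' V[of 0] t by (simp add: n_def \<delta>_def \<beta>_def relaxed_trajectory_def)
  ultimately have "(n t + \<eta>\<^sup>2) * exp (- 3 * t) \<le> \<eta>\<^sup>2" by simp
  then have "n t + \<eta>\<^sup>2 \<le> \<eta>\<^sup>2 * exp (3 * t)" by (simp add: exp_minus field_simps)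
  then have "(\<delta> t)\<^sup>2 \<le> \<eta>\<^sup>2 * exp (3 * t)" unfolding n_def
    using zero_le_power2[of "\<beta> t"] zero_le_power2[of \<eta>] by linarith
  \<comment> \<open>The exponent is rounded up so that the bound is a perfect square.\<close>
  also have "\<dots> \<le> \<eta>\<^sup>2 * exp (4 * t)" using t by (intro mult_left_mono) auto
  also have "\<dots> = (\<eta> * exp (2 * t))\<^sup>2" by (simp add: power_mult_distrib exp_double[symmetric])
  finally have "\<bar>\<delta> t\<bar> \<le> \<bar>\<eta> * exp (2 * t)\<bar>" by (simp add: abs_le_square_iff)
  moreover have "0 \<le> \<eta>" using V[OF t] by simp
  ultimately show ?thesis by (simp add: \<delta>_def)
qed

text \<open>Direct method: primitives of admissible controls are uniformly bounded and
  equicontinuous on \<open>{0..M}\<close>, so a minimising sequence has a uniformly convergent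
  subsequence, and the cost passes to the limit by stability.\<close>

lemma relaxed_minimizer_exists:
  assumes e: "0 < \<epsilon>" "\<epsilon> \<le> 1" and M: "0 \<le> M" and K: "0 \<le> K"
  obtains T V x y where "T \<in> {0..M}" "V \<in> control_primitives" "relaxed_trajectory \<epsilon> M V x y"
    "\<forall>T'\<in>{0..M}. \<forall>V'\<in>control_primitives. \<forall>x' y'. relaxed_trajectory \<epsilon> M V' x' y' \<longrightarrow>
      T + K * (1 + cos (x T)) \<le> T' + K * (1 + cos (x' T'))"
proof -
  define A where "A = {T + K * (1 + cos (x T)) | T V x y. T \<in> {0..M} \<and> V \<in> control_primitives \<and> relaxed_trajectory \<epsilon> M V x y}"
  have zero: "(\<lambda>t. 0) \<in> control_primitives" by (simp add: control_primitives_def)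
  obtain x0 y0 where 0: "relaxed_trajectory \<epsilon> M (\<lambda>t. 0) x0 y0"
    using relaxed_trajectory_exists[OF M zero] by blast
  have ne: "A \<noteq> {}" using 0 zero M unfolding A_def by fastforce
  have "0 \<le> a" if "a \<in> A" for a
  proof -
    have "0 \<le> T + K * (1 + cos z)" if "0 \<le> T" for T z
    proof -
      have "0 \<le> 1 + cos z" using cos_ge_minus_one[of z] by linarith
      then show ?thesis using that K by simp
    qed
    then show ?thesis using that unfolding A_def by auto
  qed
  then have bdd: "bdd_below A" by (rule bdd_belowI)
  have "\<exists>T V x y. T \<in> {0..M} \<and> V \<in> control_primitives \<and> relaxed_trajectory \<epsilon> M V x y \<and>
      T + K * (1 + cos (x T)) < Inf A + 1 / real (Suc n)" for n
  proof -
    obtain a where "a \<in> A" "a < Inf A + 1 / real (Suc n)"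
      using cInf_lessD[OF ne, of "Inf A + 1 / real (Suc n)"] by auto
    then show ?thesis unfolding A_def by blast
  qed
  then obtain T V x y where seq: "\<And>n. T n \<in> {0..M}" "\<And>n. V n \<in> control_primitives"
    "\<And>n. relaxed_trajectory \<epsilon> M (V n) (x n) (y n)"
    "\<And>n. T n + K * (1 + cos (x n (T n))) < Inf A + 1 / real (Suc n)" by metis
  obtain g k where g: "continuous_on {0..M} g" and k: "strict_mono (k :: nat \<Rightarrow> nat)"
    and lim: "\<And>e. 0 < e \<Longrightarrow> \<exists>N. \<forall>n t. n \<ge> N \<and> t \<in> {0..M} \<longrightarrow> norm ((V (k n) t, T (k n)) - g t) < e"
  \<comment> \<open>The end times travel along as constant second components, so that one
    subsequence serves the primitives and the times.\<close>
  proof (rule Arzela_Ascoli[of "{0..M}" "\<lambda>n t. (V n t, T n)" "2 * M"])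
    fix n t assume t: "t \<in> {0..M}"
    have "norm (V n t, T n) \<le> norm (V n t) + norm (T n)" by (rule norm_Pair_le)
    also have "\<dots> \<le> 2 * M" using seq(1)[of n] control_primitivesD(3)[OF seq(2), of n t] t by auto
    finally show "norm (V n t, T n) \<le> 2 * M" .
  next
    fix t e :: real assume "0 < e"
    have "norm ((V n t, T n) - (V n s, T n)) \<le> \<bar>t - s\<bar>" for n s
      using control_primitivesD(2)[OF seq(2), of n t s] by (simp add: norm_Pair)
    then show "\<exists>d>0. \<forall>n s. s \<in> {0..M} \<and> norm (t - s) < d \<longrightarrow> norm ((V n t, T n) - (V n s, T n)) < e"
      using \<open>0 < e\<close> by (intro exI[of _ e]) (auto intro: le_less_trans)
  qed auto
  have lim_g: "(\<lambda>n. (V (k n) t, T (k n))) \<longlonglongrightarrow> g t" if "t \<in> {0..M}" for t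
    unfolding LIMSEQ_iff using lim that by blast
  define T' where "T' = snd (g 0)"
  have limT: "(\<lambda>n. T (k n)) \<longlonglongrightarrow> T'"
    unfolding T'_def using tendsto_snd[OF lim_g[of 0]] M by simp
  have limV: "(\<lambda>n. V (k n) t) \<longlonglongrightarrow> fst (g t)" if "t \<in> {0..M}" for t
    using tendsto_fst[OF lim_g[OF that]] by simp
  have T': "T' \<in> {0..M}"
    by (rule closed_sequentially[OF closed_real_atLeastAtMost _ limT]) (rule seq(1))
  define W where "W t = fst (g (max 0 (min M t)))" for t
  have W_eq: "W t = fst (g t)" if "t \<in> {0..M}" for t using that by (simp add: W_def min_absorb2 max_absorb2)
  have W: "W \<in> control_primitives"
    unfolding W_def[abs_def]
  proof (rule control_primitive_extend[OF _ M])
    have "(\<lambda>n. 0) \<longlonglongrightarrow> fst (g 0)"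
      using limV[of 0] M unfolding control_primitivesD(1)[OF seq(2)] by simp
    then show "fst (g 0) = 0" unfolding LIMSEQ_const_iff by (rule sym)
    show "\<bar>fst (g s) - fst (g t)\<bar> \<le> \<bar>s - t\<bar>" if "s \<in> {0..M}" "t \<in> {0..M}" for s t
      by (rule LIMSEQ_le_const2[OF tendsto_rabs[OF tendsto_diff[OF limV limV]]])
        (use that control_primitivesD(2)[OF seq(2)] in auto)
  qed
  obtain X Y where X: "relaxed_trajectory \<epsilon> M W X Y" using relaxed_trajectory_exists[OF M W] by blast
  have contX: "continuous_on {0..M} X"
    using X by (intro DERIV_continuous_on) (auto simp: relaxed_trajectory_def)
  have fst_le: "\<bar>fst z\<bar> \<le> norm z" for z :: "real \<times> real"
    using norm_fst_le[of "fst z" "snd z"] by simp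
  have "(\<lambda>n. x (k n) (T (k n)) - X (T (k n))) \<longlonglongrightarrow> 0"
  proof (rule LIMSEQ_I)
    fix r :: real assume "0 < r"
    then have "0 < r / exp (2 * M) / 2" by simp
    from lim[OF this] obtain N where N: "\<And>n t. n \<ge> N \<Longrightarrow> t \<in> {0..M} \<Longrightarrow> norm ((V (k n) t, T (k n)) - g t) < r / exp (2 * M) / 2"
      by blast
    have "norm (x (k n) (T (k n)) - X (T (k n)) - 0) < r" if "n \<ge> N" for n
    proof -
      have "\<bar>V (k n) t - W t\<bar> \<le> r / exp (2 * M) / 2" if "t \<in> {0..M}" for t
        using less_imp_le[OF le_less_trans[OF fst_le N[OF \<open>n \<ge> N\<close> that]]] W_eq[OF that] by simp
      from relaxed_trajectory_stable[OF seq(3) X this e seq(1)]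
      have "\<bar>x (k n) (T (k n)) - X (T (k n))\<bar> \<le> r / exp (2 * M) / 2 * exp (2 * T (k n))" .
      also have "\<dots> \<le> r / exp (2 * M) / 2 * exp (2 * M)"
        using \<open>0 < r\<close> seq(1)[of "k n"] by (intro mult_left_mono) auto
      also have "\<dots> < r" using \<open>0 < r\<close> by simp
      finally show ?thesis by simp
    qed
    then show "\<exists>no. \<forall>n\<ge>no. norm (x (k n) (T (k n)) - X (T (k n)) - 0) < r" by blast
  qed
  moreover have "(\<lambda>n. X (T (k n))) \<longlonglongrightarrow> X T'"
    by (rule continuous_on_tendsto_compose[OF contX limT T']) (intro always_eventually allI seq(1))
  ultimately have "(\<lambda>n. (x (k n) (T (k n)) - X (T (k n))) + X (T (k n))) \<longlonglongrightarrow> 0 + X T'"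
    by (rule tendsto_add)
  then have limx: "(\<lambda>n. x (k n) (T (k n))) \<longlonglongrightarrow> X T'" by simp
  have "T' + K * (1 + cos (X T')) \<le> Inf A + 0"
  proof (rule LIMSEQ_le)
    show "(\<lambda>n. T (k n) + K * (1 + cos (x (k n) (T (k n))))) \<longlonglongrightarrow> T' + K * (1 + cos (X T'))"
      by (intro tendsto_intros limT limx)
    have "(\<lambda>n. 1 / real (Suc (k n))) \<longlonglongrightarrow> 0"
      using LIMSEQ_subseq_LIMSEQ[OF LIMSEQ_Suc[OF lim_1_over_n] k] by (simp add: comp_def)
    then show "(\<lambda>n. Inf A + 1 / real (Suc (k n))) \<longlonglongrightarrow> Inf A + 0" by (intro tendsto_intros)
    show "\<exists>N. \<forall>n\<ge>N. T (k n) + K * (1 + cos (x (k n) (T (k n)))) \<le> Inf A + 1 / real (Suc (k n))"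
      using seq(4) less_imp_le by blast
  qed
  then have "T' + K * (1 + cos (X T')) \<le> a" if "a \<in> A" for a
    using cInf_lower[OF that bdd] by simp
  moreover have "T' + K * (1 + cos (x' T')) \<in> A"
    if "T' \<in> {0..M}" "V' \<in> control_primitives" "relaxed_trajectory \<epsilon> M V' x' y'" for T' V' x' y'
    using that unfolding A_def by blast
  ultimately show thesis by (intro that[OF T' W X]) blast
qed

section \<open>First-order conditions\<close>

lemma cos_le_quadratic:
  fixes a b :: real
  shows "cos b \<le> cos a - sin a * (b - a) + (b - a)\<^sup>2 / 2"
proof -
  define f f' where "f s = cos s + sin a * (s - a) - (s - a)\<^sup>2 / 2" and "f' s = - sin s + sin a - (s - a)" for s
  have d: "(f has_real_derivative f' s) (at s within S)" for s S
    unfolding f_def[abs_def] f'_def by (auto intro!: derivative_eq_intros simp: field_simps)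
  have "f b \<le> f a"
  proof (cases "a \<le> b")
    case True
    have "f b - f a \<le> 0 * (b - a)"
    proof (rule diff_le_of_deriv_le[OF d _ True])
      show "f' s \<le> 0" if "a < s" "s < b" for s
        using abs_sin_diff_le[of s a] that by (simp add: f'_def abs_le_iff)
    qed
    then show ?thesis by simp
  next
    case False
    have "- f a - - f b \<le> 0 * (a - b)"
    proof (rule diff_le_of_deriv_le[where f' = "\<lambda>s. - f' s"])
      show "- f' s \<le> 0" if "b < s" "s < a" for s
        using abs_sin_diff_le[of s a] that by (simp add: f'_def abs_le_iff)
    qed (use False in \<open>auto intro!: derivative_eq_intros d\<close>)
    then show ?thesis by simp
  qed
  then show ?thesis by (simp add: f_def)
qed

lemma sin_taylor_remainder:
  fixes a b :: real
  shows "\<bar>sin b - sin a - cos a * (b - a)\<bar> \<le> (b - a)\<^sup>2 / 2"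
proof -
  have "sin b \<le> sin a + cos a * (b - a) + (b - a)\<^sup>2 / 2"
    using cos_le_quadratic[of "b - pi / 2" "a - pi / 2"] by (simp add: cos_diff sin_diff)
  moreover have "- sin b \<le> - sin a - cos a * (b - a) + (b - a)\<^sup>2 / 2"
    using cos_le_quadratic[of "b + pi / 2" "a + pi / 2"] by (simp add: cos_add sin_add)
  ultimately show ?thesis unfolding abs_le_iff by argo
qed

lemma le_of_deriv_nonpos_finite:
  fixes f :: "real \<Rightarrow> real"
  assumes S: "finite S" and ab: "a \<le> b" and c: "continuous_on {a..b} f"
    and d: "\<And>t. a < t \<Longrightarrow> t < b \<Longrightarrow> t \<notin> S \<Longrightarrow> \<exists>D\<le>0. (f has_real_derivative D) (at t)"
  shows "f b \<le> f a"
proof -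
  define f' where "f' t = (if t \<in> {a<..<b} - S then SOME D. D \<le> 0 \<and> (f has_real_derivative D) (at t) else 0)" for t
  have f': "f' t \<le> 0" "(f has_real_derivative f' t) (at t)" if "t \<in> {a<..<b} - S" for t
  proof -
    have "\<exists>D. D \<le> 0 \<and> (f has_real_derivative D) (at t)" using d[of t] that by simp
    from someI_ex[OF this] show "f' t \<le> 0" "(f has_real_derivative f' t) (at t)"
      using that by (simp_all add: f'_def)
  qed
  have "(f' has_integral (f b - f a)) {a..b}"
    by (rule fundamental_theorem_of_calculus_interior_strong[OF S ab _ c])
      (use f'(2) in \<open>simp add: has_real_derivative_iff_has_vector_derivative\<close>)
  then have "f b - f a \<le> 0"
    by (rule has_integral_le[OF _ has_integral_0]) (use f'(1) in \<open>force simp: f'_def\<close>)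
  then show ?thesis by simp
qed

text \<open>Cutting \<open>{a..b}\<close> into equal pieces leaves a total error proportional to the
  reciprocal of their number. This gives monotonicity without differentiability.\<close>

lemma mono_of_quadratic_lower_bound:
  fixes f :: "real \<Rightarrow> real"
  assumes ab: "a \<le> b" and C: "0 \<le> C"
    and f: "\<And>s t. a \<le> s \<Longrightarrow> s < t \<Longrightarrow> t \<le> b \<Longrightarrow> - C * (t - s)\<^sup>2 \<le> f t - f s"
  shows "f a \<le> f b"
proof -
  have n: "- C * (b - a)\<^sup>2 * (1 / real (Suc n)) \<le> f b - f a" for n
  proof (cases "a = b")
    case False
    define h where "h = (b - a) / real (Suc n)"
    have h: "0 < h" "real (Suc n) * h = b - a" using False ab by (auto simp: h_def)
    have "- C * real k * h\<^sup>2 \<le> f (a + real k * h) - f a" if "k \<le> Suc n" for k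
      using that
    proof (induction k)
      case (Suc k)
      have "real (Suc k) * h \<le> real (Suc n) * h" using Suc.prems h by (intro mult_right_mono) auto
      then have le: "a + real (Suc k) * h \<le> b" unfolding h(2) by simp
      have "- C * (a + real (Suc k) * h - (a + real k * h))\<^sup>2 \<le> f (a + real (Suc k) * h) - f (a + real k * h)"
        using h(1) by (intro f le) auto
      moreover have "a + real (Suc k) * h - (a + real k * h) = h" by (simp add: algebra_simps)
      ultimately have "- C * h\<^sup>2 \<le> f (a + real (Suc k) * h) - f (a + real k * h)" by simp
      then show ?case using Suc by (simp add: algebra_simps)
    qed simp
    from this[of "Suc n"] have "- C * real (Suc n) * h\<^sup>2 \<le> f b - f a" using h by simp
    moreover have "- C * real (Suc n) * h\<^sup>2 = - C * (b - a)\<^sup>2 * (1 / real (Suc n))"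
      unfolding h_def by (simp add: power_divide power2_eq_square)
    ultimately show ?thesis by simp
  qed simp
  have "(\<lambda>n. - C * (b - a)\<^sup>2 * (1 / real (Suc n))) \<longlonglongrightarrow> - C * (b - a)\<^sup>2 * 0"
    by (intro tendsto_mult tendsto_const LIMSEQ_Suc[OF lim_1_over_n])
  then have "- C * (b - a)\<^sup>2 * 0 \<le> f b - f a"
    by (rule LIMSEQ_le_const2) (use n in blast)
  then show ?thesis by simp
qed

lemma integrable_sgn_continuous:
  fixes f :: "real \<Rightarrow> real"
  assumes "continuous_on {a..b} f"
  shows "(\<lambda>t. sgn (f t)) integrable_on {a..b}"
proof -
  have "(\<lambda>t. sgn (f t)) \<in> borel_measurable (lebesgue_on {a..b})"
    by (rule measurable_compose[OF continuous_imp_measurable_on_sets_lebesgue[OF assms] borel_measurable_sgn]) simp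
  then have "(\<lambda>t. sgn (f t)) absolutely_integrable_on {a..b}"
    by (rule measurable_bounded_by_integrable_imp_absolutely_integrable[where g = "\<lambda>_. 1"]) (auto simp: sgn_if)
  then show ?thesis by (rule set_lebesgue_integral_eq_integral(1))
qed

text \<open>The maximum principle in integrated form. Since \<open>\<psi> T = 0\<close> and
  \<open>W 0 = V 0\<close>, integration by parts turns the integral into minus the Stieltjes
  integral of \<open>\<psi>\<close> against \<open>W - V\<close>, so \<open>V\<close> minimises the
  integral of \<open>\<psi>\<close> against the primitive. The set of primitives is convex:
  \<open>V\<close> is moved by a fraction \<open>h\<close> towards \<open>W\<close>, and the gain of
  order \<open>h\<close> is compared with an error of order \<open>h\<^sup>2\<close>.\<close>

lemma relaxed_first_order_condition:
  assumes e: "0 < \<epsilon>" "\<epsilon> \<le> 1" and T: "0 \<le> T" and K: "0 \<le> K"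
    and V: "V \<in> control_primitives" and x: "relaxed_trajectory \<epsilon> T V x y"
    and min: "\<forall>V'\<in>control_primitives. \<forall>x' y'. relaxed_trajectory \<epsilon> T V' x' y' \<longrightarrow> K * cos (x T) \<le> K * cos (x' T)"
    and \<psi>: "\<And>t. t \<in> {0..T} \<Longrightarrow> (\<psi> has_real_derivative \<zeta> t) (at t within {0..T})"
    and \<zeta>: "\<And>t. t \<in> {0..T} \<Longrightarrow> (\<zeta> has_real_derivative - cos (x t) * \<psi> t) (at t within {0..T})"
    and end_eq: "\<psi> T = 0" "\<zeta> T = K * sin (x T)"
    and W: "W \<in> control_primitives"
  shows "integral {0..T} (\<lambda>t. \<zeta> t * (W t - V t)) \<le> 0"
proof (rule ccontr)
  define A where "A t = integral {0..t} (\<lambda>t. \<zeta> t * (W t - V t))" for t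
  assume "\<not> ?thesis"
  then have pos: "0 < A T" by (simp add: A_def)
  have c\<zeta>: "continuous_on {0..T} \<zeta>" using \<zeta> by (rule DERIV_continuous_on)
  have c\<psi>: "continuous_on {0..T} \<psi>" using \<psi> by (rule DERIV_continuous_on)
  have dA: "(A has_real_derivative \<zeta> t * (W t - V t)) (at t within {0..T})" if "t \<in> {0..T}" for t
    unfolding A_def[abs_def] has_real_derivative_iff_has_vector_derivative
    by (intro integral_has_vector_derivative that continuous_intros c\<zeta> control_primitivesD(4) V W)
  have "compact (\<psi> ` {0..T})" using c\<psi> by (intro compact_continuous_image) auto
  then obtain B where B: "\<And>t. t \<in> {0..T} \<Longrightarrow> \<bar>\<psi> t\<bar> \<le> B"
    using compact_imp_bounded bounded_iff[of "\<psi> ` {0..T}"] by (metis imageI real_norm_def)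
  have B0: "0 \<le> B" using B[of 0] T by auto
  define C where "C = 2 * T * exp (2 * T)"
  have C: "0 \<le> C" using T by (simp add: C_def)
  define c where "c = (B * T + K) * (C\<^sup>2 / 2)"
  have c: "0 \<le> c" using B0 T K by (simp add: c_def)
  have bound: "\<epsilon> * A T \<le> c * h" if h: "0 < h" "h \<le> 1" for h
  proof -
    define Vh where "Vh t = V t + h * (W t - V t)" for t
    have Vh: "Vh \<in> control_primitives"
      unfolding control_primitives_def mem_Collect_eq
    proof (intro conjI allI)
      show "Vh 0 = 0" using control_primitivesD(1)[OF V] control_primitivesD(1)[OF W] by (simp add: Vh_def)
      fix s t
      have "Vh s - Vh t = (1 - h) * (V s - V t) + h * (W s - W t)" by (simp add: Vh_def algebra_simps)
      then have "\<bar>Vh s - Vh t\<bar> \<le> (1 - h) * \<bar>V s - V t\<bar> + h * \<bar>W s - W t\<bar>"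
        using h abs_triangle_ineq[of "(1 - h) * (V s - V t)" "h * (W s - W t)"] by (simp add: abs_mult)
      also have "\<dots> \<le> (1 - h) * \<bar>s - t\<bar> + h * \<bar>s - t\<bar>"
        using h by (intro add_mono mult_left_mono control_primitivesD(2) V W) auto
      finally show "\<bar>Vh s - Vh t\<bar> \<le> \<bar>s - t\<bar>" by (simp add: algebra_simps)
    qed
    obtain xh yh where xh: "relaxed_trajectory \<epsilon> T Vh xh yh"
      using relaxed_trajectory_exists[OF T Vh] by blast
    define \<delta> \<beta> where "\<delta> t = xh t - x t" and "\<beta> t = (yh t - \<epsilon> * Vh t) - (y t - \<epsilon> * V t)" for t
    have \<delta>_le: "\<bar>\<delta> t\<bar> \<le> h * C" if t: "t \<in> {0..T}" for t
    proof -
      have "\<bar>Vh t - V t\<bar> \<le> h * (2 * T)" if "t \<in> {0..T}" for t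
      proof -
        have "\<bar>W t - V t\<bar> \<le> 2 * T"
          using control_primitivesD(3)[OF V, of t] control_primitivesD(3)[OF W, of t] that by auto
        then show ?thesis using h by (simp add: Vh_def abs_mult)
      qed
      from relaxed_trajectory_stable[OF xh x this e t]
      have "\<bar>\<delta> t\<bar> \<le> h * (2 * T) * exp (2 * t)" by (simp add: \<delta>_def)
      also have "\<dots> \<le> h * (2 * T) * exp (2 * T)" using h t by (intro mult_left_mono) auto
      finally show ?thesis by (simp add: C_def)
    qed
    have sq: "(\<delta> t)\<^sup>2 / 2 \<le> h\<^sup>2 * (C\<^sup>2 / 2)" if "t \<in> {0..T}" for t
      using power_mono[OF \<delta>_le[OF that], of 2] by (simp add: power_mult_distrib)
    \<comment> \<open>The duality pairing of adjoint and variation, with \<open>A\<close>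
      compensating the change of control. Its derivative reduces to \<open>\<psi>\<close> times the
      Taylor remainder of the sine.\<close>
    define F where "F t = \<psi> t * \<beta> t - \<zeta> t * \<delta> t + \<epsilon> * h * A t" for t
    have dF: "(F has_real_derivative - \<psi> t * (sin (xh t) - sin (x t) - cos (x t) * \<delta> t)) (at t within {0..T})"
      if t: "t \<in> {0..T}" for t
    proof -
      have "(\<delta> has_real_derivative yh t - y t) (at t within {0..T})"
        unfolding \<delta>_def[abs_def] using x xh t by (intro DERIV_diff) (auto simp: relaxed_trajectory_def)
      moreover have "(\<beta> has_real_derivative - sin (xh t) - - sin (x t)) (at t within {0..T})"
        unfolding \<beta>_def[abs_def] using x xh t by (intro DERIV_diff) (auto simp: relaxed_trajectory_def)
      ultimately have "(F has_real_derivative (\<zeta> t * \<beta> t + (- sin (xh t) - - sin (x t)) * \<psi> t)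
          - ((- cos (x t) * \<psi> t) * \<delta> t + (yh t - y t) * \<zeta> t) + \<epsilon> * h * (\<zeta> t * (W t - V t))) (at t within {0..T})"
        unfolding F_def[abs_def]
        by (intro DERIV_add DERIV_diff DERIV_mult DERIV_cmult \<psi>[OF t] \<zeta>[OF t] dA[OF t])
      moreover have "yh t - y t = \<beta> t + \<epsilon> * h * (W t - V t)" by (simp add: \<beta>_def Vh_def algebra_simps)
      ultimately show ?thesis by (simp add: algebra_simps)
    qed
    have "\<bar>F T - F 0\<bar> \<le> (B * (h\<^sup>2 * (C\<^sup>2 / 2))) * (T - 0)"
    proof (rule abs_diff_le_of_deriv_le[OF dF _ T])
      fix t assume "0 < t" "t < T"
      then have t: "t \<in> {0..T}" by simp
      have "\<bar>sin (xh t) - sin (x t) - cos (x t) * \<delta> t\<bar> \<le> h\<^sup>2 * (C\<^sup>2 / 2)"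
        using sin_taylor_remainder[of "xh t" "x t"] sq[OF t] by (simp add: \<delta>_def)
      then show "\<bar>- \<psi> t * (sin (xh t) - sin (x t) - cos (x t) * \<delta> t)\<bar> \<le> B * (h\<^sup>2 * (C\<^sup>2 / 2))"
        unfolding abs_mult abs_minus_cancel using B[OF t] B0 by (intro mult_mono) auto
    qed
    moreover have "F 0 = 0"
      using x xh by (simp add: F_def A_def \<delta>_def \<beta>_def relaxed_trajectory_def Vh_def)
    moreover have "F T = - (K * sin (x T) * \<delta> T) + \<epsilon> * h * A T" by (simp add: F_def end_eq)
    ultimately have "- (K * sin (x T) * \<delta> T) + \<epsilon> * h * A T \<le> B * (h\<^sup>2 * (C\<^sup>2 / 2)) * T"
      by (metis abs_le_D1 diff_zero)
    then have "\<epsilon> * h * A T \<le> B * (h\<^sup>2 * (C\<^sup>2 / 2)) * T + K * sin (x T) * \<delta> T"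
      by simp
    moreover have "K * sin (x T) * \<delta> T \<le> K * (h\<^sup>2 * (C\<^sup>2 / 2))"
    proof -
      have "K * cos (x T) \<le> K * cos (xh T)" by (rule min[rule_format, OF Vh xh])
      also have "\<dots> \<le> K * (cos (x T) - sin (x T) * \<delta> T + (\<delta> T)\<^sup>2 / 2)"
        using K cos_le_quadratic[of "xh T" "x T"] by (intro mult_left_mono) (simp_all add: \<delta>_def)
      also have "\<dots> = K * cos (x T) - K * sin (x T) * \<delta> T + K * ((\<delta> T)\<^sup>2 / 2)" by (simp add: algebra_simps)
      finally have "K * sin (x T) * \<delta> T \<le> K * ((\<delta> T)\<^sup>2 / 2)" by simp
      also have "\<dots> \<le> K * (h\<^sup>2 * (C\<^sup>2 / 2))" using sq[of T] T K by (intro mult_left_mono) auto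
      finally show ?thesis .
    qed
    ultimately have "h * (\<epsilon> * A T) \<le> h * (c * h)"
      by (simp add: c_def algebra_simps power2_eq_square)
    then show ?thesis using h by simp
  qed
  \<comment> \<open>Chosen so that \<open>c * h < \<epsilon> * A T\<close>, against
    \<open>bound\<close>; the added 1 covers \<open>c = 0\<close>.\<close>
  define h where "h = min 1 (\<epsilon> * A T / (2 * c + 1))"
  have h: "0 < h" "h \<le> 1" using pos e c by (auto simp: h_def)
  have "c * h \<le> c * (\<epsilon> * A T / (2 * c + 1))" using c by (intro mult_left_mono) (simp_all add: h_def)
  also have "\<dots> = (c / (2 * c + 1)) * (\<epsilon> * A T)" by simp
  also have "\<dots> < 1 * (\<epsilon> * A T)" using c pos e by (intro mult_strict_right_mono) auto
  finally show False using bound[OF h] by simp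
qed

lemma const_of_deriv_zero_finite:
  fixes f :: "real \<Rightarrow> real"
  assumes S: "finite S" and ab: "a \<le> b" and c: "continuous_on {a..b} f"
    and d: "\<And>t. a < t \<Longrightarrow> t < b \<Longrightarrow> t \<notin> S \<Longrightarrow> (f has_real_derivative 0) (at t)"
  shows "f b = f a"
proof -
  have "f b \<le> f a"
    by (rule le_of_deriv_nonpos_finite[OF S ab c]) (use d in blast)
  moreover have "- f b \<le> - f a"
  proof (rule le_of_deriv_nonpos_finite[OF S ab continuous_on_minus[OF c]])
    fix t assume "a < t" "t < b" "t \<notin> S"
    from DERIV_minus[OF d[OF this]] show "\<exists>D\<le>0. ((\<lambda>t. - f t) has_real_derivative D) (at t)" by auto
  qed
  ultimately show ?thesis by simp
qed

text \<open>A minimiser of the integral of \<open>\<psi>\<close> against 1-Lipschitz primitives has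
  to fall at full speed where \<open>\<psi> > 0\<close> and rise at full speed where
  \<open>\<psi> < 0\<close>. It is tested against the function \<open>S\<close> that does exactly
  this. \<open>V\<close> is only known to be Lipschitz, so \<open>D = S - V\<close> is handled
  through increments with quadratic errors.\<close>

lemma bang_bang_primitive:
  assumes T: "0 \<le> T" and V: "V \<in> control_primitives"
    and \<psi>: "\<And>t. t \<in> {0..T} \<Longrightarrow> (\<psi> has_real_derivative \<zeta> t) (at t within {0..T})"
    and c\<zeta>: "continuous_on {0..T} \<zeta>" and end0: "\<psi> T = 0" and fin: "finite {t \<in> {0..T}. \<psi> t = 0}"
    and first_order: "\<And>W. W \<in> control_primitives \<Longrightarrow> integral {0..T} (\<lambda>t. \<zeta> t * (W t - V t)) \<le> 0"
    and t: "t \<in> {0..T}"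
  shows "V t = - integral {0..t} (\<lambda>s. sgn (\<psi> s))"
proof -
  have c\<psi>: "continuous_on {0..T} \<psi>" using \<psi> by (rule DERIV_continuous_on)
  define S where "S t = - integral {0..t} (\<lambda>s. sgn (\<psi> s))" for t
  have int: "(\<lambda>s. sgn (\<psi> s)) integrable_on {a..b}" if "0 \<le> a" "b \<le> T" for a b
    by (intro integrable_sgn_continuous continuous_on_subset[OF c\<psi>]) (use that in auto)
  have S_diff: "S b - S a = - integral {a..b} (\<lambda>s. sgn (\<psi> s))" if "0 \<le> a" "a \<le> b" "b \<le> T" for a b
    using Henstock_Kurzweil_Integration.integral_combine[OF that(1,2) int[OF order_refl that(3)]] by (simp add: S_def)
  have S_lip: "\<bar>S b - S a\<bar> \<le> b - a" if "0 \<le> a" "a \<le> b" "b \<le> T" for a b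
  proof -
    have "norm (integral {a..b} (\<lambda>s. sgn (\<psi> s))) \<le> integral {a..b} (\<lambda>s. 1)"
      by (rule integral_norm_bound_integral[OF int]) (use that in \<open>auto simp: sgn_if\<close>)
    then show ?thesis using that by (simp add: S_diff)
  qed
  have S_lip': "\<bar>S b - S a\<bar> \<le> \<bar>b - a\<bar>" if "a \<in> {0..T}" "b \<in> {0..T}" for a b
    using S_lip[of a b] S_lip[of b a] that by (cases "a \<le> b") (auto simp: abs_minus_commute)
  define W where "W t = S (max 0 (min T t))" for t
  have W_eq: "W t = S t" if "t \<in> {0..T}" for t using that by (simp add: W_def min_absorb2 max_absorb2)
  have W: "W \<in> control_primitives"
    unfolding W_def[abs_def] by (rule control_primitive_extend[OF _ T S_lip']) (auto simp: S_def)
  define D where "D t = S t - V t" for t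
  have D_lip: "\<bar>D b - D a\<bar> \<le> 2 * \<bar>b - a\<bar>" if "a \<in> {0..T}" "b \<in> {0..T}" for a b
  proof -
    have "D b - D a = (S b - S a) - (V b - V a)" by (simp add: D_def)
    also have "\<bar>\<dots>\<bar> \<le> \<bar>S b - S a\<bar> + \<bar>V b - V a\<bar>" by (rule abs_triangle_ineq4)
    also have "\<dots> \<le> \<bar>b - a\<bar> + \<bar>b - a\<bar>" using S_lip'[OF that] control_primitivesD(2)[OF V, of b a] by (rule add_mono)
    finally show ?thesis by simp
  qed
  have cD: "continuous_on {0..T} D"
    by (rule continuous_on_eq[of _ "\<lambda>t. W t - V t"])
      (auto intro!: continuous_intros control_primitivesD(4)[OF V] control_primitivesD(4)[OF W] simp: D_def W_eq)
  have D_decr: "D b \<le> D a" if "0 \<le> a" "a \<le> b" "b \<le> T" "\<And>s. s \<in> {a..b} \<Longrightarrow> 0 < \<psi> s" for a b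
  proof -
    have "integral {a..b} (\<lambda>s. sgn (\<psi> s)) = integral {a..b} (\<lambda>s. 1)"
      by (rule integral_cong) (use that(4) in auto)
    then have "S b - S a = - (b - a)" using that by (simp add: S_diff)
    then show ?thesis using control_primitivesD(2)[OF V, of b a] that by (simp add: D_def abs_le_iff)
  qed
  have D_incr: "D a \<le> D b" if "0 \<le> a" "a \<le> b" "b \<le> T" "\<And>s. s \<in> {a..b} \<Longrightarrow> \<psi> s < 0" for a b
  proof -
    have "integral {a..b} (\<lambda>s. sgn (\<psi> s)) = integral {a..b} (\<lambda>s. - 1)"
      by (rule integral_cong) (use that(4) in auto)
    then have "S b - S a = b - a" using that by (simp add: S_diff)
    then show ?thesis using control_primitivesD(2)[OF V, of b a] that by (simp add: D_def abs_le_iff)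
  qed
  have "compact (\<zeta> ` {0..T})" using c\<zeta> by (intro compact_continuous_image) auto
  then obtain B where B: "\<And>t. t \<in> {0..T} \<Longrightarrow> \<bar>\<zeta> t\<bar> \<le> B"
    using compact_imp_bounded bounded_iff[of "\<zeta> ` {0..T}"] by (metis imageI real_norm_def)
  have B0: "0 \<le> B" using B[of 0] T by auto
  have \<psi>_lip: "\<bar>\<psi> b - \<psi> a\<bar> \<le> B * (b - a)" if "0 \<le> a" "a \<le> b" "b \<le> T" for a b
  proof (rule abs_diff_le_of_deriv_le[where f' = \<zeta>])
    show "(\<psi> has_real_derivative \<zeta> r) (at r within {a..b})" if "r \<in> {a..b}" for r
      by (rule has_field_derivative_subset[OF \<psi>]) (use that \<open>0 \<le> a\<close> \<open>b \<le> T\<close> in auto)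
  qed (use B that in auto)
  define A where "A t = integral {0..t} (\<lambda>t. \<zeta> t * D t)" for t
  have dA: "(A has_real_derivative \<zeta> t * D t) (at t within {0..T})" if "t \<in> {0..T}" for t
    unfolding A_def[abs_def] has_real_derivative_iff_has_vector_derivative
    by (intro integral_has_vector_derivative that continuous_intros c\<zeta> cD)
  have AT: "A T \<le> 0"
  proof -
    have "A T = integral {0..T} (\<lambda>t. \<zeta> t * (W t - V t))"
      unfolding A_def by (rule integral_cong) (simp add: D_def W_eq)
    then show ?thesis using first_order[OF W] by simp
  qed
  \<comment> \<open>\<open>Q\<close> is minus the Stieltjes integral of \<open>\<psi>\<close> against \<open>D\<close>; it increases because \<open>D\<close> is monotone against the sign of \<open>\<psi>\<close>,
    while the first-order condition gives \<open>Q T \<le> 0\<close>.\<close>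
  define Q where "Q t = A t - \<psi> t * D t" for t
  have Q_diff: "\<bar>(Q b - Q a) - \<psi> a * (D a - D b)\<bar> \<le> 2 * B * (b - a)\<^sup>2" if ab: "0 \<le> a" "a \<le> b" "b \<le> T" for a b
  proof -
    have "\<bar>(A b - \<psi> b * D b) - (A a - \<psi> a * D b)\<bar> \<le> B * (2 * (b - a)) * (b - a)"
    proof (rule abs_diff_le_of_deriv_le[where f' = "\<lambda>r. \<zeta> r * (D r - D b)"])
      fix r assume r: "r \<in> {a..b}"
      have sub: "{a..b} \<subseteq> {0..T}" using ab by auto
      show "((\<lambda>r. A r - \<psi> r * D b) has_real_derivative \<zeta> r * (D r - D b)) (at r within {a..b})"
        using has_field_derivative_subset[OF dA sub, of r] has_field_derivative_subset[OF \<psi> sub, of r] r sub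
        by (auto intro!: derivative_eq_intros simp: algebra_simps)
    next
      fix r assume r: "a < r" "r < b"
      have "\<bar>D r - D b\<bar> \<le> 2 * (b - a)" using D_lip[of b r] r ab by auto
      then show "\<bar>\<zeta> r * (D r - D b)\<bar> \<le> B * (2 * (b - a))"
        unfolding abs_mult using B[of r] B0 r ab by (intro mult_mono) auto
    qed fact
    then show ?thesis by (simp add: Q_def algebra_simps power2_eq_square)
  qed
  \<comment> \<open>If \<open>\<psi>\<close> vanishes or changes sign on \<open>{a..b}\<close>, then
    \<open>\<psi> a\<close> and the increment of \<open>D\<close> are both of order
    \<open>b - a\<close>; otherwise \<open>D\<close> is monotone in the favourable
    direction.\<close>
  have "- (2 * B * (b - a)\<^sup>2) \<le> \<psi> a * (D a - D b)" if ab: "0 \<le> a" "a \<le> b" "b \<le> T" for a b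
  proof (cases "\<exists>r\<in>{a..b}. \<psi> a * \<psi> r \<le> 0")
    case True
    then obtain r where r: "r \<in> {a..b}" "\<psi> a * \<psi> r \<le> 0" by blast
    have "\<bar>\<psi> a\<bar> \<le> \<bar>\<psi> r - \<psi> a\<bar>" using r(2) by (auto simp: mult_le_0_iff)
    also have "\<dots> \<le> B * (r - a)" using r ab by (intro \<psi>_lip) auto
    also have "\<dots> \<le> B * (b - a)" using r B0 by (intro mult_left_mono) auto
    finally have "\<bar>\<psi> a\<bar> \<le> B * (b - a)" .
    moreover have "\<bar>D a - D b\<bar> \<le> 2 * (b - a)" using D_lip[of b a] ab by auto
    ultimately have "\<bar>\<psi> a * (D a - D b)\<bar> \<le> (B * (b - a)) * (2 * (b - a))"
      unfolding abs_mult using B0 ab by (intro mult_mono) auto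
    also have "\<dots> = 2 * B * (b - a)\<^sup>2" by (simp add: power2_eq_square)
    finally show ?thesis by linarith
  next
    case False
    then have same: "0 < \<psi> a * \<psi> r" if "r \<in> {a..b}" for r using that by (meson not_le)
    have "0 \<le> \<psi> a * (D a - D b)"
    proof (cases "0 < \<psi> a")
      case True
      then have "D b \<le> D a" using same ab by (intro D_decr) (auto simp: zero_less_mult_iff)
      with True show ?thesis by simp
    next
      case False
      then have "\<psi> a < 0" using same[of a] ab by (auto simp: zero_less_mult_iff)
      then have "D a \<le> D b" using same ab by (intro D_incr) (auto simp: zero_less_mult_iff)
      with \<open>\<psi> a < 0\<close> show ?thesis by (simp add: mult_nonpos_nonpos)
    qed
    moreover have "0 \<le> 2 * B * (b - a)\<^sup>2" using B0 by simp
    ultimately show ?thesis by linarith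
  qed
  note Q_step = this
  have Q_mono: "Q a \<le> Q b" if "0 \<le> a" "a \<le> b" "b \<le> T" for a b
  proof (rule mono_of_quadratic_lower_bound[of a b "4 * B"])
    fix s t assume "a \<le> s" "s < t" "t \<le> b"
    then have "0 \<le> s" "s \<le> t" "t \<le> T" using that by auto
    from Q_diff[OF this] Q_step[OF this] show "- (4 * B) * (t - s)\<^sup>2 \<le> Q t - Q s"
      unfolding abs_le_iff by linarith
  qed (use B0 that in auto)
  have Q0: "Q s = 0" if "s \<in> {0..T}" for s
  proof -
    have "S 0 = 0" by (simp add: S_def)
    then have "Q 0 = 0" using control_primitivesD(1)[OF V] by (simp add: Q_def A_def D_def)
    moreover have "Q T \<le> 0" using AT end0 by (simp add: Q_def)
    ultimately show ?thesis using Q_mono[of 0 s] Q_mono[of s T] that by auto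
  qed
  \<comment> \<open>As \<open>Q\<close> vanishes identically, increments of \<open>D\<close> are
    quadratically small wherever \<open>\<psi> \<noteq> 0\<close>; there \<open>D\<close> is locally
    constant, and continuity carries the constant across the finitely many zeroes.\<close>
  have D_flat: "\<bar>\<psi> a\<bar> * \<bar>D b - D a\<bar> \<le> 2 * B * (b - a)\<^sup>2" if ab: "0 \<le> a" "a \<le> b" "b \<le> T" for a b
    using Q_diff[OF ab] Q0[of a] Q0[of b] ab by (simp add: abs_mult abs_minus_commute)
  have dD: "(D has_real_derivative 0) (at s)" if s: "0 < s" "s < T" "\<psi> s \<noteq> 0" for s
  proof -
    obtain r0 where r0: "0 < r0" "\<And>u. u \<in> {0..T} \<Longrightarrow> dist u s < r0 \<Longrightarrow> dist (\<psi> u) (\<psi> s) < \<bar>\<psi> s\<bar> / 2"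
      using c\<psi> s unfolding continuous_on_iff by (metis atLeastAtMost_iff half_gt_zero less_imp_le zero_less_abs_iff)
    define r where "r = min r0 (min s (T - s))"
    have r: "0 < r" using r0 s by (simp add: r_def)
    define C where "C = 2 * B / (\<bar>\<psi> s\<bar> / 2)"
    have C: "0 \<le> C" using B0 by (simp add: C_def)
    have near: "\<bar>D v - D u\<bar> \<le> C * (v - u)\<^sup>2" if uv: "s - r < u" "u \<le> v" "v < s + r" for u v
    proof -
      have I: "0 \<le> u" "u \<le> v" "v \<le> T" using uv by (auto simp: r_def)
      have "dist (\<psi> u) (\<psi> s) < \<bar>\<psi> s\<bar> / 2" using uv I by (intro r0) (auto simp: dist_real_def r_def)
      moreover have "\<bar>\<psi> s\<bar> \<le> \<bar>\<psi> u\<bar> + \<bar>\<psi> u - \<psi> s\<bar>"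
        using abs_triangle_ineq4[of "\<psi> u" "\<psi> u - \<psi> s"] by simp
      ultimately have "\<bar>\<psi> s\<bar> / 2 \<le> \<bar>\<psi> u\<bar>" unfolding dist_real_def by argo
      then have "\<bar>\<psi> s\<bar> / 2 * \<bar>D v - D u\<bar> \<le> \<bar>\<psi> u\<bar> * \<bar>D v - D u\<bar>" by (intro mult_right_mono) auto
      also have "\<dots> \<le> 2 * B * (v - u)\<^sup>2" by (rule D_flat[OF I])
      finally show ?thesis using s by (simp add: C_def field_simps)
    qed
    have const: "D u = D v" if uv: "s - r < u" "u \<le> v" "v < s + r" for u v
    proof -
      have bound: "- C * (b - a)\<^sup>2 \<le> D b - D a" "- C * (b - a)\<^sup>2 \<le> - D b - - D a"
        if "u \<le> a" "a < b" "b \<le> v" for a b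
        using near[of a b] uv that by (simp_all add: abs_le_iff)
      have "D u \<le> D v" by (rule mono_of_quadratic_lower_bound[OF uv(2) C bound(1)])
      moreover have "- D u \<le> - D v" by (rule mono_of_quadratic_lower_bound[OF uv(2) C bound(2)])
      ultimately show ?thesis by simp
    qed
    have "((\<lambda>_. D s) has_real_derivative 0) (at s)" by simp
    then show ?thesis
    proof (rule has_field_derivative_transform_within_open[where S = "{s - r<..<s + r}"])
      fix u assume u: "u \<in> {s - r<..<s + r}"
      show "D s = D u"
      proof (cases "s \<le> u")
        case True
        show ?thesis by (rule const) (use u r True in auto)
      next
        case False
        show ?thesis by (rule const[symmetric]) (use u r False in auto)
      qed
    qed (use r in auto)
  qed
  have sub: "continuous_on {0..t} D" by (rule continuous_on_subset[OF cD]) (use t in auto)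
  have "D t = D 0"
    by (rule const_of_deriv_zero_finite[OF fin _ sub dD]) (use t in auto)
  moreover have "D 0 = 0" using control_primitivesD(1)[OF V] by (simp add: D_def S_def)
  ultimately show ?thesis by (simp add: D_def S_def)
qed

section \<open>Hamiltonian, energy and Sturm comparison along bang-bang trajectories\<close>

lemma bang_bang_velocity_deriv:
  assumes x: "relaxed_trajectory \<epsilon> T V x y" and c\<psi>: "continuous_on {0..T} \<psi>"
    and V: "\<And>t. t \<in> {0..T} \<Longrightarrow> V t = - integral {0..t} (\<lambda>s. sgn (\<psi> s))"
    and s: "0 < s" "s < T" "\<psi> s \<noteq> 0"
  shows "(x has_real_derivative y s) (at s)" "(y has_real_derivative - sin (x s) - \<epsilon> * sgn (\<psi> s)) (at s)"
proof -
  have at: "at s within {0..T} = at s" by (rule at_within_Icc_at) (use s in auto)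
  have s': "s \<in> {0..T}" using s by simp
  show "(x has_real_derivative y s) (at s)"
    using x s' unfolding relaxed_trajectory_def at[symmetric] by blast
  have "continuous (at s within ({0..T} - {})) (\<lambda>s. sgn (\<psi> s))"
    using c\<psi> s s' unfolding continuous_on_def continuous_within by (auto intro!: tendsto_sgn)
  from integral_has_vector_derivative_continuous_at[OF integrable_sgn_continuous[OF c\<psi>] _ finite.emptyI this] s'
  have "((\<lambda>t. integral {0..t} (\<lambda>s. sgn (\<psi> s))) has_real_derivative sgn (\<psi> s)) (at s)"
    by (simp add: has_real_derivative_iff_has_vector_derivative at)
  from DERIV_minus[OF this] have dV: "(V has_real_derivative - sgn (\<psi> s)) (at s)"
    by (rule has_field_derivative_transform_within_open[of _ _ _ "{0<..<T}"]) (use s V in auto)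
  have "((\<lambda>t. y t - \<epsilon> * V t) has_real_derivative - sin (x s)) (at s)"
    using x s' unfolding relaxed_trajectory_def at[symmetric] by blast
  from DERIV_add[OF this DERIV_cmult[OF dV, of \<epsilon>]]
  show "(y has_real_derivative - sin (x s) - \<epsilon> * sgn (\<psi> s)) (at s)" by simp
qed

lemma relaxed_trajectory_continuous:
  assumes "relaxed_trajectory \<epsilon> T V x y" "V \<in> control_primitives"
  shows "continuous_on {0..T} x" "continuous_on {0..T} y"
proof -
  show "continuous_on {0..T} x"
    using assms by (intro DERIV_continuous_on) (auto simp: relaxed_trajectory_def)
  have "continuous_on {0..T} (\<lambda>t. y t - \<epsilon> * V t)"
    using assms by (intro DERIV_continuous_on[where D = "\<lambda>t. - sin (x t)"]) (auto simp: relaxed_trajectory_def)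
  from continuous_on_add[OF this continuous_on_mult[OF continuous_on_const control_primitivesD(4)[OF assms(2)]]]
  have "continuous_on {0..T} (\<lambda>t. (y t - \<epsilon> * V t) + \<epsilon> * V t)" .
  then show "continuous_on {0..T} y" by simp
qed

lemma hamiltonian_constant:
  assumes x: "relaxed_trajectory \<epsilon> T V x y" and Vp: "V \<in> control_primitives"
    and V: "\<And>t. t \<in> {0..T} \<Longrightarrow> V t = - integral {0..t} (\<lambda>s. sgn (\<psi> s))"
    and \<psi>: "\<And>t. t \<in> {0..T} \<Longrightarrow> (\<psi> has_real_derivative \<zeta> t) (at t within {0..T})"
    and \<zeta>: "\<And>t. t \<in> {0..T} \<Longrightarrow> (\<zeta> has_real_derivative - cos (x t) * \<psi> t) (at t within {0..T})"
    and fin: "finite {t \<in> {0..T}. \<psi> t = 0}" and t: "t \<in> {0..T}"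
  shows "y t * \<zeta> t + sin (x t) * \<psi> t + \<epsilon> * \<bar>\<psi> t\<bar> = y T * \<zeta> T + sin (x T) * \<psi> T + \<epsilon> * \<bar>\<psi> T\<bar>"
proof -
  have c: "continuous_on {0..T} \<psi>" "continuous_on {0..T} \<zeta>"
    using DERIV_continuous_on[OF \<psi>] DERIV_continuous_on[OF \<zeta>] by auto
  \<comment> \<open>\<open>\<bar>\<psi> t\<bar>\<close> is written as a square root so that the
    chain rule applies off the zeroes; there the derivatives of the summands cancel, and continuity
    bridges the finitely many zeroes.\<close>
  define F where "F t = y t * \<zeta> t + sin (x t) * \<psi> t + \<epsilon> * sqrt ((\<psi> t)\<^sup>2)" for t
  have cF: "continuous_on {t..T} F"
    by (rule continuous_on_subset[of "{0..T}"]) (use t in \<open>auto simp: F_def[abs_def]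
      intro!: continuous_intros c relaxed_trajectory_continuous[OF x Vp]\<close>)
  have dF: "(F has_real_derivative 0) (at s)" if s: "0 < s" "s < T" "\<psi> s \<noteq> 0" for s
  proof -
    have at: "at s within {0..T} = at s" by (rule at_within_Icc_at) (use s in auto)
    have d\<psi>: "(\<psi> has_real_derivative \<zeta> s) (at s)" and d\<zeta>: "(\<zeta> has_real_derivative - cos (x s) * \<psi> s) (at s)"
      using \<psi>[of s] \<zeta>[of s] s at by auto
    have "((\<lambda>t. (\<psi> t)\<^sup>2) has_real_derivative 2 * \<psi> s * \<zeta> s) (at s)"
      by (auto intro!: derivative_eq_intros d\<psi>)
    then have ds: "((\<lambda>t. sqrt ((\<psi> t)\<^sup>2)) has_real_derivative inverse (sqrt ((\<psi> s)\<^sup>2)) / 2 * (2 * \<psi> s * \<zeta> s)) (at s)"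
      using s by (intro DERIV_chain'[OF _ DERIV_real_sqrt]) auto
    have "inverse (sqrt ((\<psi> s)\<^sup>2)) / 2 * (2 * \<psi> s * \<zeta> s) = sgn (\<psi> s) * \<zeta> s"
      using s by (simp add: sgn_if field_simps)
    then have da: "((\<lambda>t. sqrt ((\<psi> t)\<^sup>2)) has_real_derivative sgn (\<psi> s) * \<zeta> s) (at s)" by (rule DERIV_cong[OF ds])
    have dxy: "(x has_real_derivative y s) (at s)" "(y has_real_derivative - sin (x s) - \<epsilon> * sgn (\<psi> s)) (at s)"
      using bang_bang_velocity_deriv[OF x c(1) _ s] V by blast+
    have dsin: "((\<lambda>t. sin (x t)) has_real_derivative cos (x s) * y s) (at s)"
      by (rule DERIV_chain'[OF dxy(1) DERIV_sin])
    show ?thesis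
      unfolding F_def[abs_def]
      by (rule DERIV_cong[OF DERIV_add[OF DERIV_add[OF DERIV_mult[OF dxy(2) d\<zeta>] DERIV_mult[OF dsin d\<psi>]] DERIV_cmult[OF da]]])
        algebra
  qed
  have "F T = F t"
    by (rule const_of_deriv_zero_finite[OF fin _ cF dF]) (use t in auto)
  then show ?thesis by (simp add: F_def)
qed

text \<open>The control changes the energy at rate at most
  \<open>\<epsilon> * \<bar>y\<bar>\<close>, and
  \<open>\<bar>y\<bar> \<le> y\<^sup>2 / 2 + 1 / 2\<close>. Adding \<open>1 / 2\<close> to the
  energy therefore gives a linear differential inequality with rate
  \<open>\<epsilon>\<close>.\<close>

lemma energy_growth:
  assumes x: "relaxed_trajectory \<epsilon> T V x y" and Vp: "V \<in> control_primitives" and e: "0 < \<epsilon>"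
    and V: "\<And>t. t \<in> {0..T} \<Longrightarrow> V t = - integral {0..t} (\<lambda>s. sgn (\<psi> s))"
    and c\<psi>: "continuous_on {0..T} \<psi>" and fin: "finite {t \<in> {0..T}. \<psi> t = 0}" and t: "t \<in> {0..T}"
  shows "(y t)\<^sup>2 / 2 + (1 - cos (x t)) + 1 / 2 \<le> exp (\<epsilon> * t) / 2"
proof -
  define F where "F t = ((y t)\<^sup>2 / 2 + (1 - cos (x t)) + 1 / 2) * exp (- \<epsilon> * t)" for t
  have "F t \<le> F 0"
  proof (rule le_of_deriv_nonpos_finite[where f = F and a = 0 and b = t, OF fin])
    show "continuous_on {0..t} F"
      by (rule continuous_on_subset[of "{0..T}"]) (use t in \<open>auto simp: F_def[abs_def]
        intro!: continuous_intros relaxed_trajectory_continuous[OF x Vp]\<close>)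
    fix s assume "0 < s" "s < t" "s \<notin> {t \<in> {0..T}. \<psi> t = 0}"
    then have s: "0 < s" "s < T" "\<psi> s \<noteq> 0" using t by auto
    have dxy: "(x has_real_derivative y s) (at s)" "(y has_real_derivative - sin (x s) - \<epsilon> * sgn (\<psi> s)) (at s)"
      using bang_bang_velocity_deriv[OF x c\<psi> _ s] V by blast+
    let ?D = "(- \<epsilon> * (sgn (\<psi> s) * y s) - \<epsilon> * ((y s)\<^sup>2 / 2 + (1 - cos (x s)) + 1 / 2)) * exp (- \<epsilon> * s)"
    have "(F has_real_derivative ?D) (at s)"
      unfolding F_def[abs_def]
      by (auto intro!: derivative_eq_intros dxy simp: field_simps power2_eq_square)
    moreover have "?D \<le> 0"
    proof -
      have "- (sgn (\<psi> s) * y s) \<le> \<bar>y s\<bar>" by (auto simp: sgn_if)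
      also have "\<dots> \<le> (y s)\<^sup>2 / 2 + 1 / 2" using sum_squares_bound[of "\<bar>y s\<bar>" 1] by simp
      also have "\<dots> \<le> (y s)\<^sup>2 / 2 + (1 - cos (x s)) + 1 / 2" by simp
      finally have "\<epsilon> * - (sgn (\<psi> s) * y s) \<le> \<epsilon> * ((y s)\<^sup>2 / 2 + (1 - cos (x s)) + 1 / 2)"
        using e by (intro mult_left_mono) auto
      then show ?thesis by (intro mult_nonpos_nonneg) auto
    qed
    ultimately show "\<exists>D\<le>0. (F has_real_derivative D) (at s)" by blast
  qed (use t in auto)
  also have "F 0 = 1 / 2" using x by (simp add: F_def relaxed_trajectory_def)
  finally show ?thesis by (simp add: F_def exp_minus field_simps)
qed

text \<open>Comparison with \<open>sin (w * (t - a))\<close>, \<open>w = pi / 5\<close>, whose half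
  period is the length 5; \<open>w\<^sup>2 \<le> 1 / 2\<close> makes it oscillate no faster than the
  equation. Without a zero of \<open>f\<close> the Wronskian \<open>F\<close> could not increase,
  yet it passes from a negative to a positive value. The factor \<open>f a\<close> in
  \<open>F\<close> treats both signs of \<open>f\<close> at once.\<close>

lemma sturm_zero:
  fixes f g c :: "real \<Rightarrow> real"
  assumes f: "\<And>t. t \<in> {a..a + 5} \<Longrightarrow> (f has_real_derivative g t) (at t within {a..a + 5})"
    and g: "\<And>t. t \<in> {a..a + 5} \<Longrightarrow> (g has_real_derivative - c t * f t) (at t within {a..a + 5})"
    and c: "\<And>t. t \<in> {a..a + 5} \<Longrightarrow> 1 / 2 \<le> c t"
  shows "\<exists>t\<in>{a..a + 5}. f t = 0"
proof (rule ccontr)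
  assume no: "\<not> ?thesis"
  have cf: "continuous_on {a..a + 5} f" using f by (rule DERIV_continuous_on)
  have same: "0 < f a * f t" if t: "t \<in> {a..a + 5}" for t
  proof (rule ccontr)
    assume "\<not> ?thesis"
    then have "f a \<le> 0 \<and> 0 \<le> f t \<or> f t \<le> 0 \<and> 0 \<le> f a" by (auto simp: mult_le_0_iff not_less)
    moreover have "continuous_on {a..t} f" by (rule continuous_on_subset[OF cf]) (use t in auto)
    ultimately have "\<exists>r. a \<le> r \<and> r \<le> t \<and> f r = 0" using IVT'[of f a 0 t] IVT2'[of f t 0 a] t by auto
    then show False using no t by auto
  qed
  define w where "w = pi / 5"
  have w: "0 < w" "w\<^sup>2 \<le> 1 / 2"
  proof -
    have "w \<le> 7 / 10" using pi_less_4 pi_approx by (simp add: w_def)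
    then have "w\<^sup>2 \<le> (7 / 10)\<^sup>2" unfolding w_def by (intro power_mono) auto
    also have "\<dots> \<le> 1 / 2" by (simp add: power2_eq_square)
    finally show "w\<^sup>2 \<le> 1 / 2" .
  qed (simp add: w_def)
  define F where "F t = f a * (g t * sin (w * (t - a)) - f t * (w * cos (w * (t - a))))" for t
  have "F (a + 5) - F a \<le> 0 * (a + 5 - a)"
  proof (rule diff_le_of_deriv_le[where f' = "\<lambda>t. (w\<^sup>2 - c t) * (f a * f t * sin (w * (t - a)))"])
    fix t assume t: "t \<in> {a..a + 5}"
    show "(F has_real_derivative (w\<^sup>2 - c t) * (f a * f t * sin (w * (t - a)))) (at t within {a..a + 5})"
      unfolding F_def[abs_def]
      by (rule derivative_eq_intros f[OF t] g[OF t] refl)+ (simp add: algebra_simps power2_eq_square)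
  next
    fix t assume t: "a < t" "t < a + 5"
    have "w * (t - a) \<le> w * 5" using w t by (intro mult_left_mono) auto
    then have "0 \<le> sin (w * (t - a))" using w t by (intro sin_ge_zero) (auto simp: w_def)
    moreover have "0 < f a * f t" using same t by auto
    moreover have "w\<^sup>2 - c t \<le> 0" using c[of t] w t by auto
    ultimately show "(w\<^sup>2 - c t) * (f a * f t * sin (w * (t - a))) \<le> 0" by (intro mult_nonpos_nonneg) auto
  qed simp
  moreover have "F (a + 5) = w * (f a * f (a + 5))" by (simp add: F_def w_def)
  moreover have "F a = - (w * (f a * f a))" by (simp add: F_def)
  moreover have "0 < w * (f a * f (a + 5))" "0 < w * (f a * f a)" using w same by auto
  ultimately show False by simp
qed

section \<open>The lower bound\<close>

text \<open>Makes every trajectory that reaches the origin a competitor in the relaxed problem on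
  the common interval \<open>{0..M}\<close>. Subtracting \<open>x T\<close> from the angle puts the
  start of the reversed lift at 0.\<close>

lemma reversed_trajectory_relaxed:
  assumes e: "0 < \<epsilon>" "\<epsilon> \<le> 1" and tr: "pendulum_trajectory \<epsilon> T x y u"
    and ends: "[x T = 0] (rmod 2 * pi)" "y T = 0" and M: "T \<le> M"
  shows "\<exists>V\<in>control_primitives. \<exists>X Y. relaxed_trajectory \<epsilon> M V X Y \<and> X T = x 0 - x T"
proof -
  have T: "0 \<le> T" and x: "\<And>t. t \<in> {0..T} \<Longrightarrow> (x has_real_derivative y t) (at t within {0..T})"
    and u: "\<And>t. t \<in> {0..T} \<Longrightarrow> \<bar>u t\<bar> \<le> 1"
    using tr by (auto simp: pendulum_trajectory_def admissible_control_def)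
  define S where "S r = integral {0..r} (\<lambda>r. sin (x r))" for r
  have cs: "continuous_on {0..T} (\<lambda>r. sin (x r))"
    by (intro continuous_intros pendulum_trajectory_continuous(1)[OF tr])
  have dS: "(S has_real_derivative sin (x r)) (at r within {0..T})" if "r \<in> {0..T}" for r
    unfolding S_def[abs_def] has_real_derivative_iff_has_vector_derivative
    by (rule integral_has_vector_derivative[OF cs that])
  \<comment> \<open>The primitive of the reversed control, expressed through the velocity and the
    integrated gravity term; \<open>\<bar>u\<bar> \<le> 1\<close> makes it 1-Lipschitz.\<close>
  define V where "V s = (- y (T - s) + S T - S (T - s)) / \<epsilon>" for s
  define X where "X s = x (T - s) - x T" for s
  define Y where "Y s = - y (T - s)" for s
  have reflect: "((\<lambda>s. f (T - s)) has_real_derivative - f') (at s within {0..T})"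
    if f: "\<And>r. r \<in> {0..T} \<Longrightarrow> (f has_real_derivative g r) (at r within {0..T})" and s: "s \<in> {0..T}" "f' = g (T - s)"
    for f g f' s
  proof -
    have im: "(\<lambda>s. T - s) ` {0..T} = {0..T}"
      by (auto simp: image_iff intro!: bexI[of _ "T - _"])
    have 1: "(f has_real_derivative f') (at (T - s) within (\<lambda>s. T - s) ` {0..T})"
      unfolding im s(2) by (rule f) (use s in auto)
    have 2: "((\<lambda>s. T - s) has_real_derivative - 1) (at s within {0..T})"
      by (auto intro!: derivative_eq_intros)
    show ?thesis using DERIV_image_chain[OF 1 2] by (simp add: o_def)
  qed
  have V0: "V 0 = 0" using ends by (simp add: V_def)
  have V_lip: "\<bar>V s - V t\<bar> \<le> \<bar>s - t\<bar>" if "s \<in> {0..T}" "t \<in> {0..T}" for s t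
  proof -
    have *: "\<bar>V s - V t\<bar> \<le> t - s" if "0 \<le> s" "s \<le> t" "t \<le> T" for s t
    proof -
      define a b where "a = T - t" and "b = T - s"
      have ab: "0 \<le> a" "a \<le> b" "b \<le> T" using that by (auto simp: a_def b_def)
      have "((\<lambda>r. sin (x r)) has_integral (S b - S a)) {a..b}"
      proof (rule fundamental_theorem_of_calculus[OF ab(2)])
        fix r assume "r \<in> {a..b}"
        then have "(S has_real_derivative sin (x r)) (at r within {a..b})"
          using ab by (intro has_field_derivative_subset[OF dS]) auto
        then show "(S has_vector_derivative sin (x r)) (at r within {a..b})"
          by (simp add: has_real_derivative_iff_has_vector_derivative)
      qed
      from has_integral_add[OF pendulum_trajectory_integral[OF tr ab] this]
      have I: "((\<lambda>r. \<epsilon> * u r) has_integral (y b - y a + (S b - S a))) {a..b}" by simp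
      have "norm (y b - y a + (S b - S a)) \<le> \<epsilon> * measure lborel {a..b}"
        by (rule has_integral_bound_real[OF _ finite.emptyI I]) (use e u ab in \<open>auto simp: abs_mult\<close>)
      then have le: "\<bar>y b - y a + (S b - S a)\<bar> \<le> \<epsilon> * (b - a)" using ab by simp
      have "V t - V s = (y b - y a + (S b - S a)) / \<epsilon>"
        unfolding V_def a_def b_def diff_divide_distrib[symmetric] by simp
      then have "\<bar>V t - V s\<bar> = \<bar>y b - y a + (S b - S a)\<bar> / \<epsilon>" using e by (simp only: abs_divide abs_of_pos)
      also have "\<dots> \<le> \<epsilon> * (b - a) / \<epsilon>" using le e by (intro divide_right_mono) auto
      finally have "\<bar>V t - V s\<bar> \<le> b - a" using e by simp
      then show ?thesis by (simp add: a_def b_def abs_minus_commute)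
    qed
    show ?thesis using *[of s t] *[of t s] that by (cases "s \<le> t") (auto simp: abs_minus_commute)
  qed
  define V' where "V' t = V (max 0 (min T t))" for t
  have V'_eq: "V' t = V t" if "t \<in> {0..T}" for t using that by (simp add: V'_def min_absorb2 max_absorb2)
  have V': "V' \<in> control_primitives"
    unfolding V'_def[abs_def] by (rule control_primitive_extend[OF V0 T V_lip])
  have "sin (x r) = sin (x r - x T)" for r
    using sin_rcong[OF rcong_diff[OF rcong_refl[of "x r"] ends(1)]] by simp
  then have sin_X: "sin (x (T - s)) = sin (X s)" for s by (simp add: X_def)
  have rel: "relaxed_trajectory \<epsilon> T V' X Y"
    unfolding relaxed_trajectory_def
  proof (intro conjI ballI)
    show "X 0 = 0" "Y 0 = 0" "V' 0 = 0" using ends V0 V'_eq[of 0] T by (auto simp: X_def Y_def)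
    fix s assume s: "s \<in> {0..T}"
    show "(X has_real_derivative Y s) (at s within {0..T})"
      unfolding X_def[abs_def] Y_def using reflect[OF x s refl] by (auto intro!: derivative_eq_intros)
    have "((\<lambda>s. S (T - s) - S T) has_real_derivative - sin (X s)) (at s within {0..T})"
      using reflect[OF dS s refl] by (auto intro!: derivative_eq_intros simp: sin_X)
    then show "((\<lambda>t. Y t - \<epsilon> * V' t) has_real_derivative - sin (X s)) (at s within {0..T})"
      by (rule has_field_derivative_transform_within[of _ _ _ _ 1])
        (use s e in \<open>auto simp: V'_eq V_def Y_def field_simps\<close>)
  qed
  have M0: "0 \<le> M" using T M by simp
  obtain X' Y' where X': "relaxed_trajectory \<epsilon> M V' X' Y'" using relaxed_trajectory_exists[OF M0 V'] by blast
  \<comment> \<open>Uniqueness: the solution prolonged to \<open>{0..M}\<close> agrees with the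
    reversed trajectory at \<open>T\<close>.\<close>
  have "\<bar>X' T - X T\<bar> \<le> 0 * exp (2 * T)"
    by (rule relaxed_trajectory_stable[OF relaxed_trajectory_restrict[OF X' M] rel _ e]) (use T in auto)
  then have "X' T = x 0 - x T" by (simp add: X_def)
  with V' X' show ?thesis by blast
qed

lemma forward_of_relaxed:
  assumes e: "0 < \<epsilon>" and T: "0 \<le> T" and x: "relaxed_trajectory \<epsilon> T V x y"
    and V: "\<And>t. t \<in> {0..T} \<Longrightarrow> V t = - integral {0..t} (\<lambda>s. sgn (\<psi> s))"
    and c\<psi>: "continuous_on {0..T} \<psi>"
  shows "pendulum_trajectory \<epsilon> T (\<lambda>t. x (T - t)) (\<lambda>t. - y (T - t)) (\<lambda>t. - sgn (\<psi> (T - t)))"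
proof (rule pendulum_trajectoryI[OF T e])
  fix t assume t: "t \<in> {0..T}"
  show "\<bar>- sgn (\<psi> (T - t))\<bar> \<le> 1" by (simp add: sgn_if)
  have im: "(\<lambda>s. T - s) ` {0..T} = {0..T}"
    by (auto simp: image_iff intro!: bexI[of _ "T - _"])
  have 1: "(x has_real_derivative y (T - t)) (at (T - t) within (\<lambda>s. T - s) ` {0..T})"
    unfolding im using x t by (auto simp: relaxed_trajectory_def)
  have 2: "((\<lambda>s. T - s) has_real_derivative - 1) (at t within {0..T})"
    by (auto intro!: derivative_eq_intros)
  show "((\<lambda>t. x (T - t)) has_real_derivative - y (T - t)) (at t within {0..T})"
    using DERIV_image_chain[OF 1 2] by (simp add: o_def)
  define a where "a = T - t"
  have a: "0 \<le> a" "a \<le> T" using t by (auto simp: a_def)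
  have h1: "((\<lambda>s. - sin (x s)) has_integral ((y T - \<epsilon> * V T) - (y a - \<epsilon> * V a))) {a..T}"
  proof (rule fundamental_theorem_of_calculus[OF a(2)])
    fix r assume "r \<in> {a..T}"
    then have r: "r \<in> {0..T}" and sub: "{a..T} \<subseteq> {0..T}" using a by auto
    then have "((\<lambda>t. y t - \<epsilon> * V t) has_real_derivative - sin (x r)) (at r within {0..T})"
      using x unfolding relaxed_trajectory_def by blast
    from has_field_derivative_subset[OF this sub] show "((\<lambda>t. y t - \<epsilon> * V t) has_vector_derivative - sin (x r)) (at r within {a..T})"
      by (simp add: has_real_derivative_iff_has_vector_derivative)
  qed
  have h2: "((\<lambda>s. \<epsilon> * - sgn (\<psi> s)) has_integral \<epsilon> * (V T - V a)) {a..T}"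
  proof -
    have int: "(\<lambda>s. sgn (\<psi> s)) integrable_on {b..T}" if "0 \<le> b" for b
      by (intro integrable_sgn_continuous continuous_on_subset[OF c\<psi>]) (use that in auto)
    have "V T - V a = - integral {a..T} (\<lambda>s. sgn (\<psi> s))"
      using Henstock_Kurzweil_Integration.integral_combine[OF a int[OF order_refl]] V[of T] V[of a] a T by simp
    moreover have "((\<lambda>s. - sgn (\<psi> s)) has_integral - integral {a..T} (\<lambda>s. sgn (\<psi> s))) {a..T}"
      by (intro has_integral_neg integrable_integral int a)
    ultimately show ?thesis by (intro has_integral_mult_right) simp
  qed
  have "(y T - \<epsilon> * V T) - (y a - \<epsilon> * V a) + \<epsilon> * (V T - V a) = y T - y a" by (simp add: algebra_simps)
  with has_integral_add[OF h1 h2]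
  have "((\<lambda>s. - sin (x s) + \<epsilon> * - sgn (\<psi> s)) has_integral (y T - y a)) {a..T}" by (simp only:)
  then have "((\<lambda>s. - sin (x (- s)) + \<epsilon> * - sgn (\<psi> (- s))) has_integral (y T - y a)) {- T..- a}"
    by (rule has_integral_reflect_lemma_real)
  from has_integral_shift_real_ivl[OF this, of "- T"]
  have "((\<lambda>s. - sin (x (T - s)) + \<epsilon> * - sgn (\<psi> (T - s))) has_integral (y T - y a)) {0..t}"
    by (simp add: a_def)
  then show "((\<lambda>s. - sin (x (T - s)) + \<epsilon> * - sgn (\<psi> (T - s))) has_integral (- y (T - t) - - y (T - 0))) {0..t}"
    by (simp add: a_def)
qed

text \<open>The relaxed problem yields the control \<open>- sgn \<psi>\<close>, whereas the adjoint
  conditions ask for \<open>u = sgn \<psi>\<close>; hence the sign change of both adjoint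
  variables.\<close>

lemma adjoint_of_reversed:
  assumes \<psi>: "\<And>t. t \<in> {0..T} \<Longrightarrow> (\<psi> has_real_derivative \<zeta> t) (at t within {0..T})"
    and \<zeta>: "\<And>t. t \<in> {0..T} \<Longrightarrow> (\<zeta> has_real_derivative - cos (x t) * \<psi> t) (at t within {0..T})"
    and ham: "\<And>t. t \<in> {0..T} \<Longrightarrow> y t * \<zeta> t + sin (x t) * \<psi> t + \<epsilon> * \<bar>\<psi> t\<bar> = 1"
  shows "adjoint_variables \<epsilon> T (\<lambda>t. x (T - t)) (\<lambda>t. - y (T - t)) (\<lambda>t. - sgn (\<psi> (T - t)))
    (\<lambda>t. - \<zeta> (T - t)) (\<lambda>t. - \<psi> (T - t))"
  unfolding adjoint_variables_def
proof (intro conjI ballI impI)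
  fix t assume t: "t \<in> {0..T}"
  then have t': "T - t \<in> {0..T}" by auto
  have im: "(\<lambda>s. T - s) ` {0..T} = {0..T}"
    by (auto simp: image_iff intro!: bexI[of _ "T - _"])
  have d: "((\<lambda>s. T - s) has_real_derivative - 1) (at t within {0..T})"
    by (auto intro!: derivative_eq_intros)
  show "((\<lambda>t. - \<zeta> (T - t)) has_real_derivative cos (x (T - t)) * - \<psi> (T - t)) (at t within {0..T})"
    using DERIV_minus[OF DERIV_image_chain[OF _ d, of \<zeta>, unfolded im, OF \<zeta>[OF t']]] by (simp add: o_def)
  show "((\<lambda>t. - \<psi> (T - t)) has_real_derivative - (- \<zeta> (T - t))) (at t within {0..T})"
    using DERIV_minus[OF DERIV_image_chain[OF _ d, of \<psi>, unfolded im, OF \<psi>[OF t']]] by (simp add: o_def)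
  show "- sgn (\<psi> (T - t)) = sgn (- \<psi> (T - t))" by (simp add: sgn_minus)
  show "- y (T - t) * - \<zeta> (T - t) + (- sin (x (T - t)) + \<epsilon> * - sgn (\<psi> (T - t))) * - \<psi> (T - t) - 1 = 0"
    using ham[OF t'] by (simp add: algebra_simps abs_sgn mult.commute)
qed

lemma relaxed_minimizer_bang_bang:
  assumes e: "0 < \<epsilon>" "\<epsilon> \<le> 1" and K: "0 < K"
    and x: "relaxed_trajectory \<epsilon> M V x y" and V: "V \<in> control_primitives" and T: "0 < T" "T < M"
    and minimal: "\<forall>T'\<in>{0..M}. \<forall>V'\<in>control_primitives. \<forall>x' y'. relaxed_trajectory \<epsilon> M V' x' y' \<longrightarrow>
      T + K * (1 + cos (x T)) \<le> T' + K * (1 + cos (x' T'))"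
  obtains \<psi> \<zeta> where "\<And>t. t \<in> {0..T} \<Longrightarrow> (\<psi> has_real_derivative \<zeta> t) (at t within {0..T})"
    "\<And>t. t \<in> {0..T} \<Longrightarrow> (\<zeta> has_real_derivative - cos (x t) * \<psi> t) (at t within {0..T})"
    "\<And>t. t \<in> {0..T} \<Longrightarrow> y t * \<zeta> t + sin (x t) * \<psi> t + \<epsilon> * \<bar>\<psi> t\<bar> = 1"
    "\<And>t. t \<in> {0..T} \<Longrightarrow> V t = - integral {0..t} (\<lambda>s. sgn (\<psi> s))"
    "finite {t \<in> {0..T}. \<psi> t = 0}"
proof -
  note min = minimal[rule_format]
  have xT: "relaxed_trajectory \<epsilon> T V x y" by (rule relaxed_trajectory_restrict[OF x]) (use T in auto)
  have cx: "continuous_on {0..T} x" by (rule relaxed_trajectory_continuous(1)[OF xT V])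
  \<comment> \<open>Stationarity of the cost in the end time, which is interior to
    \<open>{0..M}\<close>. With \<open>\<psi> T = 0\<close> and
    \<open>\<zeta> T = K * sin (x T)\<close> it says that the Hamiltonian has the value 1 at
    \<open>T\<close>.\<close>
  have transversality: "K * sin (x T) * y T = 1"
  proof -
    have "(x has_real_derivative y T) (at T within {0..M})"
      using x T unfolding relaxed_trajectory_def by auto
    then have "(x has_real_derivative y T) (at T)" using T at_within_Icc_at[of 0 T M] by simp
    then have "((\<lambda>t. t + K * (1 + cos (x t))) has_real_derivative 1 - K * sin (x T) * y T) (at T)"
      by (auto intro!: derivative_eq_intros)
    then have "1 - K * sin (x T) * y T = 0"
    proof (rule DERIV_local_min)
      show "0 < min T (M - T)" using T by simp
      show "\<forall>s. \<bar>T - s\<bar> < min T (M - T) \<longrightarrow> T + K * (1 + cos (x T)) \<le> s + K * (1 + cos (x s))"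
        using T by (auto intro!: min[OF _ V x])
    qed
    then show ?thesis by simp
  qed
  have cz: "continuous_on {0..T} (\<lambda>t. x (T - t))"
    by (rule continuous_on_compose2[OF cx]) (auto intro!: continuous_intros)
  \<comment> \<open>The adjoint data are prescribed at the end, so the equation is solved in
    reflected time.\<close>
  obtain p q where pq: "p 0 = 0" "q 0 = - (K * sin (x T))"
    "\<And>t. t \<in> {0..T} \<Longrightarrow> (p has_real_derivative q t) (at t within {0..T})"
    "\<And>t. t \<in> {0..T} \<Longrightarrow> (q has_real_derivative - cos (x (T - t)) * p t) (at t within {0..T})"
  proof (rule lipschitz_ode_exists_planar[where T = T and L = 1 and f = "\<lambda>t p q. q" and g = "\<lambda>t p q. - cos (x (T - t)) * p"])
    show "\<bar>- cos (x (T - t)) * a - - cos (x (T - t)) * a'\<bar> \<le> 1 * (\<bar>a - a'\<bar> + \<bar>b - b'\<bar>)" for t a b a' b'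
    proof -
      have "- cos (x (T - t)) * a - - cos (x (T - t)) * a' = - cos (x (T - t)) * (a - a')" by (simp add: algebra_simps)
      also have "\<bar>\<dots>\<bar> \<le> 1 * \<bar>a - a'\<bar>" unfolding abs_mult by (intro mult_right_mono) auto
      finally show ?thesis by simp
    qed
  qed (use T in \<open>auto intro!: continuous_intros cz\<close>)
  define \<psi> \<zeta> where "\<psi> t = p (T - t)" and "\<zeta> t = - q (T - t)" for t
  have im: "(\<lambda>s. T - s) ` {0..T} = {0..T}"
    by (auto simp: image_iff intro!: bexI[of _ "T - _"])
  have d: "((\<lambda>s. T - s) has_real_derivative - 1) (at t within {0..T})" for t
    by (auto intro!: derivative_eq_intros)
  have d\<psi>: "(\<psi> has_real_derivative \<zeta> t) (at t within {0..T})" if "t \<in> {0..T}" for t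
    unfolding \<psi>_def[abs_def] \<zeta>_def
    using DERIV_image_chain[OF _ d[of t], of p, unfolded im, OF pq(3)] that by (simp add: o_def)
  have d\<zeta>: "(\<zeta> has_real_derivative - cos (x t) * \<psi> t) (at t within {0..T})" if "t \<in> {0..T}" for t
    unfolding \<zeta>_def[abs_def] \<psi>_def
    using DERIV_minus[OF DERIV_image_chain[OF _ d[of t], of q, unfolded im, OF pq(4)]] that by (simp add: o_def)
  have end_eq: "\<psi> T = 0" "\<zeta> T = K * sin (x T)" using pq by (auto simp: \<psi>_def \<zeta>_def)
  have c\<psi>: "continuous_on {0..T} \<psi>" and c\<zeta>: "continuous_on {0..T} \<zeta>"
    using DERIV_continuous_on[OF d\<psi>] DERIV_continuous_on[OF d\<zeta>] by auto
  have minT: "\<forall>V'\<in>control_primitives. \<forall>x' y'. relaxed_trajectory \<epsilon> T V' x' y' \<longrightarrow> K * cos (x T) \<le> K * cos (x' T)"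
  proof (intro ballI allI impI)
    fix V' x' y' assume V': "V' \<in> control_primitives" and x': "relaxed_trajectory \<epsilon> T V' x' y'"
    obtain X Y where X: "relaxed_trajectory \<epsilon> M V' X Y"
      using relaxed_trajectory_exists[of M V' \<epsilon>] V' T by auto
    have "\<bar>X T - x' T\<bar> \<le> 0 * exp (2 * T)"
      by (rule relaxed_trajectory_stable[OF relaxed_trajectory_restrict[OF X] x' _ e]) (use T in auto)
    then show "K * cos (x T) \<le> K * cos (x' T)" using min[OF _ V' X, of T] T by (simp add: algebra_simps)
  qed
  have nontriv: "\<psi> t \<noteq> 0 \<or> \<zeta> t \<noteq> 0" if t: "t \<in> {0..T}" for t
  proof (rule ccontr)
    assume "\<not> ?thesis"
    then have z: "\<psi> t = 0" "\<zeta> t = 0" by auto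
    \<comment> \<open>This weighted square cannot grow, so a common zero would persist up to
      \<open>T\<close>, where transversality excludes \<open>\<zeta> T = 0\<close>.\<close>
    define E where "E s = ((\<psi> s)\<^sup>2 + (\<zeta> s)\<^sup>2) * exp (- 2 * s)" for s
    have "E T - E t \<le> 0 * (T - t)"
    proof (rule diff_le_of_deriv_le[where f' = "\<lambda>s. (2 * \<psi> s * \<zeta> s * (1 - cos (x s)) - 2 * ((\<psi> s)\<^sup>2 + (\<zeta> s)\<^sup>2)) * exp (- 2 * s)"])
      fix s assume s: "s \<in> {t..T}"
      have sub: "{t..T} \<subseteq> {0..T}" using t by auto
      show "(E has_real_derivative (2 * \<psi> s * \<zeta> s * (1 - cos (x s)) - 2 * ((\<psi> s)\<^sup>2 + (\<zeta> s)\<^sup>2)) * exp (- 2 * s)) (at s within {t..T})"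
        unfolding E_def[abs_def]
        using has_field_derivative_subset[OF d\<psi> sub, of s] has_field_derivative_subset[OF d\<zeta> sub, of s] s sub
        by (auto intro!: derivative_eq_intros simp: algebra_simps power2_eq_square)
    next
      fix s :: real
      have "2 * \<psi> s * \<zeta> s * (1 - cos (x s)) \<le> \<bar>2 * \<psi> s * \<zeta> s\<bar> * \<bar>1 - cos (x s)\<bar>" by (metis abs_ge_self abs_mult)
      also have "\<dots> \<le> ((\<psi> s)\<^sup>2 + (\<zeta> s)\<^sup>2) * 2"
      proof (rule mult_mono)
        show "\<bar>2 * \<psi> s * \<zeta> s\<bar> \<le> (\<psi> s)\<^sup>2 + (\<zeta> s)\<^sup>2"
          using sum_squares_bound[of "\<bar>\<psi> s\<bar>" "\<bar>\<zeta> s\<bar>"] by (simp add: abs_mult)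
        show "\<bar>1 - cos (x s)\<bar> \<le> 2" using cos_ge_minus_one[of "x s"] cos_le_one[of "x s"] by simp
      qed auto
      finally show "(2 * \<psi> s * \<zeta> s * (1 - cos (x s)) - 2 * ((\<psi> s)\<^sup>2 + (\<zeta> s)\<^sup>2)) * exp (- 2 * s) \<le> 0"
        by (intro mult_nonpos_nonneg) auto
    qed (use t in auto)
    then have "((\<psi> T)\<^sup>2 + (\<zeta> T)\<^sup>2) * exp (- 2 * T) \<le> 0" using z by (simp add: E_def)
    then have "(\<zeta> T)\<^sup>2 \<le> 0" using end_eq(1) by (simp add: mult_le_0_iff)
    then have "\<zeta> T = 0" by simp
    then have "K * sin (x T) = 0" using end_eq by simp
    then show False using transversality by (simp only: mult_zero_left)
  qed
  have fin: "finite {t \<in> {0..T}. \<psi> t = 0}"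
  proof (rule finite_card_of_separated(1)[of _ 0 T])
    fix s t assume st: "s \<in> {t \<in> {0..T}. \<psi> t = 0}" "t \<in> {t \<in> {0..T}. \<psi> t = 0}" "s < t"
    then have sub: "{s..t} \<subseteq> {0..T}" by auto
    show "1 \<le> t - s"
      by (rule zeroes_separated[where f = \<psi> and g = \<zeta> and c = "\<lambda>t. cos (x t)"])
        (use st sub nontriv[of s] has_field_derivative_subset[OF d\<psi> sub] has_field_derivative_subset[OF d\<zeta> sub] in auto)
  qed auto
  have prim: "V t = - integral {0..t} (\<lambda>s. sgn (\<psi> s))" if t: "t \<in> {0..T}" for t
  proof (rule bang_bang_primitive[OF _ V d\<psi> c\<zeta> end_eq(1) fin _ t])
    show "integral {0..T} (\<lambda>t. \<zeta> t * (W t - V t)) \<le> 0" if "W \<in> control_primitives" for W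
      by (rule relaxed_first_order_condition[OF e _ _ V xT minT d\<psi> d\<zeta> end_eq that]) (use T K in auto)
  qed (use T in auto)
  have "y t * \<zeta> t + sin (x t) * \<psi> t + \<epsilon> * \<bar>\<psi> t\<bar> = 1" if t: "t \<in> {0..T}" for t
    using hamiltonian_constant[OF xT V prim d\<psi> d\<zeta> fin t] end_eq transversality by (simp add: mult_ac)
  then show thesis using that[OF d\<psi> d\<zeta> _ prim fin] by blast
qed

lemma N_sup_ge:
  assumes e: "0 < \<epsilon>" "\<epsilon> \<le> 1 / 2000"
  shows "ereal (1 / 24 / \<epsilon>) \<le> ereal_of_enat (N_sup \<epsilon>)"
proof -
  have e1: "\<epsilon> \<le> 1" using e by simp
  \<comment> \<open>The time bound for steering a resting pendulum to the origin. The reversed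
    manoeuvre from \<open>(pi, 0)\<close> has no penalty and costs at most \<open>K\<close>, so the
    minimal cost is at most \<open>K\<close>, which forces \<open>T \<le> K\<close> and
    \<open>K * cos (x T) \<le> 0\<close>.\<close>
  define K where "K = 60002 / \<epsilon>"
  \<comment> \<open>Larger than \<open>K\<close>, so that the minimal end time is interior to the
    time interval.\<close>
  define M where "M = 2 * K + 1"
  have K: "0 < K" "0 \<le> K" and M: "0 \<le> M" using e by (auto simp: K_def M_def)
  obtain T0 where T0: "T0 \<le> K" "steerable \<epsilon> T0 (pi, 0) (0, 0)"
    using steerable_rest_to_origin[OF e, of pi] unfolding K_def by blast
  then obtain x0 y0 u0 where 0: "pendulum_trajectory \<epsilon> T0 x0 y0 u0"
    "[x0 0 = pi] (rmod 2 * pi)" "[x0 T0 = 0] (rmod 2 * pi)" "y0 T0 = 0"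
    by (auto simp: steerable_def)
  have T0': "0 \<le> T0" "T0 \<le> M" using 0(1) T0(1) K by (auto simp: pendulum_trajectory_def M_def)
  obtain T V x y where T: "T \<in> {0..M}" and V: "V \<in> control_primitives" and x: "relaxed_trajectory \<epsilon> M V x y"
    and minimal: "\<forall>T'\<in>{0..M}. \<forall>V'\<in>control_primitives. \<forall>x' y'. relaxed_trajectory \<epsilon> M V' x' y' \<longrightarrow>
      T + K * (1 + cos (x T)) \<le> T' + K * (1 + cos (x' T'))"
    by (rule relaxed_minimizer_exists[OF e(1) e1 M K(2)])
  note min = minimal[rule_format]
  have "T + K * (1 + cos (x T)) \<le> K"
  proof -
    obtain V' X Y where X: "V' \<in> control_primitives" "relaxed_trajectory \<epsilon> M V' X Y" "X T0 = x0 0 - x0 T0"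
      using reversed_trajectory_relaxed[OF e(1) e1 0(1) 0(3,4) T0'(2)] by blast
    have "cos (X T0) = cos pi"
      using cos_rcong[OF rcong_diff[OF 0(2,3)]] X(3) by simp
    then show ?thesis using min[OF _ X(1,2), of T0] T0' T0(1) by simp
  qed
  moreover have "0 \<le> K * (1 + cos (x T))"
  proof -
    have "0 \<le> 1 + cos (x T)" using cos_ge_minus_one[of "x T"] by linarith
    then show ?thesis using K by simp
  qed
  ultimately have TK: "T \<le> K" and "K * cos (x T) \<le> 0" using T by (auto simp: distrib_left)
  then have cosT: "cos (x T) \<le> 0" using K by (simp add: mult_le_0_iff)
  have T_pos: "0 < T" "T < M"
    using cosT x T TK K by (auto simp: relaxed_trajectory_def M_def less_le)
  obtain \<psi> \<zeta> where d\<psi>: "\<And>t. t \<in> {0..T} \<Longrightarrow> (\<psi> has_real_derivative \<zeta> t) (at t within {0..T})"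
    and d\<zeta>: "\<And>t. t \<in> {0..T} \<Longrightarrow> (\<zeta> has_real_derivative - cos (x t) * \<psi> t) (at t within {0..T})"
    and ham: "\<And>t. t \<in> {0..T} \<Longrightarrow> y t * \<zeta> t + sin (x t) * \<psi> t + \<epsilon> * \<bar>\<psi> t\<bar> = 1"
    and prim: "\<And>t. t \<in> {0..T} \<Longrightarrow> V t = - integral {0..t} (\<lambda>s. sgn (\<psi> s))"
    and fin: "finite {t \<in> {0..T}. \<psi> t = 0}"
    by (rule relaxed_minimizer_bang_bang[OF e(1) e1 K(1) x V T_pos minimal]) (rule that, assumption+)
  have xT: "relaxed_trajectory \<epsilon> T V x y" by (rule relaxed_trajectory_restrict[OF x]) (use T in auto)
  have c\<psi>: "continuous_on {0..T} \<psi>" using d\<psi> by (rule DERIV_continuous_on)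
  let ?x = "\<lambda>t. x (T - t)" and ?y = "\<lambda>t. - y (T - t)" and ?u = "\<lambda>t. - sgn (\<psi> (T - t))"
  let ?\<phi> = "\<lambda>t. - \<zeta> (T - t)" and ?\<psi> = "\<lambda>t. - \<psi> (T - t)"
  \<comment> \<open>A competitor from the same initial angle, reversed, ends with the same cosine
    and pays the same penalty, so comparing costs compares times. A competitor slower than
    \<open>M\<close> is slower than \<open>T\<close> anyway.\<close>
  have opt: "optimal_trajectory \<epsilon> (x T) (- y T) T ?x ?y ?u"
    unfolding optimal_trajectory_def
  proof (intro conjI allI impI)
    show "steers_to_equilibrium \<epsilon> (x T) (- y T) T ?x ?y ?u"
      using forward_of_relaxed[OF e(1) _ xT prim c\<psi>] T_pos x
      by (auto simp: steers_to_equilibrium_def relaxed_trajectory_def)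
    fix T' x' y' u' assume st: "steers_to_equilibrium \<epsilon> (x T) (- y T) T' x' y' u'"
    then have st': "pendulum_trajectory \<epsilon> T' x' y' u'" "[x' 0 = x T] (rmod 2 * pi)" "[x' T' = 0] (rmod 2 * pi)" "y' T' = 0"
      by (auto simp: steers_to_equilibrium_def)
    show "T \<le> T'"
    proof (cases "T' \<le> M")
      case True
      obtain V' X Y where X: "V' \<in> control_primitives" "relaxed_trajectory \<epsilon> M V' X Y" "X T' = x' 0 - x' T'"
        using reversed_trajectory_relaxed[OF e(1) e1 st'(1,3,4) True] by blast
      have "cos (X T') = cos (x T)"
        using cos_rcong[OF rcong_diff[OF st'(2,3)]] X(3) by simp
      then show ?thesis using min[OF _ X(1,2), of T'] True st'(1) by (simp add: pendulum_trajectory_def)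
    qed (use T in auto)
  qed
  have adj: "adjoint_variables \<epsilon> T ?x ?y ?u ?\<phi> ?\<psi>"
    by (rule adjoint_of_reversed[OF d\<psi> d\<zeta> ham])
  have energy: "(y t)\<^sup>2 / 2 + (1 - cos (x t)) + 1 / 2 \<le> exp (\<epsilon> * t) / 2" if "t \<in> {0..T}" for t
    by (rule energy_growth[OF xT V e(1) prim c\<psi> fin that])
  have exp_half: "exp (1 / 2 :: real) \<le> 2"
  proof -
    have "(exp (1 / 2 :: real))\<^sup>2 = exp 1" by (simp flip: exp_double)
    also have "\<dots> \<le> 2\<^sup>2" using exp_le by simp
    finally show ?thesis by (rule power2_le_imp_le) simp
  qed
  have cos_half: "1 / 2 \<le> cos (x t)" if t: "t \<in> {0..T}" "t \<le> 1 / (2 * \<epsilon>)" for t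
  proof -
    have "\<epsilon> * t \<le> 1 / 2" using t e by (simp add: field_simps)
    then have "exp (\<epsilon> * t) \<le> 2" using exp_half by (meson exp_le_cancel_iff order_trans)
    then show ?thesis using energy[OF t(1)] zero_le_power2[of "y t"] by argo
  qed
  \<comment> \<open>Up to \<open>1 / (2 * \<epsilon>)\<close> the energy is at most
    \<open>1 / 2\<close>, which keeps the cosine at \<open>1 / 2\<close> or above; the end point has
    cosine at most 0.\<close>
  have long: "1 / (2 * \<epsilon>) < T" using cos_half[of T] cosT T_pos by fastforce
  \<comment> \<open>The number of slots of length 6 that fit into
    \<open>1 / (2 * \<epsilon>)\<close>. Each holds a Sturm window of length 5, and the gap of 1
    keeps the zeroes found in different windows distinct.\<close>
  define n where "n = nat \<lfloor>1 / (12 * \<epsilon>)\<rfloor>"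
  have n: "real n \<le> 1 / (12 * \<epsilon>)" "1 / (12 * \<epsilon>) - 1 \<le> real n" using e by (auto simp: n_def)
  have "\<exists>z\<in>{6 * real i..6 * real i + 5}. \<psi> z = 0" if i: "i < n" for i
  proof -
    have "6 * real i + 6 \<le> 6 * real n" using i by simp
    also have "\<dots> \<le> 1 / (2 * \<epsilon>)" using mult_left_mono[OF n(1), of 6] by simp
    finally have le: "6 * real i + 5 \<le> 1 / (2 * \<epsilon>)" by simp
    have sub: "{6 * real i..6 * real i + 5} \<subseteq> {0..T}" using le long by auto
    show ?thesis
      by (rule sturm_zero[OF has_field_derivative_subset[OF d\<psi> sub] has_field_derivative_subset[OF d\<zeta> sub] cos_half])
        (use sub le in auto)
  qed
  then obtain z where z: "\<And>i. i < n \<Longrightarrow> 6 * real i \<le> z i \<and> z i \<le> 6 * real i + 5 \<and> \<psi> (z i) = 0"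
    by (metis atLeastAtMost_iff)
  define Z where "Z = {t \<in> {0..T}. ?\<psi> t = 0}"
  have "inj_on (\<lambda>i. T - z i) {..<n}"
  proof (rule inj_onI)
    fix i j assume "i \<in> {..<n}" "j \<in> {..<n}" "T - z i = T - z j"
    then have "6 * real i \<le> 6 * real j + 5" "6 * real j \<le> 6 * real i + 5" using z[of i] z[of j] by auto
    then show "i = j" by linarith
  qed
  moreover have "(\<lambda>i. T - z i) ` {..<n} \<subseteq> Z"
  proof safe
    fix i assume i: "i < n"
    have "6 * real i + 6 \<le> 6 * real n" using i by simp
    also have "\<dots> \<le> 1 / (2 * \<epsilon>)" using mult_left_mono[OF n(1), of 6] by simp
    finally show "T - z i \<in> Z" using z[OF i] long by (auto simp: Z_def)
  qed
  ultimately have "finite Z \<Longrightarrow> n \<le> card Z" using card_inj_on_le by fastforce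
  then have "enat n \<le> num_zeroes T ?\<psi>"
    unfolding num_zeroes_def Let_def Z_def[symmetric] by simp
  also have "\<dots> \<le> N_point \<epsilon> (x T) (- y T)"
    unfolding N_point_def by (rule Sup_upper) (use opt adj in blast)
  also have "\<dots> \<le> N_sup \<epsilon>"
    unfolding N_sup_def by (rule SUP_upper2[of "(x T, - y T)"]) auto
  finally have "ereal_of_enat (enat n) \<le> ereal_of_enat (N_sup \<epsilon>)" by (simp only: ereal_of_enat_le_iff)
  moreover have "1 / 24 / \<epsilon> \<le> real n"
  proof -
    have "1 \<le> 1 / 24 / \<epsilon>" using e by (simp add: field_simps)
    then show ?thesis using n(2) by simp
  qed
  ultimately show ?thesis by (metis ereal_less_eq(3) ereal_of_enat_simps(1) order_trans)
qed

theorem theorem1p2: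
  shows "\<exists>c1 c2 :: real. c1 > 0 \<and> c2 > 0 \<and>
    (\<exists>\<epsilon>0 > 0. \<forall>\<epsilon> :: real. 0 < \<epsilon> \<and> \<epsilon> < \<epsilon>0 \<longrightarrow>
       ereal (c1 / \<epsilon>) \<le> ereal_of_enat (N_sup \<epsilon>) \<and>
       ereal_of_enat (N_sup \<epsilon>) \<le> ereal (c2 / \<epsilon>))"
proof (intro exI conjI allI impI)
  show "(0 :: real) < 1 / 24" "(0 :: real) < 60004" "(0 :: real) < 1 / 2000" by simp_all
  fix \<epsilon> :: real assume "0 < \<epsilon> \<and> \<epsilon> < 1 / 2000"
  then show "ereal (1 / 24 / \<epsilon>) \<le> ereal_of_enat (N_sup \<epsilon>)" "ereal_of_enat (N_sup \<epsilon>) \<le> ereal (60004 / \<epsilon>)"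
    using N_sup_ge[of \<epsilon>] N_sup_le[of \<epsilon>] by auto
qed

end
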